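(* Let $s\in\mathbb{C}$ with $\Re s>-1/2$. For $t>0$ let $F_N(t)$ be the Fredholm determinant associated with $K_{[N]}$ and let $F_\infty(t)$ be the Fredholm determinant associated with $K_\infty$. Then $F_N$ (for every integer $N\ge 1$) and $F_\infty$ are in $\mathcal{C}^3(\mathbb{R}_+^*,\mathbb{R})$, and for every $p\in\{0,1,2,3\}$ the $p$-th derivative of $F_N$ with respect to $t$ converges pointwise on $\mathbb{R}_+^*$, as $N\to\infty$, to the $p$-th derivative of $F_\infty$.
   Context: Notation: $\mathbb{R}^*=\mathbb{R}\setminus\{0\}$, $\mathbb{R}_+^*=(0,\infty)$; $(x)_0=1$, $(x)_n=x(x+1)\cdots(x+n-1)$; ${}_2F_1[a,b,c;x]=\sum_{n\ge0}\frac{(a)_n(b)_n}{(c)_n n!}x^n$; ${}_1F_1[r,q;x]=\sum_{n\ge0}\frac{(r)_n}{(q)_n n!}x^n$. Here $s\in\mathbb{C}$ with $\Re s>-1/2$ is fixed and $N\geq 1$ is an integer. Finite-$N$ kernel. For $x\in\mathbb{R}$ put $w_H(x)=(1+ix)^{-s-N}(1-ix)^{-\overline{s}-N}=(1+x^2)^{-\Re s-N}e^{2\Im s\,\mathrm{Arg}(1+ix)}$ (principal branches), $p_{N-1}(x)=(x-i)^{N-1}{}_2F_1\left[-(N-1),s+1,2\Re s+2;\frac{2}{1+ix}\right]$, $\tilde p_N(x)=(x-i)^N{}_2F_1\left[-N,s,2\Re s+1;\frac{2}{1+ix}\right]$ (both are polynomials), and $C=\frac{2^{2\Re s}}{\pi}\frac{\Gamma(2\Re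 s+N+1)\Gamma(s+1)\Gamma(\overline s+1)}{\Gamma(N)\Gamma(2\Re s+1)\Gamma(2\Re s+2)}$. For $x\ne y$ real, $K_N(x,y)=C\,\frac{\tilde p_N(x)p_{N-1}(y)-p_{N-1}(x)\tilde p_N(y)}{x-y}\sqrt{w_H(x)w_H(y)}$, and $K_N(x,x)=C\,(\tilde p_N'(x)p_{N-1}(x)-\tilde p_N(x)p_{N-1}'(x))\,w_H(x)$. The rescaled kernel is $K_{[N]}(x,y)=N K_N(Nx,Ny)$. Limiting kernel. For $x\in\mathbb{R}^*$ put $\tilde P(x)=|2/x|^{\Re s}e^{-i/x+\pi\Im s\,\mathrm{Sgn}(x)/2}\,{}_1F_1[s,2\Re s+1;2i/x]$, $Q(x)=(2/x)|2/x|^{\Re s}e^{-i/x+\pi\Im s\,\mathrm{Sgn}(x)/2}\,{}_1F_1[s+1,2\Re s+2;2i/x]$. With $c_s=\frac{1}{2\pi}\frac{\Gamma(s+1)\Gamma(\overline s+1)}{\Gamma(2\Re s+1)\Gamma(2\Re s+2)}$, set $K_\infty(x,y)=c_s\frac{\tilde P(x)Q(y)-Q(x)\tilde P(y)}{x-y}$ for $x\neq y$ in $\mathbb{R}^*$, and $K_\infty(x,x)=c_s(\tilde P'(x)Q(x)-Q'(x)\tilde P(x))$. Fredholm determinant. For a kernel $K$ on $(\mathbb{R}_+^* )^2$, with $\rho_k(x_1,\dots,x_k)=\det(K(x_i,x_j))_{1\le i,j\le k}$, the Fredholm determinant associated with $K$ is the function of $t>0$: $F(t)=1+\sum_{k\ge1}\frac{(-1)^k}{k!}\int_{(t,\infty)^k}\rho_k(x_1,\dots,x_k)\,dx_1\cdots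 dx_k$. *)

theory Defs
  imports "HOL-Analysis.Analysis" "Jordan_Normal_Form.Determinant"
begin

text \<open>The unqualified names \<open>mat\<close> and \<open>det\<close> exist in HOL-Analysis (dimension given by a type) and
  in Jordan_Normal_Form (dimension given by a number); the latter are meant below and are written
  \<open>Matrix.mat\<close> and \<open>Determinant.det\<close>.\<close>

section \<open>Hypergeometric series\<close>

definition hyp2F1 :: "complex \<Rightarrow> complex \<Rightarrow> complex \<Rightarrow> complex \<Rightarrow> complex" where
  "hyp2F1 a b c x =
     (\<Sum>n. pochhammer a n * pochhammer b n / (pochhammer c n * fact n) * x ^ n)"

definition hyp1F1 :: "complex \<Rightarrow> complex \<Rightarrow> complex \<Rightarrow> complex" where
  "hyp1F1 r q x = (\<Sum>n. pochhammer r n / (pochhammer q n * fact n) * x ^ n)"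


section \<open>The kernel for finite N\<close>

definition w_H :: "complex \<Rightarrow> nat \<Rightarrow> real \<Rightarrow> real" where
  "w_H s N x = (1 + x\<^sup>2) powr (- Re s - real N) * exp (2 * Im s * Arg (1 + \<i> * of_real x))"

lemma w_H_eq_powr:
  "complex_of_real (w_H s N x) =
     (1 + \<i> * of_real x) powr (- s - of_nat N) * (1 - \<i> * of_real x) powr (- cnj s - of_nat N)"
proof -
  define z where "z = 1 + \<i> * complex_of_real x"
  have z0: "z \<noteq> 0" and cz: "1 - \<i> * complex_of_real x = cnj z"
    by (auto simp: z_def complex_eq_iff)
  have nr: "z \<notin> \<real>\<^sub>\<le>\<^sub>0"
    by (auto simp: z_def complex_nonpos_Reals_iff)
  have n: "(cmod z)\<^sup>2 = 1 + x\<^sup>2"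
    by (simp add: z_def cmod_power2)
  have p: "0 < 1 + x\<^sup>2"
    by (simp add: add_pos_nonneg)
  have ln2: "ln (1 + x\<^sup>2) = 2 * ln (cmod z)"
    using z0 by (simp add: n [symmetric] ln_realpow)
  have L: "Ln z = Complex (ln (cmod z)) (Arg z)"
    using z0 by (simp add: complex_eq_iff Arg_eq_Im_Ln)
  have "(1 + \<i> * of_real x) powr (- s - of_nat N) * (1 - \<i> * of_real x) powr (- cnj s - of_nat N)
      = exp ((- s - of_nat N) * Ln z + (- cnj s - of_nat N) * cnj (Ln z))"
    using z0 nr by (simp add: cz powr_def exp_add cnj_Ln flip: z_def)
  also have "(- s - of_nat N) * Ln z + (- cnj s - of_nat N) * cnj (Ln z)
      = of_real ((- Re s - real N) * ln (1 + x\<^sup>2) + 2 * Im s * Arg z)"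
    by (simp add: L ln2 complex_eq_iff algebra_simps)
  also have "exp (of_real ((- Re s - real N) * ln (1 + x\<^sup>2) + 2 * Im s * Arg z))
      = complex_of_real (w_H s N x)"
    using p by (simp only: exp_of_real) (simp add: w_H_def powr_def exp_add z_def)
  finally show ?thesis by simp
qed

text \<open>On the real line \<open>p_tilde\<close> is in general not real-valued (it is a real function plus a complex
  multiple of \<open>p_pred\<close>), so the kernels below are complex-valued functions.\<close>

definition p_pred :: "complex \<Rightarrow> nat \<Rightarrow> real \<Rightarrow> complex" where
  "p_pred s N x = (of_real x - \<i>) ^ (N - 1) *
     hyp2F1 (- of_nat (N - 1)) (s + 1) (of_real (2 * Re s + 2)) (2 / (1 + \<i> * of_real x))"

definition p_tilde :: "complex \<Rightarrow> nat \<Rightarrow> real \<Rightarrow> complex" where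
  "p_tilde s N x = (of_real x - \<i>) ^ N *
     hyp2F1 (- of_nat N) s (of_real (2 * Re s + 1)) (2 / (1 + \<i> * of_real x))"

definition C_const :: "complex \<Rightarrow> nat \<Rightarrow> complex" where
  "C_const s N = of_real (2 powr (2 * Re s) / pi) *
     (Gamma (of_real (2 * Re s + real N + 1)) * Gamma (s + 1) * Gamma (cnj s + 1)) /
     (Gamma (of_nat N) * Gamma (of_real (2 * Re s + 1)) * Gamma (of_real (2 * Re s + 2)))"

definition K_fin :: "complex \<Rightarrow> nat \<Rightarrow> real \<Rightarrow> real \<Rightarrow> complex" where
  "K_fin s N x y =
     (if x \<noteq> y
      then C_const s N *
             ((p_tilde s N x * p_pred s N y - p_pred s N x * p_tilde s N y) / of_real (x - y)) *
             of_real (sqrt (w_H s N x * w_H s N y))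
      else C_const s N *
             (vector_derivative (p_tilde s N) (at x) * p_pred s N x
              - p_tilde s N x * vector_derivative (p_pred s N) (at x)) *
             of_real (w_H s N x))"

definition K_resc :: "complex \<Rightarrow> nat \<Rightarrow> real \<Rightarrow> real \<Rightarrow> complex" where
  "K_resc s N x y = of_nat N * K_fin s N (real N * x) (real N * y)"


section \<open>The limiting kernel\<close>

definition P_tilde :: "complex \<Rightarrow> real \<Rightarrow> complex" where
  "P_tilde s x = of_real (\<bar>2 / x\<bar> powr Re s) *
     exp (- \<i> / of_real x + of_real (pi * Im s * sgn x / 2)) *
     hyp1F1 s (of_real (2 * Re s + 1)) (2 * \<i> / of_real x)"

definition Q_lim :: "complex \<Rightarrow> real \<Rightarrow> complex" where
  "Q_lim s x = of_real (2 / x * \<bar>2 / x\<bar> powr Re s) *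
     exp (- \<i> / of_real x + of_real (pi * Im s * sgn x / 2)) *
     hyp1F1 (s + 1) (of_real (2 * Re s + 2)) (2 * \<i> / of_real x)"

definition c_const :: "complex \<Rightarrow> complex" where
  "c_const s = of_real (1 / (2 * pi)) * (Gamma (s + 1) * Gamma (cnj s + 1)) /
     (Gamma (of_real (2 * Re s + 1)) * Gamma (of_real (2 * Re s + 2)))"

text \<open>Meaningful for non-zero arguments only.\<close>

definition K_infty :: "complex \<Rightarrow> real \<Rightarrow> real \<Rightarrow> complex" where
  "K_infty s x y =
     (if x \<noteq> y
      then c_const s * ((P_tilde s x * Q_lim s y - Q_lim s x * P_tilde s y) / of_real (x - y))
      else c_const s *
             (vector_derivative (P_tilde s) (at x) * Q_lim s x
              - vector_derivative (Q_lim s) (at x) * P_tilde s x))"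


section \<open>Fredholm determinants\<close>

text \<open>Points of \<open>(t,\<infinity>)\<^sup>k\<close> are functions on \<open>{..<k}\<close>, so the variables are numbered from 0.\<close>

definition rho :: "(real \<Rightarrow> real \<Rightarrow> complex) \<Rightarrow> nat \<Rightarrow> (nat \<Rightarrow> real) \<Rightarrow> complex" where
  "rho K k x = Determinant.det (Matrix.mat k k (\<lambda>(i, j). K (x i) (x j)))"

definition fredholm_term :: "(real \<Rightarrow> real \<Rightarrow> complex) \<Rightarrow> real \<Rightarrow> nat \<Rightarrow> complex" where
  "fredholm_term K t k = (- 1) ^ k / fact k *
     set_lebesgue_integral (Pi\<^sub>M {..<k} (\<lambda>_. lborel)) (Pi\<^sub>E {..<k} (\<lambda>_. {t<..})) (rho K k)"

definition fredholm_det :: "(real \<Rightarrow> real \<Rightarrow> complex) \<Rightarrow> real \<Rightarrow> complex" where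
  "fredholm_det K t = 1 + (\<Sum>k. fredholm_term K t (Suc k))"

text \<open>Non-integrable functions have integral 0 and \<open>suminf\<close> is unspecified for divergent series, so
  \<open>fredholm_det K t\<close> is the intended number only under the following condition.\<close>

definition fredholm_converges :: "(real \<Rightarrow> real \<Rightarrow> complex) \<Rightarrow> real \<Rightarrow> bool" where
  "fredholm_converges K t \<longleftrightarrow>
     (\<forall>k\<ge>1. set_integrable (Pi\<^sub>M {..<k} (\<lambda>_. lborel)) (Pi\<^sub>E {..<k} (\<lambda>_. {t<..})) (rho K k)) \<and>
     summable (\<lambda>k. fredholm_term K t (Suc k))"


section \<open>Functions of class \<open>C\<^sup>m\<close>\<close>

text \<open>For open \<open>S\<close>: the derivatives of order up to \<open>m\<close> exist and are continuous on \<open>S\<close>.\<close>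

definition C_class_on :: "nat \<Rightarrow> real set \<Rightarrow> (real \<Rightarrow> real) \<Rightarrow> bool" where
  "C_class_on m S f \<longleftrightarrow>
     (\<forall>j<m. \<forall>x\<in>S. (deriv ^^ j) f field_differentiable at x) \<and>
     (\<forall>j\<le>m. continuous_on S ((deriv ^^ j) f))"

end

theory Submission
  imports Defs "HOL-Complex_Analysis.Complex_Analysis" "Jordan_Normal_Form.Schur_Decomposition"
begin

text \<open>
  Both kernels have the form \<open>c (P(x) Q(y) - Q(x) P(y)) / (x - y)\<close>. In the coordinates
  \<open>\<xi> = 1/x\<close>, \<open>\<eta> = 1/y\<close> the functions \<open>P\<close> and \<open>Q\<close> are the powers \<open>x\<^sup>-\<^sup>\<sigma>\<close> and
  \<open>x\<^sup>-\<^sup>\<sigma>\<^sup>-\<^sup>1\<close>, with \<open>\<sigma> = Re s\<close>, times functions that are holomorphic in the strip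
  \<open>\<bar>Im \<xi>\<bar> < 1\<close>. Hence, for \<open>x, y > 0\<close>,
  \<open>K(x,y) = (xy)\<^sup>-\<^sup>\<sigma>\<^sup>-\<^sup>1 (f(\<xi>) h(\<eta>) - h(\<xi>) f(\<eta>)) / (\<eta> - \<xi>)\<close>
  with \<open>f\<close> and \<open>h\<close> holomorphic in the strip (\<open>K_resc_eq_reciprocal_kernel\<close>,
  \<open>K_infty_eq_reciprocal_kernel\<close>); the singularity at \<open>\<xi> = \<eta>\<close> is removable.

  Substituting \<open>x\<^sub>i = t y\<^sub>i\<close> moves the integrals in the Fredholm determinant to the fixed domain
  \<open>(1,\<infinity>)\<^sup>k\<close>. With \<open>z = 1/t\<close>, the factor \<open>y\<^sup>-\<^sup>2\<^sup>\<sigma>\<^sup>-\<^sup>2\<close> becomes an integrable weight, since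
  \<open>\<sigma> > -1/2\<close>, and what is left in the determinant,
  \<open>z\<^sup>2\<^sup>\<sigma>\<^sup>+\<^sup>1 (f(z/y) h(z/y') - h(z/y) f(z/y')) / (z/y' - z/y)\<close>, is holomorphic in \<open>z\<close> for
  \<open>Re z > 0\<close>, \<open>\<bar>Im z\<bar> < 1\<close> and bounded for \<open>y, y' > 1\<close>, locally uniformly in \<open>z\<close>. Hadamard's inequality bounds the
  \<open>k\<close>-th term by \<open>C\<^sup>k k\<^sup>k\<^sup>/\<^sup>2 / k!\<close>, so the series converges locally uniformly in \<open>z\<close> and the
  Fredholm determinant extends to a holomorphic function of \<open>t\<close> in a neighbourhood of the positive
  half-line. This already gives smoothness.

  For the convergence, the pairs \<open>(f, h)\<close> that belong to \<open>N\<close> converge pointwise to the pair of the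
  limiting kernel and are, for large \<open>N\<close>, uniformly bounded on compact subsets of the strip
  (\<open>fin_converges\<close>). This mode of convergence, called \<open>boundedly_converges\<close> below, passes to
  derivatives by Cauchy's integral formula and to the Fredholm determinants by dominated convergence
  (\<open>kernel_fredholm_converges\<close>). Applied to the determinants, Cauchy's formula then yields the
  convergence of every derivative.

  Finally \<open>K\<^sub>[\<^sub>N\<^sub>]\<close> is real, because \<open>p_pred\<close> is real on the real line while \<open>p_tilde\<close> differs
  from its conjugate by a multiple of \<open>p_pred\<close>, which drops out of the antisymmetric numerator.
  The limiting determinant is real as a limit of real numbers.
\<close>


section \<open>Hadamard's inequality\<close>

lemma sum_diag_mult_comm:
  fixes A B :: "'a::comm_ring_1 Matrix.mat"
  assumes A: "A \<in> carrier_mat n n" and B: "B \<in> carrier_mat n n"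
  shows "(\<Sum>i<n. (A * B) $$ (i,i)) = (\<Sum>i<n. (B * A) $$ (i,i))"
proof -
  have e: "(\<Sum>i<n. (X * Y) $$ (i,i)) = (\<Sum>i<n. \<Sum>k<n. X $$ (i,k) * Y $$ (k,i))"
    if "X \<in> carrier_mat n n" "Y \<in> carrier_mat n n" for X Y :: "'a Matrix.mat"
    using that by (auto simp: scalar_prod_def atLeast0LessThan intro!: sum.cong)
  show ?thesis
    unfolding e[OF A B] e[OF B A] by (subst sum.swap) (simp add: mult.commute)
qed

lemma similar_mat_sum_diag:
  fixes A B :: "'a::comm_ring_1 Matrix.mat"
  assumes A: "A \<in> carrier_mat n n" and s: "similar_mat_wit A B P Q"
  shows "(\<Sum>i<n. A $$ (i,i)) = (\<Sum>i<n. B $$ (i,i))"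
proof -
  from similar_mat_witD2[OF A s]
  have w: "Q * P = 1\<^sub>m n" "A = P * B * Q" "B \<in> carrier_mat n n" "P \<in> carrier_mat n n" "Q \<in> carrier_mat n n"
    by auto
  have "(\<Sum>i<n. A $$ (i,i)) = (\<Sum>i<n. (P * (B * Q)) $$ (i,i))"
    using w by (simp add: assoc_mult_mat[of _ n n _ n _ n])
  also have "\<dots> = (\<Sum>i<n. (B * Q * P) $$ (i,i))"
    using w by (intro sum_diag_mult_comm) auto
  also have "B * Q * P = B"
    using w by (simp add: assoc_mult_mat[of _ n n _ n _ n])
  finally show ?thesis .
qed

text \<open>If \<open>A\<^sup>* A v = l v\<close>, pairing with \<open>v\<close> gives \<open>l \<parallel>v\<parallel>\<^sup>2 = \<parallel>A v\<parallel>\<^sup>2\<close>.\<close>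

lemma gram_eigenvalue_nonneg:
  fixes A :: "complex Matrix.mat" and l :: complex
  assumes A: "A \<in> carrier_mat n n"
    and l: "eigenvalue (transpose_mat (map_mat cnj A) * A) l"
  shows "l = of_real (Re l)" "0 \<le> Re l"
proof -
  define C where "C = transpose_mat (map_mat cnj A) * A"
  have C: "C \<in> carrier_mat n n" using A by (auto simp: C_def)
  have Cij: "C $$ (i,j) = (\<Sum>k<n. cnj (A $$ (k,i)) * A $$ (k,j))" if "i < n" "j < n" for i j
    using A that by (auto simp: C_def scalar_prod_def atLeast0LessThan intro!: sum.cong)
  from l obtain v where v: "v \<in> carrier_vec n" "v \<noteq> 0\<^sub>v n" "C *\<^sub>v v = l \<cdot>\<^sub>v v"
    using C unfolding C_def[symmetric] eigenvalue_def eigenvector_def by auto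
  define f where "f = vec_index v"
  have Cv: "(\<Sum>j<n. C $$ (i,j) * f j) = l * f i" if "i < n" for i
  proof -
    have "vec_index (C *\<^sub>v v) i = (\<Sum>j<n. C $$ (i,j) * f j)"
      using that C v(1) by (auto simp: scalar_prod_def atLeast0LessThan f_def)
    then show ?thesis using that v(1) by (simp add: v(3) f_def)
  qed
  define S where "S = (\<Sum>i<n. (cmod (f i))\<^sup>2)"
  define T where "T = (\<Sum>k<n. (cmod (\<Sum>j<n. A $$ (k,j) * f j))\<^sup>2)"
  have "l * of_real S = (\<Sum>i<n. cnj (f i) * (l * f i))"
    unfolding S_def of_real_sum complex_norm_square sum_distrib_left
    by (intro sum.cong refl) (simp only: mult_ac)
  also have "\<dots> = (\<Sum>i<n. cnj (f i) * (\<Sum>j<n. C $$ (i,j) * f j))"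
    by (intro sum.cong refl) (simp add: Cv)
  also have "\<dots> = (\<Sum>i<n. \<Sum>j<n. \<Sum>k<n. (cnj (A $$ (k,i) * f i)) * (A $$ (k,j) * f j))"
    by (intro sum.cong refl) (auto simp: Cij sum_distrib_left sum_distrib_right mult_ac intro!: sum.cong)
  also have "\<dots> = (\<Sum>i<n. \<Sum>k<n. \<Sum>j<n. (cnj (A $$ (k,i) * f i)) * (A $$ (k,j) * f j))"
    by (intro sum.cong refl sum.swap)
  also have "\<dots> = (\<Sum>k<n. \<Sum>i<n. \<Sum>j<n. (cnj (A $$ (k,i) * f i)) * (A $$ (k,j) * f j))"
    by (rule sum.swap)
  also have "\<dots> = (\<Sum>k<n. of_real ((cmod (\<Sum>j<n. A $$ (k,j) * f j))\<^sup>2))"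
    by (intro sum.cong refl)
       (simp add: complex_norm_square sum_distrib_left sum_distrib_right mult_ac del: of_real_power)
  also have "\<dots> = of_real T" by (simp add: T_def)
  finally have lST: "l * of_real S = of_real T" .
  have "\<exists>i<n. f i \<noteq> 0"
  proof (rule ccontr)
    assume "\<not> ?thesis"
    then have "v = 0\<^sub>v n" using v(1) by (intro eq_vecI) (auto simp: f_def)
    with v(2) show False by simp
  qed
  then have "S > 0" unfolding S_def by (intro sum_pos2[where i = "SOME i. i < n \<and> f i \<noteq> 0"]) (use someI_ex[of "\<lambda>i. i < n \<and> f i \<noteq> 0"] in auto)
  have "T \<ge> 0" by (simp add: T_def sum_nonneg)
  have "l = of_real (T / S)" using lST \<open>S > 0\<close> by (simp add: field_simps)
  then show "l = of_real (Re l)" "0 \<le> Re l" using \<open>S > 0\<close> \<open>T \<ge> 0\<close> by auto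
qed

lemma prod_le_mean_power:
  fixes x :: "nat \<Rightarrow> real"
  assumes "\<And>i. i < n \<Longrightarrow> 0 \<le> x i" and "n > 0"
  shows "(\<Prod>i<n. x i) \<le> ((\<Sum>i<n. x i) / n) ^ n"
proof -
  have "0 \<le> (\<Prod>i<n. x i)" using assms by (intro prod_nonneg) auto
  then have "(\<Prod>i<n. x i) = ((\<Prod>i<n. x i) powr (1 / n)) ^ n"
    using assms(2) by (cases "(\<Prod>i<n. x i) = 0") (simp_all only: powr_power powr_0 zero_power,
      simp_all add: powr_power)
  also have "\<dots> \<le> ((\<Sum>i<n. x i) / n) ^ n"
    using arith_geom_mean[of "{..<n}" x] assms
    by (intro power_mono) (auto simp: sum_divide_distrib lessThan_empty_iff)
  finally show ?thesis .
qed

text \<open>The eigenvalues of \<open>A\<^sup>* A\<close> are non-negative, their product is \<open>\<bar>det A\<bar>\<^sup>2\<close>, and their sum, the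
  trace, is the sum of the squared moduli of the entries of \<open>A\<close>, hence at most \<open>n\<^sup>2 B\<^sup>2\<close>. The
  inequality between the arithmetic and the geometric mean concludes. The eigenvalues are read off
  from a Schur decomposition.\<close>

lemma hadamard_det_bound:
  fixes A :: "complex Matrix.mat"
  assumes A: "A \<in> carrier_mat n n" and b: "\<And>i j. i < n \<Longrightarrow> j < n \<Longrightarrow> cmod (A $$ (i,j)) \<le> B"
  shows "(cmod (Determinant.det A))\<^sup>2 \<le> (real n * B\<^sup>2) ^ n"
proof (cases "n = 0")
  case True then show ?thesis using A by (simp add: det_dim_zero)
next
  case False
  define C where "C = transpose_mat (map_mat cnj A) * A"
  have C: "C \<in> carrier_mat n n" using A by (auto simp: C_def)
  interpret cnj_hom: comm_ring_hom cnj by unfold_locales auto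
  have "Determinant.det C = cnj (Determinant.det A) * Determinant.det A"
    using A by (simp add: C_def Determinant.det_mult[of _ n] det_transpose[of _ n] cnj_hom.hom_det)
  then have dC: "Determinant.det C = of_real ((cmod (Determinant.det A))\<^sup>2)"
    unfolding complex_norm_square by (simp only: mult.commute)
  obtain es where es: "char_poly C = (\<Prod>a\<leftarrow>es. [:- a, 1:])" "length es = n"
    using char_poly_factorized[OF C] by auto
  obtain D P Q where "schur_decomposition C es = (D, P, Q)" by (cases "schur_decomposition C es")
  from schur_decomposition[OF C es(1) this]
  have w: "similar_mat_wit C D P Q" and ut: "upper_triangular D" and dg: "diag_mat D = es" by auto
  have D: "D \<in> carrier_mat n n" using similar_mat_witD2[OF C w] by auto
  define x where "x i = Re (es ! i)" for i
  have ev: "eigenvalue C (es ! i)" if "i < n" for i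
  proof -
    have "poly (char_poly C) (es ! i) = 0"
      unfolding es(1) poly_prod_list prod_list_zero_iff using that es(2)
      by (auto simp: image_iff intro!: bexI[of _ "es ! i"])
    then show ?thesis using eigenvalue_root_char_poly[OF C] by simp
  qed
  have x: "es ! i = of_real (x i)" "0 \<le> x i" if "i < n" for i
    using gram_eigenvalue_nonneg[OF A ev[OF that, unfolded C_def]] by (auto simp: x_def)
  have esm: "es = map (\<lambda>i. of_real (x i)) [0..<n]"
    using x es(2) by (intro nth_equalityI) auto
  have "Determinant.det C = Determinant.det D"
    using w by (intro det_similar) (auto simp: similar_mat_def)
  also have "\<dots> = prod_list es" using det_upper_triangular[OF ut D] dg by simp
  also have "\<dots> = of_real (\<Prod>i<n. x i)"
    by (simp add: esm prod.distinct_set_conv_list[symmetric] atLeast0LessThan of_real_prod)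
  finally have p: "(cmod (Determinant.det A))\<^sup>2 = (\<Prod>i<n. x i)"
    unfolding dC of_real_eq_iff .
  have "(\<Sum>i<n. C $$ (i,i)) = (\<Sum>i<n. D $$ (i,i))" by (rule similar_mat_sum_diag[OF C w])
  also have "\<dots> = (\<Sum>i<n. es ! i)"
    using D by (intro sum.cong refl) (auto simp: dg[symmetric] diag_mat_def)
  also have "\<dots> = of_real (\<Sum>i<n. x i)" using x by simp
  finally have "of_real (\<Sum>i<n. x i) = (\<Sum>i<n. C $$ (i,i))" by simp
  also have "\<dots> = (\<Sum>i<n. \<Sum>k<n. of_real ((cmod (A $$ (k,i)))\<^sup>2))"
    using A by (intro sum.cong refl)
      (auto simp: C_def scalar_prod_def atLeast0LessThan complex_norm_square mult_ac simp del: of_real_power intro!: sum.cong)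
  also have "\<dots> = complex_of_real (\<Sum>i<n. \<Sum>k<n. (cmod (A $$ (k,i)))\<^sup>2)" by simp
  finally have t: "(\<Sum>i<n. x i) = (\<Sum>i<n. \<Sum>k<n. (cmod (A $$ (k,i)))\<^sup>2)"
    unfolding of_real_eq_iff .
  also have "\<dots> \<le> (\<Sum>i<n. \<Sum>k<n. B\<^sup>2)"
    by (intro sum_mono power_mono b) auto
  finally have "(\<Sum>i<n. x i) / n \<le> n * B\<^sup>2" using False by (simp add: field_simps)
  moreover have "0 \<le> (\<Sum>i<n. x i) / n" using x by (intro divide_nonneg_nonneg sum_nonneg) auto
  moreover have "(\<Prod>i<n. x i) \<le> ((\<Sum>i<n. x i) / n) ^ n"
    using x False by (intro prod_le_mean_power) auto
  ultimately show ?thesis unfolding p using power_mono[of "(\<Sum>i<n. x i) / n" "n * B\<^sup>2" n] by linarith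
qed

lemma det_mat_scale_rows_cols:
  fixes L :: "nat \<Rightarrow> nat \<Rightarrow> 'a::comm_ring_1"
  shows "Determinant.det (Matrix.mat k k (\<lambda>(i,j). a i * b j * L i j))
       = (\<Prod>i<k. a i) * (\<Prod>i<k. b i) * Determinant.det (Matrix.mat k k (\<lambda>(i,j). L i j))"
proof -
  have "(\<Prod>i = 0..<k. Matrix.mat k k (\<lambda>(i,j). a i * b j * L i j) $$ (i, p i))
      = (\<Prod>i<k. a i) * (\<Prod>i<k. b i) * (\<Prod>i = 0..<k. Matrix.mat k k (\<lambda>(i,j). L i j) $$ (i, p i))"
    if p: "p permutes {0..<k}" for p
  proof -
    have pl: "p i < k" if "i < k" for i using permutes_in_image[OF p, of i] that by auto
    have "(\<Prod>i = 0..<k. Matrix.mat k k (\<lambda>(i,j). a i * b j * L i j) $$ (i, p i))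
        = (\<Prod>i = 0..<k. a i * b (p i) * (Matrix.mat k k (\<lambda>(i,j). L i j) $$ (i, p i)))"
      using pl by (intro prod.cong) auto
    also have "\<dots> = (\<Prod>i=0..<k. a i) * (\<Prod>i=0..<k. b (p i)) * (\<Prod>i = 0..<k. Matrix.mat k k (\<lambda>(i,j). L i j) $$ (i, p i))"
      by (simp add: prod.distrib)
    also have "(\<Prod>i=0..<k. b (p i)) = (\<Prod>i=0..<k. b i)"
      using prod.permute[OF p, of b] by (simp add: o_def)
    finally show ?thesis by (simp add: atLeast0LessThan)
  qed
  then show ?thesis
    unfolding Determinant.det_def by (simp add: sum_distrib_left mult_ac)
qed

text \<open>From \<open>k\<^sup>k \<le> e\<^sup>k k!\<close>, a single term of the exponential series, the terms are at most
  \<open>(B e\<^sup>1\<^sup>/\<^sup>2)\<^sup>k / (k!)\<^sup>1\<^sup>/\<^sup>2\<close>, and the ratio test applies to these.\<close>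

lemma summable_hadamard_series:
  fixes B :: real
  assumes "B \<ge> 0"
  shows "summable (\<lambda>k. B ^ k * sqrt (real k ^ k) / fact k)"
proof (rule summable_comparison_test)
  define b where "b = B * exp (1/2)"
  have kk: "real k ^ k \<le> exp (real k) * fact k" for k :: nat
  proof -
    have "real k ^ k / fact k \<le> (\<Sum>n. real k ^ n / fact n)"
      using sum_le_suminf[OF summable_exp_generic[of "real k"], of "{k}"]
      by (simp add: divide_inverse mult.commute)
    also have "\<dots> = exp (real k)" by (simp add: exp_def divide_inverse mult.commute)
    finally show ?thesis by (simp add: divide_simps)
  qed
  have "norm (B ^ k * sqrt (real k ^ k) / fact k) \<le> b ^ k / sqrt (fact k)" for k
  proof -
    have "sqrt (real k ^ k) \<le> sqrt (exp (real k) * fact k)" by (rule real_sqrt_le_mono[OF kk])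
    also have "\<dots> = exp (1/2) ^ k * sqrt (fact k)"
    proof -
      have "sqrt (exp (real k)) = exp (1/2) ^ k"
      proof (rule real_sqrt_unique)
        show "(exp (1/2) ^ k)\<^sup>2 = exp (real k)"
          unfolding exp_of_nat_mult[symmetric] exp_double[symmetric] by simp
      qed simp
      then show ?thesis by (simp add: real_sqrt_mult)
    qed
    finally have "B ^ k * sqrt (real k ^ k) / fact k \<le> B ^ k * (exp (1/2) ^ k * sqrt (fact k)) / fact k"
      using assms by (intro divide_right_mono mult_left_mono) auto
    also have "\<dots> = b ^ k / sqrt (fact k)"
      by (simp add: b_def power_mult_distrib field_simps)
    finally show ?thesis using assms by simp
  qed
  then show "\<exists>N. \<forall>n\<ge>N. norm (B ^ n * sqrt (real n ^ n) / fact n) \<le> b ^ n / sqrt (fact n)" by blast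
  show "summable (\<lambda>k. b ^ k / sqrt (fact k))"
  proof (rule summable_ratio_test[where c = "1/2" and N = "nat \<lceil>4 * b\<^sup>2\<rceil>"])
    fix n assume n: "nat \<lceil>4 * b\<^sup>2\<rceil> \<le> n"
    have b0: "b \<ge> 0" using assms by (simp add: b_def)
    have "4 * b\<^sup>2 \<le> real (Suc n)" using n by linarith
    then have "sqrt (4 * b\<^sup>2) \<le> sqrt (real (Suc n))" by (rule real_sqrt_le_mono)
    then have "2 * b \<le> sqrt (real (Suc n))" using b0 by (simp add: real_sqrt_mult)
    then have q: "b / sqrt (real (Suc n)) \<le> 1/2" by (simp add: field_simps)
    have "norm (b ^ Suc n / sqrt (fact (Suc n))) = (b / sqrt (real (Suc n))) * (b ^ n / sqrt (fact n))"
      using b0 by (simp add: real_sqrt_mult del: of_nat_Suc)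
    also have "\<dots> \<le> 1/2 * (b ^ n / sqrt (fact n))"
      using b0 by (intro mult_right_mono q) auto
    finally show "norm (b ^ Suc n / sqrt (fact (Suc n))) \<le> 1/2 * norm (b ^ n / sqrt (fact n))"
      using b0 by simp
  qed auto
qed


section \<open>Bounded convergence of holomorphic functions\<close>

text \<open>Pointwise convergence of holomorphic functions together with a bound on compact sets that holds
  from some index on. Holomorphy is required from index 1 on because the kernel is only studied for
  \<open>N \<ge> 1\<close>. A constant sequence is a special case, so that bounds for one function are instances
  of bounds for a sequence.\<close>

definition boundedly_converges :: "(nat \<Rightarrow> complex \<Rightarrow> complex) \<Rightarrow> (complex \<Rightarrow> complex) \<Rightarrow> complex set \<Rightarrow> bool" where
  "boundedly_converges F f U \<longleftrightarrow>
     open U \<and> (\<forall>n\<ge>1. F n holomorphic_on U) \<and> f holomorphic_on U \<and>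
     (\<forall>z\<in>U. (\<lambda>n. F n z) \<longlonglongrightarrow> f z) \<and>
     (\<forall>K. compact K \<longrightarrow> K \<subseteq> U \<longrightarrow> (\<exists>B. \<forall>\<^sub>F n in sequentially. \<forall>z\<in>K. cmod (F n z) \<le> B))"

lemma boundedly_convergesI:
  assumes "open U" "\<And>n. n \<ge> 1 \<Longrightarrow> F n holomorphic_on U" "f holomorphic_on U"
    and "\<And>z. z \<in> U \<Longrightarrow> (\<lambda>n. F n z) \<longlonglongrightarrow> f z"
    and "\<And>K. compact K \<Longrightarrow> K \<subseteq> U \<Longrightarrow> \<exists>B. \<forall>\<^sub>F n in sequentially. \<forall>z\<in>K. cmod (F n z) \<le> B"
  shows "boundedly_converges F f U"
  using assms by (auto simp: boundedly_converges_def)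

lemma boundedly_convergesD:
  assumes "boundedly_converges F f U"
  shows "open U" "\<And>n. n \<ge> 1 \<Longrightarrow> F n holomorphic_on U" "f holomorphic_on U"
    and "\<And>z. z \<in> U \<Longrightarrow> (\<lambda>n. F n z) \<longlonglongrightarrow> f z"
    and "\<And>K. compact K \<Longrightarrow> K \<subseteq> U \<Longrightarrow> \<exists>B. \<forall>\<^sub>F n in sequentially. \<forall>z\<in>K. cmod (F n z) \<le> B"
  using assms by (auto simp: boundedly_converges_def)

lemma bounded_on_compact:
  fixes f :: "complex \<Rightarrow> complex"
  assumes "f holomorphic_on U" "compact K" "K \<subseteq> U"
  shows "\<exists>B. \<forall>z\<in>K. cmod (f z) \<le> B"
proof -
  have "compact (f ` K)"
    using assms by (intro compact_continuous_image continuous_on_subset[OF holomorphic_on_imp_continuous_on])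
  then show ?thesis using compact_imp_bounded[of "f ` K"] by (auto simp: bounded_iff)
qed

lemma boundedly_converges_const:
  assumes "open U" "f holomorphic_on U"
  shows "boundedly_converges (\<lambda>_. f) f U"
  using assms bounded_on_compact[OF assms(2)] by (intro boundedly_convergesI) auto

lemma boundedly_converges_mult:
  assumes F: "boundedly_converges F f U" and G: "boundedly_converges G g U"
  shows "boundedly_converges (\<lambda>n z. F n z * G n z) (\<lambda>z. f z * g z) U"
proof (rule boundedly_convergesI)
  fix K assume K: "compact K" "K \<subseteq> U"
  from boundedly_convergesD(5)[OF F K] boundedly_convergesD(5)[OF G K]
  obtain A B where "\<forall>\<^sub>F n in sequentially. \<forall>z\<in>K. cmod (F n z) \<le> A"
    "\<forall>\<^sub>F n in sequentially. \<forall>z\<in>K. cmod (G n z) \<le> B" by auto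
  then have "\<forall>\<^sub>F n in sequentially. \<forall>z\<in>K. cmod (F n z * G n z) \<le> A * B"
    by eventually_elim (auto simp: norm_mult intro!: mult_mono intro: order_trans[OF norm_ge_zero])
  then show "\<exists>B. \<forall>\<^sub>F n in sequentially. \<forall>z\<in>K. cmod (F n z * G n z) \<le> B" by blast
qed (use boundedly_convergesD[OF F] boundedly_convergesD[OF G] in \<open>auto intro!: holomorphic_intros tendsto_intros\<close>)

text \<open>Cauchy's formula writes the derivative as an integral over a circle around \<open>z\<close>, on which the
  integrands converge pointwise and are bounded.\<close>

lemma boundedly_converges_higher_deriv_tendsto:
  assumes F: "boundedly_converges F f U" and z: "z \<in> U"
  shows "(\<lambda>n. (deriv ^^ p) (F n) z) \<longlonglongrightarrow> (deriv ^^ p) f z"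
proof -
  note D = boundedly_convergesD[OF F]
  obtain r where r: "r > 0" "cball z r \<subseteq> U"
    using D(1) z open_contains_cball by blast
  from D(5)[OF compact_cball r(2)]
  obtain B where "\<forall>\<^sub>F n in sequentially. \<forall>u\<in>cball z r. cmod (F n u) \<le> B" by blast
  then obtain n0 where n0: "\<And>n u. n \<ge> n0 \<Longrightarrow> u \<in> cball z r \<Longrightarrow> cmod (F n u) \<le> B"
    unfolding eventually_sequentially by blast
  \<comment> \<open>The shift makes the bound and holomorphy hold for all indices.\<close>
  define G where "G n = F (n + Suc n0)" for n
  have Gb: "cmod (G n u) \<le> B" if "u \<in> cball z r" for n u
    unfolding G_def using that by (intro n0) auto
  have Gh: "G n holomorphic_on U" for n unfolding G_def by (rule D(2)) auto
  have Gl: "(\<lambda>n. G n u) \<longlonglongrightarrow> f u" if "u \<in> U" for u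
    unfolding G_def using LIMSEQ_ignore_initial_segment[OF D(4)[OF that], of "Suc n0"] by simp
  define q where "q h x = h (circlepath z r x) / (circlepath z r x - z) ^ Suc p *
      vector_derivative (circlepath z r) (at x)" for h :: "complex \<Rightarrow> complex" and x
  have c: "(q h has_integral (complex_of_real (2 * pi) * \<i> / fact p * (deriv ^^ p) h z)) {0..1}"
    if "h holomorphic_on U" for h
  proof -
    have "continuous_on (cball z r) h" "h holomorphic_on ball z r"
      using that r(2) holomorphic_on_imp_continuous_on continuous_on_subset
        holomorphic_on_subset ball_subset_cball by (blast, metis order_trans)
    from Cauchy_has_contour_integral_higher_derivative_circlepath[OF this, of z p]
    show ?thesis using r(1)
      by (simp add: has_contour_integral q_def[abs_def])
  qed
  have circ: "circlepath z r x \<in> cball z r" "cmod (circlepath z r x - z) = r" for x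
    using r(1) by (simp_all add: circlepath dist_norm norm_mult)
  have B0: "0 \<le> B" using Gb[OF circ(1)[of 0], of 0] norm_ge_zero order_trans by blast
  have "(\<lambda>n. integral {0..1} (q (G n))) \<longlonglongrightarrow> integral {0..1} (q f)"
  proof (rule dominated_convergence(2)[where h = "\<lambda>_. B / r ^ Suc p * (2 * pi * r)"])
    show "q (G n) integrable_on {0..1}" for n using c[OF Gh[of n]] by blast
    show "norm (q (G n) x) \<le> B / r ^ Suc p * (2 * pi * r)" for n x
      unfolding q_def norm_mult norm_divide norm_power circ(2)
      using Gb[OF circ(1)] r(1) B0
      by (intro mult_mono divide_right_mono) (auto simp: vector_derivative_circlepath norm_mult)
    show "(\<lambda>n. q (G n) x) \<longlonglongrightarrow> q f x" for x
    proof -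
      have "circlepath z r x - z \<noteq> 0" using circ(2)[of x] r(1) by auto
      moreover have "(\<lambda>n. G n (circlepath z r x)) \<longlonglongrightarrow> f (circlepath z r x)"
        using Gl circ(1)[of x] r(2) by blast
      ultimately show ?thesis unfolding q_def by (intro tendsto_intros) auto
    qed
  qed auto
  then have "(\<lambda>n. complex_of_real (2 * pi) * \<i> / fact p * (deriv ^^ p) (G n) z)
      \<longlonglongrightarrow> complex_of_real (2 * pi) * \<i> / fact p * (deriv ^^ p) f z"
    using integral_unique[OF c[OF Gh]] integral_unique[OF c[OF D(3)]] by simp
  then have "(\<lambda>n. (fact p / (complex_of_real (2 * pi) * \<i>)) * (complex_of_real (2 * pi) * \<i> / fact p * (deriv ^^ p) (G n) z))
      \<longlonglongrightarrow> (fact p / (complex_of_real (2 * pi) * \<i>)) * (complex_of_real (2 * pi) * \<i> / fact p * (deriv ^^ p) f z)"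
    by (rule tendsto_mult_left)
  then have "(\<lambda>n. (deriv ^^ p) (G n) z) \<longlonglongrightarrow> (deriv ^^ p) f z" by simp
  then show ?thesis unfolding G_def by (rule LIMSEQ_offset)
qed

text \<open>The bound for the derivatives on a compact set \<open>K\<close> is Cauchy's estimate on discs of a fixed
  radius that stay in \<open>U\<close>; their union over \<open>K\<close> is again compact.\<close>

lemma boundedly_converges_deriv:
  assumes F: "boundedly_converges F f U"
  shows "boundedly_converges (\<lambda>n. deriv (F n)) (deriv f) U"
proof (rule boundedly_convergesI)
  note D = boundedly_convergesD[OF F]
  show "open U" by fact
  show "deriv (F n) holomorphic_on U" if "n \<ge> 1" for n using D(1) D(2)[OF that] by (rule holomorphic_deriv[rotated])
  show "deriv f holomorphic_on U" using D(1,3) by (rule holomorphic_deriv[rotated])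
  show "(\<lambda>n. deriv (F n) z) \<longlonglongrightarrow> deriv f z" if "z \<in> U" for z
    using boundedly_converges_higher_deriv_tendsto[OF F that, of 1] by simp
  fix K assume K: "compact K" "K \<subseteq> U"
  obtain e where e: "e > 0" "(\<Union>x\<in>K. cball x e) \<subseteq> U"
    using compact_subset_open_imp_cball_epsilon_subset[OF K(1) D(1) K(2)] by blast
  have "(\<Union>x\<in>K. cball x e) = {x + y | x y. x \<in> K \<and> y \<in> cball 0 e}"
  proof (intro equalityI subsetI)
    fix u assume "u \<in> (\<Union>x\<in>K. cball x e)"
    then obtain x where "x \<in> K" "u \<in> cball x e" by blast
    then show "u \<in> {x + y | x y. x \<in> K \<and> y \<in> cball 0 e}"
      by (intro CollectI exI[of _ x] exI[of _ "u - x"]) (auto simp: dist_norm norm_minus_commute)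
  next
    fix u assume "u \<in> {x + y | x y. x \<in> K \<and> y \<in> cball 0 e}"
    then obtain x y where "u = x + y" "x \<in> K" "y \<in> cball 0 e" by blast
    then show "u \<in> (\<Union>x\<in>K. cball x e)" by (auto simp: dist_norm intro!: bexI[of _ x])
  qed
  then have "compact (\<Union>x\<in>K. cball x e)" using compact_sums[OF K(1) compact_cball, of 0 e] by simp
  from D(5)[OF this e(2)] obtain B where B: "\<forall>\<^sub>F n in sequentially. \<forall>z\<in>(\<Union>x\<in>K. cball x e). cmod (F n z) \<le> B"
    by blast
  have "\<forall>\<^sub>F n in sequentially. \<forall>z\<in>K. cmod (deriv (F n) z) \<le> B / e"
    using B eventually_ge_at_top[of 1]
  proof eventually_elim
    case (elim n)
    show ?case
    proof
      fix z assume z: "z \<in> K"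
      have sub: "cball z e \<subseteq> U" using e z by auto
      have h: "F n holomorphic_on cball z e" using D(2)[OF elim(2)] sub holomorphic_on_subset by blast
      have "cmod ((deriv ^^ 1) (F n) z) \<le> fact 1 * B / e ^ 1"
        using h elim(1) z e(1)
        by (intro Cauchy_inequality holomorphic_on_imp_continuous_on)
           (auto intro: holomorphic_on_subset ball_subset_cball simp: dist_norm norm_minus_commute)
      then show "cmod (deriv (F n) z) \<le> B / e" by simp
    qed
  qed
  then show "\<exists>B. \<forall>\<^sub>F n in sequentially. \<forall>z\<in>K. cmod (deriv (F n) z) \<le> B" by blast
qed

text \<open>Real and complex derivatives of a holomorphic function agree along the real line; the induction
  works because \<open>f\<close> and \<open>Re \<circ> g\<close> agree on an open set.\<close>

lemma higher_deriv_Re_real_line: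
  fixes f :: "real \<Rightarrow> real" and g :: "complex \<Rightarrow> complex"
  assumes U: "open U" and g: "g holomorphic_on U" and S: "open S" "\<And>t. t \<in> S \<Longrightarrow> of_real t \<in> U"
    and f: "\<And>t. t \<in> S \<Longrightarrow> f t = Re (g (of_real t))"
  shows "\<And>t. t \<in> S \<Longrightarrow> (deriv ^^ p) f t = Re ((deriv ^^ p) g (of_real t))"
    and "\<And>t. t \<in> S \<Longrightarrow> ((deriv ^^ p) f has_real_derivative (deriv ^^ Suc p) f t) (at t)"
proof -
  have *: "((deriv ^^ p) f has_real_derivative Re ((deriv ^^ Suc p) g (of_real t))) (at t)"
    if "\<And>t. t \<in> S \<Longrightarrow> (deriv ^^ p) f t = Re ((deriv ^^ p) g (of_real t))" "t \<in> S" for p t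
  proof -
    have "(deriv ^^ p) g holomorphic_on U" by (intro holomorphic_higher_deriv g U)
    then have "((deriv ^^ p) g has_field_derivative (deriv ^^ Suc p) g (of_real t)) (at (of_real t))"
      using U S(2)[OF that(2)] by (simp add: holomorphic_derivI)
    then have "((\<lambda>t. (deriv ^^ p) g (of_real t)) has_vector_derivative (deriv ^^ Suc p) g (of_real t)) (at t)"
      using has_vector_derivative_real_field by blast
    then have "((\<lambda>t. Re ((deriv ^^ p) g (of_real t))) has_vector_derivative Re ((deriv ^^ Suc p) g (of_real t))) (at t)"
      by (rule bounded_linear.has_vector_derivative[OF bounded_linear_Re])
    then have "((\<lambda>t. Re ((deriv ^^ p) g (of_real t))) has_real_derivative Re ((deriv ^^ Suc p) g (of_real t))) (at t)"
      by (simp add: has_real_derivative_iff_has_vector_derivative)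
    then show ?thesis
      by (rule has_field_derivative_transform_within_open[OF _ S(1) that(2)]) (simp add: that(1))
  qed
  have **: "\<forall>t\<in>S. (deriv ^^ p) f t = Re ((deriv ^^ p) g (of_real t))" for p
  proof (induction p)
    case 0 then show ?case using f by simp
  next
    case (Suc p)
    then show ?case using DERIV_imp_deriv[OF *[of p]] by simp
  qed
  show "(deriv ^^ p) f t = Re ((deriv ^^ p) g (of_real t))" if "t \<in> S" for t using ** that by blast
  show "((deriv ^^ p) f has_real_derivative (deriv ^^ Suc p) f t) (at t)" if "t \<in> S" for t
    using *[of p t] **[of p] **[of "Suc p"] that by auto
qed

lemma C_class_on_Re_real_line:
  fixes f :: "real \<Rightarrow> real"
  assumes "open U" "g holomorphic_on U" "open S" "\<And>t. t \<in> S \<Longrightarrow> of_real t \<in> U"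
    and "\<And>t. t \<in> S \<Longrightarrow> f t = Re (g (of_real t))"
  shows "C_class_on m S f"
  unfolding C_class_on_def
  using higher_deriv_Re_real_line(2)[OF assms]
  by (auto simp: field_differentiable_def intro!: continuous_at_imp_continuous_on DERIV_isCont)


section \<open>Fredholm series with an integrable weight\<close>

lemma det_mat_expand:
  "Determinant.det (Matrix.mat k k (\<lambda>(i,j). L i j))
     = (\<Sum>p | p permutes {0..<k}. signof p * (\<Prod>i=0..<k. L i (p i)))"
proof -
  have "(\<Prod>i = 0..<k. Matrix.mat k k (\<lambda>(i,j). L i j) $$ (i, p i)) = (\<Prod>i=0..<k. L i (p i))"
    if p: "p permutes {0..<k}" for p
  proof (rule prod.cong[OF refl])
    fix i assume "i \<in> {0..<k}"
    then show "Matrix.mat k k (\<lambda>(i,j). L i j) $$ (i, p i) = L i (p i)"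
      using permutes_in_image[OF p, of i] by simp
  qed
  then show ?thesis unfolding Determinant.det_def by simp
qed

text \<open>The kernel behind such an integrand is \<open>w(x)\<^sup>1\<^sup>/\<^sup>2 w(y)\<^sup>1\<^sup>/\<^sup>2 L(x,y)\<close>: its decay is in the
  weight \<open>w\<close>, which comes out of the determinant, and \<open>L\<close> is merely bounded.\<close>

definition fredholm_integrand :: "(real \<Rightarrow> real) \<Rightarrow> (real \<Rightarrow> real \<Rightarrow> complex) \<Rightarrow> nat \<Rightarrow> (nat \<Rightarrow> real) \<Rightarrow> complex" where
  "fredholm_integrand w L k x =
     of_real (\<Prod>i<k. w (x i)) * Determinant.det (Matrix.mat k k (\<lambda>(i,j). L (x i) (x j)))"

definition weighted_fredholm_term :: "(real \<Rightarrow> real) \<Rightarrow> (real \<Rightarrow> real \<Rightarrow> complex) \<Rightarrow> nat \<Rightarrow> complex" where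
  "weighted_fredholm_term w L k =
     (- 1) ^ k / fact k * (\<integral>x. fredholm_integrand w L k x \<partial>(Pi\<^sub>M {..<k} (\<lambda>_. lborel)))"

definition weighted_fredholm_det :: "(real \<Rightarrow> real) \<Rightarrow> (real \<Rightarrow> real \<Rightarrow> complex) \<Rightarrow> complex" where
  "weighted_fredholm_det w L = 1 + (\<Sum>k. weighted_fredholm_term w L (Suc k))"

interpretation lborel_product: product_sigma_finite "\<lambda>_::nat. lborel :: real measure"
  by unfold_locales

lemma measurable_det_kernel:
  assumes L: "case_prod L \<in> borel_measurable (borel \<Otimes>\<^sub>M borel)"
  shows "(\<lambda>x. Determinant.det (Matrix.mat k k (\<lambda>(i,j). L (x i) (x j) :: complex)))
     \<in> borel_measurable (Pi\<^sub>M {..<k} (\<lambda>_. lborel))"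
proof -
  have m: "(\<lambda>x. L (x i) (x j)) \<in> borel_measurable (Pi\<^sub>M {..<k} (\<lambda>_. lborel))" if "i < k" "j < k" for i j
  proof -
    have "(\<lambda>x. (x i, x j)) \<in> measurable (Pi\<^sub>M {..<k} (\<lambda>_. lborel)) (borel \<Otimes>\<^sub>M borel)"
      using that by (intro measurable_Pair measurable_component_singleton[of _ "{..<k}" "\<lambda>_. lborel", simplified]) auto
    from measurable_compose[OF this L] show ?thesis by simp
  qed
  have "p i < k" if "p permutes {0..<k}" "i < k" for p i
    using permutes_in_image[OF that(1), of i] that(2) by simp
  then show ?thesis
    unfolding det_mat_expand by (intro borel_measurable_sum borel_measurable_times borel_measurable_prod m) auto
qed

lemma measurable_fredholm_integrand:
  assumes L: "case_prod L \<in> borel_measurable (borel \<Otimes>\<^sub>M borel)" and w: "w \<in> borel_measurable borel"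
  shows "fredholm_integrand w L k \<in> borel_measurable (Pi\<^sub>M {..<k} (\<lambda>_. lborel))"
proof -
  have "(\<lambda>x. w (x i)) \<in> borel_measurable (Pi\<^sub>M {..<k} (\<lambda>_. lborel))" if "i < k" for i
    using that by (intro measurable_compose[OF measurable_component_singleton[of _ "{..<k}" "\<lambda>_. lborel", simplified] w]) auto
  then show ?thesis
    unfolding fredholm_integrand_def[abs_def]
    by (intro borel_measurable_times measurable_det_kernel[OF L] borel_measurable_of_real borel_measurable_prod) auto
qed

lemma norm_fredholm_integrand_le:
  assumes w: "\<And>x. 0 \<le> w x" and L: "\<And>x y. cmod (L x y) \<le> B"
  shows "cmod (fredholm_integrand w L k x) \<le> (\<Prod>i<k. w (x i)) * (B ^ k * sqrt (real k ^ k))"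
proof -
  have B: "0 \<le> B" using L[of 0 0] norm_ge_zero order_trans by blast
  have "(cmod (Determinant.det (Matrix.mat k k (\<lambda>(i,j). L (x i) (x j)))))\<^sup>2 \<le> (real k * B\<^sup>2) ^ k"
    by (rule hadamard_det_bound) (auto simp: L)
  then have "cmod (Determinant.det (Matrix.mat k k (\<lambda>(i,j). L (x i) (x j)))) \<le> sqrt ((real k * B\<^sup>2) ^ k)"
    by (rule real_le_rsqrt)
  also have "\<dots> = B ^ k * sqrt (real k ^ k)"
    using B by (simp add: power_mult_distrib real_sqrt_mult real_sqrt_power)
  finally show ?thesis
    unfolding fredholm_integrand_def norm_mult norm_of_real using w
    by (simp add: abs_of_nonneg prod_nonneg mult_left_mono)
qed

locale fredholm_weight =
  fixes w :: "real \<Rightarrow> real"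
  assumes w_nonneg: "\<And>x. 0 \<le> w x" and w_integrable: "integrable lborel w"
begin

lemma w_measurable: "w \<in> borel_measurable borel"
  using w_integrable borel_measurable_integrable by fastforce

lemma dominating_integrable:
  "integrable (Pi\<^sub>M {..<k::nat} (\<lambda>_. lborel)) (\<lambda>x. (\<Prod>i<k. w (x i)) * C)"
  using lborel_product.product_integrable_prod[of "{..<k}" "\<lambda>_. w"] w_integrable by simp

lemma fredholm_integrand_integrable:
  assumes L: "case_prod L \<in> borel_measurable (borel \<Otimes>\<^sub>M borel)" "\<And>x y. cmod (L x y) \<le> B"
  shows "integrable (Pi\<^sub>M {..<k} (\<lambda>_. lborel)) (fredholm_integrand w L k)"
  by (rule Bochner_Integration.integrable_bound[OF dominating_integrable[of k "B ^ k * sqrt (real k ^ k)"]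
        measurable_fredholm_integrand[OF L(1) w_measurable]])
     (rule AE_I2, rule order_trans[OF norm_fredholm_integrand_le[OF w_nonneg L(2)]], simp)

text \<open>Hadamard's inequality, integrated against the weight.\<close>

definition term_bound :: "real \<Rightarrow> nat \<Rightarrow> real" where
  "term_bound B k = (B * integral\<^sup>L lborel w) ^ k * sqrt (real k ^ k) / fact k"

lemma norm_fredholm_term_le:
  assumes L: "case_prod L \<in> borel_measurable (borel \<Otimes>\<^sub>M borel)" "\<And>x y. cmod (L x y) \<le> B"
  shows "cmod (weighted_fredholm_term w L k) \<le> term_bound B k"
proof -
  have "cmod (integral\<^sup>L (Pi\<^sub>M {..<k} (\<lambda>_. lborel)) (fredholm_integrand w L k))
      \<le> (\<integral>x. (\<Prod>i<k. w (x i)) * (B ^ k * sqrt (real k ^ k)) \<partial>(Pi\<^sub>M {..<k} (\<lambda>_. lborel)))"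
    by (rule order_trans[OF integral_norm_bound])
       (intro integral_mono integrable_norm fredholm_integrand_integrable[OF L] dominating_integrable
         norm_fredholm_integrand_le w_nonneg L(2))
  also have "\<dots> = (integral\<^sup>L lborel w) ^ k * (B ^ k * sqrt (real k ^ k))"
    using lborel_product.product_integral_prod[of "{..<k}" "\<lambda>_. w"] w_integrable by simp
  finally show ?thesis
    unfolding weighted_fredholm_term_def term_bound_def norm_mult norm_divide norm_power
    by (simp add: power_mult_distrib mult_ac divide_right_mono)
qed

lemma term_bound_summable: "B \<ge> 0 \<Longrightarrow> summable (term_bound B)"
  unfolding term_bound_def[abs_def]
  by (intro summable_hadamard_series mult_nonneg_nonneg Bochner_Integration.integral_nonneg w_nonneg)

lemma term_bound_Suc_summable: "B \<ge> 0 \<Longrightarrow> summable (\<lambda>k. term_bound B (Suc k))"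
  using term_bound_summable[of B] summable_Suc_iff[of "term_bound B"] by simp

lemma fredholm_series_summable:
  assumes L: "case_prod L \<in> borel_measurable (borel \<Otimes>\<^sub>M borel)" "\<And>x y. cmod (L x y) \<le> B"
  shows "summable (\<lambda>k. weighted_fredholm_term w L (Suc k))"
proof -
  have "0 \<le> B" using L(2)[of 0 0] norm_ge_zero order_trans by blast
  then show ?thesis
    using norm_fredholm_term_le[OF L] by (intro summable_comparison_test'[OF term_bound_Suc_summable[of B]]) auto
qed

lemma norm_fredholm_det_le:
  assumes L: "case_prod L \<in> borel_measurable (borel \<Otimes>\<^sub>M borel)" "\<And>x y. cmod (L x y) \<le> B"
  shows "cmod (weighted_fredholm_det w L) \<le> 1 + (\<Sum>k. term_bound B (Suc k))"
proof -
  have "0 \<le> B" using L(2)[of 0 0] norm_ge_zero order_trans by blast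
  then have "cmod (\<Sum>k. weighted_fredholm_term w L (Suc k)) \<le> (\<Sum>k. term_bound B (Suc k))"
    using norm_fredholm_term_le[OF L] term_bound_Suc_summable[of B] by (intro norm_suminf_le) auto
  then show ?thesis unfolding weighted_fredholm_det_def
    using norm_triangle_ineq[of 1 "\<Sum>k. weighted_fredholm_term w L (Suc k)"] by simp
qed

lemma fredholm_term_tendsto:
  assumes L: "\<And>n. case_prod (L n) \<in> borel_measurable (borel \<Otimes>\<^sub>M borel)" "\<And>n x y. cmod (L n x y) \<le> B"
    and l: "case_prod l \<in> borel_measurable (borel \<Otimes>\<^sub>M borel)" "\<And>x y. (\<lambda>n. L n x y) \<longlonglongrightarrow> l x y"
  shows "(\<lambda>n. weighted_fredholm_term w (L n) k) \<longlonglongrightarrow> weighted_fredholm_term w l k"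
  unfolding weighted_fredholm_term_def
proof (intro tendsto_mult tendsto_const
    integral_dominated_convergence[OF _ _ dominating_integrable[of k "B ^ k * sqrt (real k ^ k)"]])
  show "fredholm_integrand w l k \<in> borel_measurable (Pi\<^sub>M {..<k} (\<lambda>_. lborel))"
    "\<And>n. fredholm_integrand w (L n) k \<in> borel_measurable (Pi\<^sub>M {..<k} (\<lambda>_. lborel))"
    using L l w_measurable by (intro measurable_fredholm_integrand; simp)+
  show "AE x in Pi\<^sub>M {..<k} (\<lambda>_. lborel). (\<lambda>n. fredholm_integrand w (L n) k x) \<longlonglongrightarrow> fredholm_integrand w l k x"
    unfolding fredholm_integrand_def det_mat_expand by (intro AE_I2 tendsto_intros l(2))
  show "AE x in Pi\<^sub>M {..<k} (\<lambda>_. lborel). cmod (fredholm_integrand w (L n) k x) \<le> (\<Prod>i<k. w (x i)) * (B ^ k * sqrt (real k ^ k))" for n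
    by (intro AE_I2 norm_fredholm_integrand_le w_nonneg L(2))
qed

text \<open>Dominated convergence twice: in each integral, and in the sum over \<open>k\<close> in the form of Tannery's
  theorem.\<close>

lemma fredholm_det_tendsto:
  assumes L: "\<And>n. case_prod (L n) \<in> borel_measurable (borel \<Otimes>\<^sub>M borel)" "\<And>n x y. cmod (L n x y) \<le> B"
    and l: "case_prod l \<in> borel_measurable (borel \<Otimes>\<^sub>M borel)" "\<And>x y. (\<lambda>n. L n x y) \<longlonglongrightarrow> l x y"
  shows "(\<lambda>n. weighted_fredholm_det w (L n)) \<longlonglongrightarrow> weighted_fredholm_det w l"
proof -
  have "0 \<le> B" using L(2)[of 0 0 0] norm_ge_zero order_trans by blast
  then have "(\<lambda>n. \<Sum>k. weighted_fredholm_term w (L n) (Suc k)) \<longlonglongrightarrow> (\<Sum>k. weighted_fredholm_term w l (Suc k))"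
    using norm_fredholm_term_le[OF L] term_bound_Suc_summable[of B]
    by (intro conjunct2[OF conjunct2[OF tannerys_theorem[where M = "\<lambda>k. term_bound B (Suc k)"]]]
        fredholm_term_tendsto[OF L l] always_eventually) auto
  then show ?thesis unfolding weighted_fredholm_det_def by (intro tendsto_intros)
qed

end

lemma has_field_derivative_sequentially:
  fixes f :: "complex \<Rightarrow> complex"
  assumes "r > 0" and "\<And>X. (\<And>n. X n \<in> ball z r - {z}) \<Longrightarrow> X \<longlonglongrightarrow> z \<Longrightarrow> (\<lambda>n. (f (X n) - f z) / (X n - z)) \<longlonglongrightarrow> D"
  shows "(f has_field_derivative D) (at z)"
proof -
  have "((\<lambda>y. (f y - f z) / (y - z)) \<longlongrightarrow> D) (at z within ball z r)"
    unfolding tendsto_at_iff_sequentially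
    using assms(2) by (auto simp: o_def)
  then show ?thesis unfolding has_field_derivative_iff
    using assms(1) by (simp add: at_within_open[of z "ball z r"])
qed

text \<open>Cauchy's estimate makes the integrand Lipschitz in \<open>z\<close> near \<open>z0\<close> with a constant proportional to
  \<open>H x\<close>, so the difference quotients are dominated and the limit may be taken under the integral.\<close>

lemma holomorphic_integral_param:
  fixes g :: "complex \<Rightarrow> 'a \<Rightarrow> complex"
  assumes r: "r > 0" and hol: "\<And>x. (\<lambda>z. g z x) holomorphic_on ball z0 r"
    and bd: "\<And>z x. z \<in> ball z0 r \<Longrightarrow> cmod (g z x) \<le> H x" and H: "integrable M H"
    and meas: "\<And>z. z \<in> ball z0 r \<Longrightarrow> g z \<in> borel_measurable M"
  shows "(\<lambda>z. \<integral>x. g z x \<partial>M) field_differentiable (at z0)"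
proof -
  have int: "integrable M (g z)" if "z \<in> ball z0 r" for z
    by (rule Bochner_Integration.integrable_bound[OF H meas[OF that]])
       (rule AE_I2, rule order_trans[OF bd[OF that]], simp)
  define d where "d x = deriv (\<lambda>z. g z x) z0" for x
  have dder: "((\<lambda>z. g z x) has_field_derivative d x) (at z0)" for x
    unfolding d_def using r by (intro holomorphic_derivI[OF hol]) auto
  have lip: "cmod (g z x - g z0 x) \<le> 4 * H x / r * cmod (z - z0)" if "z \<in> ball z0 (r/2)" for z x
  proof -
    have H0: "0 \<le> H x" using order_trans[OF norm_ge_zero bd[of z0 x]] r by simp
    have der: "((\<lambda>z. g z x) has_field_derivative deriv (\<lambda>z. g z x) u) (at u within ball z0 (r/2))"
      if "u \<in> ball z0 (r/2)" for u
      using that r by (intro has_field_derivative_at_within[OF holomorphic_derivI[OF hol]]) auto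
    have "cmod (deriv (\<lambda>z. g z x) u) \<le> 4 * H x / r" if "u \<in> ball z0 (r/2)" for u
    proof -
      have sub: "cball u (r/4) \<subseteq> ball z0 r"
      proof
        fix v assume "v \<in> cball u (r/4)"
        then show "v \<in> ball z0 r" using that r dist_triangle[of z0 v u] by auto
      qed
      have "cmod ((deriv ^^ 1) (\<lambda>z. g z x) u) \<le> fact 1 * H x / (r/4) ^ 1"
      proof (rule Cauchy_inequality)
        show "continuous_on (cball u (r/4)) (\<lambda>z. g z x)" "(\<lambda>z. g z x) holomorphic_on ball u (r/4)"
          using hol[of x] sub holomorphic_on_imp_continuous_on holomorphic_on_subset ball_subset_cball by metis+
        show "cmod (g v x) \<le> H x" if "cmod (u - v) = r/4" for v
          using that sub by (intro bd) (auto simp: subset_iff dist_norm)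
      qed (use r in auto)
      then show ?thesis by (simp add: mult.commute)
    qed
    from field_differentiable_bound[OF convex_ball der this, of z z0] that r show ?thesis by simp
  qed
  have quot: "(\<lambda>n. (g (X n) x - g z0 x) / (X n - z0)) \<longlonglongrightarrow> d x"
    if "\<And>n. X n \<noteq> z0" "X \<longlonglongrightarrow> z0" for X :: "nat \<Rightarrow> complex" and x
  proof -
    have "((\<lambda>y. (g y x - g z0 x) / (y - z0)) \<longlongrightarrow> d x) (at z0)"
      using dder[of x] by (simp only: has_field_derivative_iff)
    from this[unfolded tendsto_at_iff_sequentially, rule_format, of X] that show ?thesis
      by (simp add: o_def)
  qed
  have meas_d: "d \<in> borel_measurable M"
  proof -
    \<comment> \<open>Any sequence of points tending to \<open>z0\<close> shows that the derivative is measurable, being a limit of difference quotients.\<close>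
    define X where "X n = z0 + of_real (r / 2 / real (Suc (Suc n)))" for n
    have X: "X n \<in> ball z0 r" "X n \<noteq> z0" for n
    proof -
      define e where "e = r / 2 / real (Suc (Suc n))"
      have e: "0 < e" "e < r" using r by (simp_all add: e_def field_simps add_pos_nonneg)
      have "X n = z0 + of_real e" unfolding X_def e_def ..
      then show "X n \<in> ball z0 r" "X n \<noteq> z0" using e by (auto simp: dist_norm)
    qed
    have X0: "X \<longlonglongrightarrow> z0"
    proof -
      have "(\<lambda>n. r / 2 / real (Suc (Suc n))) \<longlonglongrightarrow> 0"
        using LIMSEQ_Suc[OF LIMSEQ_Suc[OF lim_const_over_n[of "r/2"]]] by simp
      from tendsto_add[OF tendsto_const[of z0] tendsto_of_real[OF this]] show ?thesis by (simp add: X_def[abs_def])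
    qed
    show ?thesis
    proof (rule borel_measurable_LIMSEQ_metric)
      show "(\<lambda>x. (g (X n) x - g z0 x) / (X n - z0)) \<in> borel_measurable M" for n
        using meas[OF X(1)[of n]] meas[of z0] r
        by (intro borel_measurable_divide borel_measurable_diff borel_measurable_const) auto
      show "(\<lambda>n. (g (X n) x - g z0 x) / (X n - z0)) \<longlonglongrightarrow> d x" for x
        by (rule quot[OF X(2) X0])
    qed
  qed
  have "((\<lambda>z. \<integral>x. g z x \<partial>M) has_field_derivative (\<integral>x. d x \<partial>M)) (at z0)"
  proof (rule has_field_derivative_sequentially)
    show "r / 2 > 0" using r by simp
    fix X assume X: "\<And>n. X n \<in> ball z0 (r / 2) - {z0}" and X0: "X \<longlonglongrightarrow> z0"
    have Xr: "X n \<in> ball z0 r" "X n \<noteq> z0" for n using X[of n] r by auto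
    have "(\<lambda>n. \<integral>x. (g (X n) x - g z0 x) / (X n - z0) \<partial>M) \<longlonglongrightarrow> (\<integral>x. d x \<partial>M)"
    proof (rule integral_dominated_convergence[OF meas_d])
      show "(\<lambda>x. (g (X n) x - g z0 x) / (X n - z0)) \<in> borel_measurable M" for n
        using meas[OF Xr(1)[of n]] meas[of z0] r
        by (intro borel_measurable_divide borel_measurable_diff borel_measurable_const) auto
      show "integrable M (\<lambda>x. 4 * H x / r)" using H by auto
      show "AE x in M. (\<lambda>n. (g (X n) x - g z0 x) / (X n - z0)) \<longlonglongrightarrow> d x"
        by (intro AE_I2 quot Xr X0)
      show "AE x in M. cmod ((g (X n) x - g z0 x) / (X n - z0)) \<le> 4 * H x / r" for n
        using lip[of "X n"] X[of n] by (intro AE_I2) (auto simp: norm_divide divide_simps mult_ac)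
    qed
    also have "(\<lambda>n. \<integral>x. (g (X n) x - g z0 x) / (X n - z0) \<partial>M)
        = (\<lambda>n. ((\<integral>x. g (X n) x \<partial>M) - (\<integral>x. g z0 x \<partial>M)) / (X n - z0))"
      using int[OF Xr(1)] int[of z0] r by (simp add: Bochner_Integration.integral_diff)
    finally show "(\<lambda>n. ((\<integral>x. g (X n) x \<partial>M) - (\<integral>x. g z0 x \<partial>M)) / (X n - z0)) \<longlonglongrightarrow> (\<integral>x. d x \<partial>M)" .
  qed
  then show ?thesis by (auto simp: field_differentiable_def)
qed

context fredholm_weight begin

text \<open>Each term is an integral depending holomorphically on a parameter, and the bounds \<open>term_bound\<close>
  make the series converge uniformly on small discs.\<close>

lemma fredholm_det_holomorphic:
  assumes U: "open U"
    and hol: "\<And>x y. (\<lambda>z. L z x y) holomorphic_on U"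
    and meas: "\<And>z. z \<in> U \<Longrightarrow> case_prod (L z) \<in> borel_measurable (borel \<Otimes>\<^sub>M borel)"
    and bd: "\<And>K. compact K \<Longrightarrow> K \<subseteq> U \<Longrightarrow> \<exists>B. \<forall>z\<in>K. \<forall>x y. cmod (L z x y) \<le> B"
  shows "(\<lambda>z. weighted_fredholm_det w (L z)) holomorphic_on U"
proof -
  have term_hol: "(\<lambda>z. weighted_fredholm_term w (L z) k) holomorphic_on U" for k
  proof -
    have "(\<lambda>z. integral\<^sup>L (Pi\<^sub>M {..<k} (\<lambda>_. lborel)) (fredholm_integrand w (L z) k)) field_differentiable (at z0)"
      if z0: "z0 \<in> U" for z0
    proof -
      obtain r where r: "r > 0" "cball z0 r \<subseteq> U" using U z0 open_contains_cball by blast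
      then have rU: "z \<in> U" if "z \<in> ball z0 r" for z using that by auto
      obtain B where B: "\<And>z x y. z \<in> cball z0 r \<Longrightarrow> cmod (L z x y) \<le> B"
        using bd[OF compact_cball r(2)] by blast
      show ?thesis
      proof (rule holomorphic_integral_param[OF r(1) _ _ dominating_integrable[of k "B ^ k * sqrt (real k ^ k)"]])
        show "(\<lambda>z. fredholm_integrand w (L z) k x) holomorphic_on ball z0 r" for x
          unfolding fredholm_integrand_def det_mat_expand
          using holomorphic_on_subset[OF hol] rU by (intro holomorphic_intros) blast
        show "cmod (fredholm_integrand w (L z) k x) \<le> (\<Prod>i<k. w (x i)) * (B ^ k * sqrt (real k ^ k))"
          if "z \<in> ball z0 r" for z x
          using that by (intro norm_fredholm_integrand_le w_nonneg B) auto
        show "fredholm_integrand w (L z) k \<in> borel_measurable (Pi\<^sub>M {..<k} (\<lambda>_. lborel))" if "z \<in> ball z0 r" for z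
          by (intro measurable_fredholm_integrand meas rU[OF that] w_measurable)
      qed
    qed
    then have "(\<lambda>z. integral\<^sup>L (Pi\<^sub>M {..<k} (\<lambda>_. lborel)) (fredholm_integrand w (L z) k)) holomorphic_on U"
      by (auto simp: holomorphic_on_def intro: field_differentiable_at_within)
    then show ?thesis unfolding weighted_fredholm_term_def by (intro holomorphic_intros)
  qed
  have "(\<lambda>z. \<Sum>k. weighted_fredholm_term w (L z) (Suc k)) holomorphic_on U"
  proof (rule holomorphic_uniform_sequence[OF U])
    show "(\<lambda>z. \<Sum>k<n. weighted_fredholm_term w (L z) (Suc k)) holomorphic_on U" for n
      by (intro holomorphic_intros term_hol)
    fix z0 assume z0: "z0 \<in> U"
    obtain r where r: "r > 0" "cball z0 r \<subseteq> U" using U z0 open_contains_cball by blast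
    obtain B where B: "\<And>z x y. z \<in> cball z0 r \<Longrightarrow> cmod (L z x y) \<le> B"
      using bd[OF compact_cball r(2)] by blast
    have "0 \<le> B" using B[of z0 0 0] r(1) norm_ge_zero order_trans by (metis centre_in_cball less_imp_le)
    have "uniform_limit (cball z0 r) (\<lambda>n z. \<Sum>k<n. weighted_fredholm_term w (L z) (Suc k))
        (\<lambda>z. \<Sum>k. weighted_fredholm_term w (L z) (Suc k)) sequentially"
      using r(2) B
      by (intro Weierstrass_m_test[OF _ term_bound_Suc_summable[OF \<open>0 \<le> B\<close>]] norm_fredholm_term_le meas) auto
    with r show "\<exists>d>0. cball z0 d \<subseteq> U \<and> uniform_limit (cball z0 d) (\<lambda>n z. \<Sum>k<n. weighted_fredholm_term w (L z) (Suc k))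
        (\<lambda>z. \<Sum>k. weighted_fredholm_term w (L z) (Suc k)) sequentially" by blast
  qed
  then show ?thesis unfolding weighted_fredholm_det_def by (intro holomorphic_intros)
qed

end

text \<open>Two product measures that agree on boxes are equal.\<close>

lemma PiM_lborel_scale:
  fixes t :: real
  assumes t: "t > 0"
  shows "Pi\<^sub>M {..<k} (\<lambda>_. lborel) =
    density (distr (Pi\<^sub>M {..<k} (\<lambda>_. lborel)) (Pi\<^sub>M {..<k} (\<lambda>_. lborel)) (\<lambda>x. \<lambda>i\<in>{..<k}. t * x i)) (\<lambda>_. ennreal (t ^ k))"
    (is "?P = density (distr ?P ?P ?T) _")
proof (rule lborel_product.PiM_eqI[symmetric])
  have T: "?T \<in> measurable ?P ?P"
    by (intro measurable_restrict measurable_compose[OF measurable_component_singleton]) auto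
  fix A :: "nat \<Rightarrow> real set" assume A: "\<And>i. i \<in> {..<k} \<Longrightarrow> A i \<in> sets lborel"
  define A' where "A' i = (\<lambda>x. t * x) -` A i" for i
  have A': "A' i \<in> sets lborel" if "i \<in> {..<k}" for i
    unfolding A'_def using measurable_sets[of "\<lambda>x. t * x" borel borel "A i"] A[OF that] by simp
  have e: "emeasure lborel (A i) = ennreal t * emeasure lborel (A' i)" if "i \<in> {..<k}" for i
  proof -
    have "emeasure lborel (A i) = emeasure (density (distr lborel borel (\<lambda>x. 0 + t * x)) (\<lambda>_. ennreal \<bar>t\<bar>)) (A i)"
      using lborel_real_affine[of t 0] t by simp
    also have "\<dots> = ennreal t * emeasure lborel (A' i)"
      using A[OF that] t by (simp add: emeasure_density_const emeasure_distr A'_def)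
    finally show ?thesis .
  qed
  have "emeasure (density (distr ?P ?P ?T) (\<lambda>_. ennreal (t ^ k))) (Pi\<^sub>E {..<k} A)
      = ennreal (t ^ k) * emeasure ?P (?T -` (Pi\<^sub>E {..<k} A) \<inter> space ?P)"
    using A T by (simp add: emeasure_density_const emeasure_distr sets_PiM_I_finite)
  also have "?T -` (Pi\<^sub>E {..<k} A) \<inter> space ?P = Pi\<^sub>E {..<k} A'"
    by (auto simp: space_PiM PiE_def Pi_def A'_def)
  also have "emeasure ?P (Pi\<^sub>E {..<k} A') = (\<Prod>i<k. emeasure lborel (A' i))"
    using A' by (intro lborel_product.emeasure_PiM) auto
  also have "ennreal (t ^ k) * (\<Prod>i<k. emeasure lborel (A' i)) = (\<Prod>i<k. ennreal t * emeasure lborel (A' i))"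
    using t by (simp add: prod.distrib ennreal_power)
  also have "\<dots> = (\<Prod>i<k. emeasure lborel (A i))" by (intro prod.cong) (auto simp: e)
  finally show "emeasure (density (distr ?P ?P ?T) (\<lambda>_. ennreal (t ^ k))) (Pi\<^sub>E {..<k} A) = (\<Prod>i<k. emeasure lborel (A i))" .
qed auto

lemma
  fixes f :: "(nat \<Rightarrow> real) \<Rightarrow> complex"
  assumes t: "t > 0" and f: "f \<in> borel_measurable (Pi\<^sub>M {..<k} (\<lambda>_. lborel))"
  shows integral_PiM_lborel_scale: "integral\<^sup>L (Pi\<^sub>M {..<k} (\<lambda>_. lborel)) f
      = of_real (t ^ k) * (\<integral>x. f (\<lambda>i\<in>{..<k}. t * x i) \<partial>(Pi\<^sub>M {..<k} (\<lambda>_. lborel)))" (is ?I)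
    and integrable_PiM_lborel_scale: "integrable (Pi\<^sub>M {..<k} (\<lambda>_. lborel)) (\<lambda>x. f (\<lambda>i\<in>{..<k}. t * x i))
      \<Longrightarrow> integrable (Pi\<^sub>M {..<k} (\<lambda>_. lborel)) f" (is "?A \<Longrightarrow> ?B")
proof -
  let ?P = "Pi\<^sub>M {..<k} (\<lambda>_. lborel :: real measure)" and ?T = "\<lambda>x. \<lambda>i\<in>{..<k}. t * x i"
  have T: "?T \<in> measurable ?P ?P"
    by (intro measurable_restrict measurable_compose[OF measurable_component_singleton]) auto
  have f': "f \<in> borel_measurable (distr ?P ?P ?T)" using f by simp
  have "integral\<^sup>L ?P f = integral\<^sup>L (density (distr ?P ?P ?T) (\<lambda>_. ennreal (t ^ k))) f"
    by (subst PiM_lborel_scale[OF t]) (rule refl)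
  also have "\<dots> = (\<integral>x. (t ^ k) *\<^sub>R f x \<partial>(distr ?P ?P ?T))"
    using t by (subst integral_density[OF f']) auto
  also have "\<dots> = (\<integral>x. (t ^ k) *\<^sub>R f (?T x) \<partial>?P)"
    using f by (subst integral_distr[OF T]) auto
  finally show ?I by (simp add: scaleR_conv_of_real)
  assume ?A
  then have "integrable (distr ?P ?P ?T) f" by (subst integrable_distr_eq[OF T f])
  then have "integrable (density (distr ?P ?P ?T) (\<lambda>_. ennreal (t ^ k))) f"
    using t by (subst integrable_density[OF f']) auto
  then show ?B by (subst PiM_lborel_scale[OF t])
qed

text \<open>The substitution \<open>x\<^sub>i = t y\<^sub>i\<close>. The Jacobian \<open>t\<^sup>k\<close> is distributed over the rows, and the factors
  \<open>a(y\<^sub>i) a(y\<^sub>j)\<close> are taken out of rows and columns, where they build the weight.\<close>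

lemma (in fredholm_weight)
  assumes t: "t > 0"
    and K: "\<And>x y. x > 1 \<Longrightarrow> y > 1 \<Longrightarrow> of_real t * K (t * x) (t * y) = of_real (a x) * of_real (a y) * L x y"
    and w: "\<And>x. w x = (if x > 1 then (a x)\<^sup>2 else 0)"
    and L: "case_prod L \<in> borel_measurable (borel \<Otimes>\<^sub>M borel)" "\<And>x y. cmod (L x y) \<le> B"
  shows fredholm_term_rescale: "fredholm_term K t k = weighted_fredholm_term w L k" (is ?I)
    and set_integrable_rho: "set_integrable (Pi\<^sub>M {..<k} (\<lambda>_. lborel)) (Pi\<^sub>E {..<k} (\<lambda>_. {t<..})) (rho K k)" (is ?S)
proof -
  let ?P = "Pi\<^sub>M {..<k} (\<lambda>_. lborel :: real measure)" and ?T = "\<lambda>x. \<lambda>i\<in>{..<k}. t * x i"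
  define f where "f x = indicator (Pi\<^sub>E {..<k} (\<lambda>_. {t<..})) x *\<^sub>R rho K k x" for x
  define g where "g x = fredholm_integrand w L k (\<lambda>i\<in>{..<k}. inverse t * x i) / of_real (t ^ k)" for x
  have fg: "f x = g x" if x: "x \<in> space ?P" for x
  proof (cases "x \<in> Pi\<^sub>E {..<k} (\<lambda>_. {t<..})")
    case True
    define y where "y i = inverse t * x i" for i
    have xy: "x i = t * y i" for i using t by (simp add: y_def)
    have y1: "y i > 1" if "i < k" for i
      using True that t by (auto simp: y_def field_simps PiE_def Pi_def)
    have "rho K k x = Determinant.det (Matrix.mat k k (\<lambda>(i,j). of_real (a (y i)) / of_real t * of_real (a (y j)) * L (y i) (y j)))"
      unfolding rho_def
    proof (intro arg_cong[where f = Determinant.det] eq_matI; clarsimp)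
      fix i j assume "i < k" "j < k"
      then show "K (x i) (x j) = complex_of_real (a (y i)) * complex_of_real (a (y j)) * L (y i) (y j) / complex_of_real t"
        using K[OF y1 y1, of i j] t by (simp add: xy field_simps)
    qed
    also have "\<dots> = (\<Prod>i<k. of_real (a (y i)) / of_real t) * (\<Prod>i<k. of_real (a (y i))) *
        Determinant.det (Matrix.mat k k (\<lambda>(i,j). L (y i) (y j)))"
      by (rule det_mat_scale_rows_cols)
    also have "(\<Prod>i<k. of_real (a (y i)) / of_real t) * (\<Prod>i<k. complex_of_real (a (y i))) = of_real (\<Prod>i<k. w (y i)) / of_real (t ^ k)"
      using y1 by (simp add: w prod_dividef power2_eq_square prod.distrib)
    also have "\<dots> * Determinant.det (Matrix.mat k k (\<lambda>(i,j). L (y i) (y j))) = g x"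
    proof -
      have "Matrix.mat k k (\<lambda>(i,j). L ((\<lambda>i\<in>{..<k}. inverse t * x i) i) ((\<lambda>i\<in>{..<k}. inverse t * x i) j))
          = Matrix.mat k k (\<lambda>(i,j). L (y i) (y j))"
        by (intro eq_matI) (auto simp: y_def)
      then show ?thesis unfolding g_def fredholm_integrand_def by (simp add: y_def)
    qed
    finally show ?thesis using True by (simp add: f_def)
  next
    case False
    then obtain i where i: "i < k" "x i \<le> t" using x by (force simp: space_PiM PiE_def Pi_def not_less)
    then have "inverse t * x i \<le> 1" using t mult_left_mono[of "x i" t "inverse t"] by simp
    then have "w (inverse t * x i) = 0" by (simp add: w)
    then have "(\<Prod>i<k. w ((\<lambda>i\<in>{..<k}. inverse t * x i) i)) = 0" using i(1) by (intro prod_zero) auto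
    then show ?thesis using False by (simp add: f_def g_def fredholm_integrand_def)
  qed
  have T': "(\<lambda>x. \<lambda>i\<in>{..<k}. inverse t * x i) \<in> measurable ?P ?P"
    by (intro measurable_restrict measurable_compose[OF measurable_component_singleton]) auto
  have gm: "g \<in> borel_measurable ?P"
    unfolding g_def
    using measurable_compose[OF T' measurable_fredholm_integrand[OF L(1) w_measurable]] by auto
  have gT: "g (?T x) = fredholm_integrand w L k x / of_real (t ^ k)" if "x \<in> space ?P" for x
  proof -
    have "(\<lambda>i\<in>{..<k}. inverse t * ?T x i) = x"
      using that t by (auto simp: space_PiM PiE_def extensional_def restrict_def)
    then show ?thesis unfolding g_def by simp
  qed
  have "integrable ?P (\<lambda>x. g (?T x))"
    using fredholm_integrand_integrable[OF L] gT by (subst Bochner_Integration.integrable_cong[OF refl gT]) auto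
  then have "integrable ?P g" by (rule integrable_PiM_lborel_scale[OF t gm])
  then have "integrable ?P f" using fg by (subst Bochner_Integration.integrable_cong[OF refl fg]) auto
  then show ?S by (simp add: set_integrable_def f_def[abs_def])
  have "integral\<^sup>L ?P f = integral\<^sup>L ?P g" by (rule Bochner_Integration.integral_cong[OF refl fg])
  also have "\<dots> = of_real (t ^ k) * (\<integral>x. g (?T x) \<partial>?P)" by (rule integral_PiM_lborel_scale[OF t gm])
  also have "(\<integral>x. g (?T x) \<partial>?P) = (\<integral>x. fredholm_integrand w L k x / of_real (t ^ k) \<partial>?P)"
    by (rule Bochner_Integration.integral_cong[OF refl gT])
  finally have "integral\<^sup>L ?P f = integral\<^sup>L ?P (fredholm_integrand w L k)" using t by simp
  then show ?I by (simp add: fredholm_term_def weighted_fredholm_term_def set_lebesgue_integral_def f_def[abs_def])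
qed


section \<open>Fredholm determinants of kernels in reciprocal coordinates\<close>

text \<open>The value on the diagonal is the continuous extension of the quotient.\<close>

definition wronskian_quotient :: "(complex \<Rightarrow> complex) \<Rightarrow> (complex \<Rightarrow> complex) \<Rightarrow> complex \<Rightarrow> complex \<Rightarrow> complex" where
  "wronskian_quotient f h a b =
     (if a = b then f a * deriv h a - h a * deriv f a else (f a * h b - h a * f b) / (b - a))"

definition strip :: "complex set" where "strip = {z. \<bar>Im z\<bar> < 1}"

text \<open>The reciprocals of positive numbers \<open>t\<close> lie here, and \<open>c z\<close> stays in \<open>strip\<close> for \<open>z\<close> in this
  set and \<open>0 \<le> c \<le> 1\<close>.\<close>

definition half_strip :: "complex set" where "half_strip = {z. 0 < Re z \<and> \<bar>Im z\<bar> < 1}"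

lemma open_strip: "open strip" and convex_strip: "convex strip"
proof -
  have e: "strip = {z. Im z < 1} \<inter> {z. Im z > -1}" by (auto simp: strip_def)
  show "open strip" unfolding e by (intro open_Int open_halfspace_Im_lt open_halfspace_Im_gt)
  show "convex strip" unfolding e by (intro convex_Int convex_halfspace_Im_lt convex_halfspace_Im_gt)
qed

lemma open_half_strip: "open half_strip"
proof -
  have e: "half_strip = {z. Re z > 0} \<inter> strip" by (auto simp: strip_def half_strip_def)
  show ?thesis unfolding e by (intro open_Int open_halfspace_Re_gt open_strip)
qed

text \<open>The numerator is \<open>f(a) (h(b) - h(a)) - h(a) (f(b) - f(a))\<close>, and on a convex set bounds for the
  derivatives are Lipschitz constants. No denominator enters the bound, so it is uniform up to the
  diagonal.\<close>

lemma norm_wronskian_quotient_le: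
  assumes U: "open U" "f holomorphic_on U" "h holomorphic_on U" and K: "convex K" "K \<subseteq> U"
    and B: "\<And>z. z \<in> K \<Longrightarrow> cmod (f z) \<le> B" "\<And>z. z \<in> K \<Longrightarrow> cmod (h z) \<le> B"
      "\<And>z. z \<in> K \<Longrightarrow> cmod (deriv f z) \<le> B" "\<And>z. z \<in> K \<Longrightarrow> cmod (deriv h z) \<le> B"
    and ab: "a \<in> K" "b \<in> K"
  shows "cmod (wronskian_quotient f h a b) \<le> 2 * B * B"
proof -
  have B0: "0 \<le> B" using order_trans[OF norm_ge_zero B(1)[OF ab(1)]] .
  have lip: "cmod (g b - g a) \<le> B * cmod (b - a)"
    if "g holomorphic_on U" "\<And>z. z \<in> K \<Longrightarrow> cmod (deriv g z) \<le> B" for g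
  proof (rule field_differentiable_bound[OF K(1) _ that(2) ab(2,1)])
    show "(g has_field_derivative deriv g z) (at z within K)" if "z \<in> K" for z
      using that K(2) by (intro has_field_derivative_at_within[OF holomorphic_derivI[OF \<open>g holomorphic_on U\<close> U(1)]]) auto
  qed
  show ?thesis
  proof (cases "a = b")
    case True
    have "cmod (f a * deriv h a - h a * deriv f a) \<le> cmod (f a * deriv h a) + cmod (h a * deriv f a)"
      by (rule norm_triangle_ineq4)
    also have "\<dots> \<le> B * B + B * B"
      unfolding norm_mult using B ab B0 by (intro add_mono mult_mono) auto
    finally show ?thesis using True by (simp add: wronskian_quotient_def)
  next
    case False
    have "f a * h b - h a * f b = f a * (h b - h a) - h a * (f b - f a)" by (simp add: algebra_simps)
    also have "cmod \<dots> \<le> cmod (f a * (h b - h a)) + cmod (h a * (f b - f a))"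
      by (rule norm_triangle_ineq4)
    also have "\<dots> \<le> B * (B * cmod (b - a)) + B * (B * cmod (b - a))"
      unfolding norm_mult using B ab B0 lip[OF U(2)] lip[OF U(3)] by (intro add_mono mult_mono) auto
    finally show ?thesis using False
      by (simp add: wronskian_quotient_def norm_divide pos_divide_le_eq algebra_simps)
  qed
qed

text \<open>Equal to \<open>1/x\<close> on \<open>(1,\<infinity>)\<close>, where the weight \<open>tail_weight\<close> lives, and continued by \<open>1\<close>; thus
  the rescaled kernel below is defined, measurable and bounded on all of \<open>\<real>\<^sup>2\<close>.\<close>

definition clamped_reciprocal :: "real \<Rightarrow> real" where "clamped_reciprocal x = 1 / max 1 x"

lemma clamped_reciprocal_bounds: "0 < clamped_reciprocal x" "clamped_reciprocal x \<le> 1"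
  by (auto simp: clamped_reciprocal_def)

lemma continuous_clamped_reciprocal: "continuous_on UNIV clamped_reciprocal"
  unfolding clamped_reciprocal_def[abs_def] by (intro continuous_intros) auto

definition scaled_kernel :: "real \<Rightarrow> (complex \<Rightarrow> complex) \<Rightarrow> (complex \<Rightarrow> complex) \<Rightarrow> complex \<Rightarrow> real \<Rightarrow> real \<Rightarrow> complex" where
  "scaled_kernel \<sigma> f h z x y = z powr of_real (2 * \<sigma> + 1) *
     wronskian_quotient f h (z * of_real (clamped_reciprocal x)) (z * of_real (clamped_reciprocal y))"

lemma clamped_reciprocal_in_strip:
  assumes "z \<in> half_strip" shows "z * of_real (clamped_reciprocal x) \<in> strip"
proof -
  have "\<bar>Im z\<bar> * clamped_reciprocal x \<le> \<bar>Im z\<bar> * 1" using clamped_reciprocal_bounds[of x] by (intro mult_left_mono) auto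
  then show ?thesis using assms clamped_reciprocal_bounds[of x] by (auto simp: strip_def half_strip_def abs_mult)
qed

lemma half_strip_nonzero: "z \<in> half_strip \<Longrightarrow> z \<noteq> 0" "z \<in> half_strip \<Longrightarrow> z \<notin> \<real>\<^sub>\<le>\<^sub>0"
  by (auto simp: half_strip_def complex_nonpos_Reals_iff)

lemma measurable_scaled_kernel:
  assumes f: "f holomorphic_on strip" and h: "h holomorphic_on strip" and z: "z \<in> half_strip"
  shows "case_prod (scaled_kernel \<sigma> f h z) \<in> borel_measurable (borel \<Otimes>\<^sub>M borel)"
proof -
  have m: "(\<lambda>x. g (z * of_real (clamped_reciprocal x))) \<in> borel_measurable borel" if "g holomorphic_on strip" for g
    using clamped_reciprocal_in_strip[OF z]
    by (intro borel_measurable_continuous_onI continuous_on_compose2[OF holomorphic_on_imp_continuous_on[OF that]]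
         continuous_intros continuous_clamped_reciprocal) auto
  note [measurable] = m[OF f] m[OF h] m[OF holomorphic_deriv[OF f open_strip]] m[OF holomorphic_deriv[OF h open_strip]]
    m[OF holomorphic_on_id, unfolded id_def]
  show ?thesis
    unfolding scaled_kernel_def wronskian_quotient_def case_prod_beta' by measurable
qed

lemma holomorphic_scaled_kernel:
  assumes f: "f holomorphic_on strip" and h: "h holomorphic_on strip"
  shows "(\<lambda>z. scaled_kernel \<sigma> f h z x y) holomorphic_on half_strip"
proof -
  have c: "(\<lambda>z. g (z * of_real (clamped_reciprocal x))) holomorphic_on half_strip" if "g holomorphic_on strip" for g x
    using holomorphic_on_compose_gen[OF _ that, of "\<lambda>z. z * of_real (clamped_reciprocal x)" half_strip] clamped_reciprocal_in_strip
    by (force simp: o_def intro!: holomorphic_intros)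
  note hol = c[OF f] c[OF h] c[OF holomorphic_deriv[OF f open_strip]] c[OF holomorphic_deriv[OF h open_strip]]
  have p: "(\<lambda>z. z powr of_real (2 * \<sigma> + 1)) holomorphic_on half_strip"
    using half_strip_nonzero by (intro holomorphic_intros) auto
  show ?thesis
  proof (cases "clamped_reciprocal x = clamped_reciprocal y")
    case True
    then show ?thesis unfolding scaled_kernel_def wronskian_quotient_def
      by (auto intro!: holomorphic_on_mult holomorphic_on_diff hol p[simplified])
  next
    case False
    have "(\<lambda>z. z powr of_real (2 * \<sigma> + 1) * ((f (z * of_real (clamped_reciprocal x)) * h (z * of_real (clamped_reciprocal y))
        - h (z * of_real (clamped_reciprocal x)) * f (z * of_real (clamped_reciprocal y)))
        / (z * of_real (clamped_reciprocal y) - z * of_real (clamped_reciprocal x)))) holomorphic_on half_strip"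
      using False half_strip_nonzero(1)
      by (intro holomorphic_on_mult[OF p] holomorphic_on_divide holomorphic_on_diff holomorphic_on_mult hol holomorphic_intros) auto
    then show ?thesis
      by (rule holomorphic_transform) (use False half_strip_nonzero(1) in \<open>auto simp: scaled_kernel_def wronskian_quotient_def\<close>)
  qed
qed

text \<open>All arguments \<open>z \<cdot> clamped_reciprocal x\<close> lie in the image of \<open>K \<times> [0,1]\<close> under multiplication. Its convex
  hull is a compact convex subset of the strip, on which the functions and their derivatives are
  eventually bounded.\<close>

lemma scaled_kernel_eventually_bounded:
  assumes F: "boundedly_converges F f strip" and H: "boundedly_converges H h strip"
    and K: "compact K" "K \<subseteq> half_strip"
  shows "\<exists>B. \<forall>\<^sub>F n in sequentially. \<forall>z\<in>K. \<forall>x y. cmod (scaled_kernel \<sigma> (F n) (H n) z x y) \<le> B"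
proof -
  define K1 where "K1 = (\<lambda>(z, c). z * of_real c) ` (K \<times> {0..1::real})"
  have "compact K1" unfolding K1_def
    by (intro compact_continuous_image compact_Times K compact_Icc) (auto simp: case_prod_beta intro!: continuous_intros)
  \<comment> \<open>The hull is needed because the bound for the Wronskian quotient joins its two arguments by a segment.\<close>
  define K2 where "K2 = convex hull K1"
  have "K1 \<subseteq> strip"
  proof
    fix u assume "u \<in> K1"
    then obtain z c where u: "u = z * of_real c" "z \<in> K" "0 \<le> c" "c \<le> 1" by (auto simp: K1_def)
    then have "\<bar>Im z\<bar> * c \<le> \<bar>Im z\<bar> * 1" by (intro mult_left_mono) auto
    then show "u \<in> strip" using u K(2) by (auto simp: strip_def half_strip_def abs_mult)
  qed
  then have K2: "compact K2" "convex K2" "K2 \<subseteq> strip"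
    using \<open>compact K1\<close> convex_strip by (auto simp: K2_def compact_convex_hull hull_minimal)
  have zK2: "z * of_real (clamped_reciprocal x) \<in> K2" if "z \<in> K" for z x
    unfolding K2_def using that clamped_reciprocal_bounds[of x]
    by (intro hull_inc) (auto simp: K1_def intro!: image_eqI[of _ _ "(z, clamped_reciprocal x)"])
  note bd = boundedly_convergesD(5)[OF _ K2(1,3)]
  obtain B1 where B1: "\<forall>\<^sub>F n in sequentially. \<forall>z\<in>K2. cmod (F n z) \<le> B1" using bd[OF F] by blast
  obtain B2 where B2: "\<forall>\<^sub>F n in sequentially. \<forall>z\<in>K2. cmod (H n z) \<le> B2" using bd[OF H] by blast
  obtain B3 where B3: "\<forall>\<^sub>F n in sequentially. \<forall>z\<in>K2. cmod (deriv (F n) z) \<le> B3"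
    using bd[OF boundedly_converges_deriv[OF F]] by blast
  obtain B4 where B4: "\<forall>\<^sub>F n in sequentially. \<forall>z\<in>K2. cmod (deriv (H n) z) \<le> B4"
    using bd[OF boundedly_converges_deriv[OF H]] by blast
  define B where "B = max (max B1 B2) (max B3 B4)"
  have "(\<lambda>z. z powr of_real (2 * \<sigma> + 1)) holomorphic_on half_strip"
    using half_strip_nonzero by (intro holomorphic_intros) auto
  from bounded_on_compact[OF this K] obtain A where A: "\<And>z. z \<in> K \<Longrightarrow> cmod (z powr of_real (2 * \<sigma> + 1)) \<le> A" by blast
  have "\<forall>\<^sub>F n in sequentially. \<forall>z\<in>K. \<forall>x y. cmod (scaled_kernel \<sigma> (F n) (H n) z x y) \<le> A * (2 * B * B)"
    using B1 B2 B3 B4 eventually_ge_at_top[of 1]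
  proof eventually_elim
    case (elim n)
    show ?case
    proof (intro ballI allI)
      fix z x y assume z: "z \<in> K"
      have "cmod (wronskian_quotient (F n) (H n) (z * of_real (clamped_reciprocal x)) (z * of_real (clamped_reciprocal y))) \<le> 2 * B * B"
        using elim z
        by (intro norm_wronskian_quotient_le[OF open_strip boundedly_convergesD(2)[OF F] boundedly_convergesD(2)[OF H] K2(2,3)])
           (auto simp: B_def zK2 intro: max.coboundedI1 max.coboundedI2)
      then show "cmod (scaled_kernel \<sigma> (F n) (H n) z x y) \<le> A * (2 * B * B)"
        unfolding scaled_kernel_def norm_mult using A[OF z]
        by (intro mult_mono) (auto intro: order_trans[OF norm_ge_zero])
    qed
  qed
  then show ?thesis by blast
qed

lemma scaled_kernel_tendsto:
  assumes F: "boundedly_converges F f strip" and H: "boundedly_converges H h strip" and z: "z \<in> half_strip"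
  shows "(\<lambda>n. scaled_kernel \<sigma> (F n) (H n) z x y) \<longlonglongrightarrow> scaled_kernel \<sigma> f h z x y"
proof -
  note t = boundedly_convergesD(4)[OF F clamped_reciprocal_in_strip[OF z]] boundedly_convergesD(4)[OF H clamped_reciprocal_in_strip[OF z]]
    boundedly_convergesD(4)[OF boundedly_converges_deriv[OF F] clamped_reciprocal_in_strip[OF z]]
    boundedly_convergesD(4)[OF boundedly_converges_deriv[OF H] clamped_reciprocal_in_strip[OF z]]
  show ?thesis
    unfolding scaled_kernel_def wronskian_quotient_def
    by (cases "z * of_real (clamped_reciprocal x) = z * of_real (clamped_reciprocal y)")
       (auto intro!: tendsto_intros t)
qed

definition tail_weight :: "real \<Rightarrow> real \<Rightarrow> real" where
  "tail_weight \<sigma> x = (if x > 1 then (x powr (- \<sigma> - 1))\<^sup>2 else 0)"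

text \<open>The weight is \<open>x\<^sup>-\<^sup>2\<^sup>\<sigma>\<^sup>-\<^sup>2\<close> on \<open>(1,\<infinity>)\<close>, and \<open>-2\<sigma> - 2 < -1\<close>.\<close>

lemma fredholm_weight_tail_weight:
  assumes "\<sigma> > - 1 / 2"
  shows "fredholm_weight (tail_weight \<sigma>)"
proof
  show "0 \<le> tail_weight \<sigma> x" for x by (simp add: tail_weight_def)
  define e where "e = - 2 * \<sigma> - 2"
  have "((\<lambda>x::real. x powr e) has_integral - (1 powr (e + 1)) / (e + 1)) {1..}"
    using assms by (intro has_integral_powr_to_inf) (auto simp: e_def)
  then have "(\<lambda>x::real. x powr e) absolutely_integrable_on {1..}"
    by (intro nonnegative_absolutely_integrable_1) (auto simp: integrable_on_def)
  then have "(\<lambda>x::real. x powr e) absolutely_integrable_on {1<..}"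
    by (rule set_integrable_subset) auto
  moreover have "(\<lambda>x. indicator {1<..} x *\<^sub>R x powr e) = tail_weight \<sigma>"
    by (rule ext) (auto simp: tail_weight_def e_def power2_eq_square powr_add[symmetric])
  ultimately have "integrable lebesgue (tail_weight \<sigma>)"
    by (simp add: set_integrable_def)
  moreover have "tail_weight \<sigma> \<in> borel_measurable borel"
    unfolding tail_weight_def[abs_def] by measurable
  ultimately show "integrable lborel (tail_weight \<sigma>)"
    by (subst (asm) integrable_completion) auto
qed

definition kernel_fredholm :: "real \<Rightarrow> (complex \<Rightarrow> complex) \<Rightarrow> (complex \<Rightarrow> complex) \<Rightarrow> complex \<Rightarrow> complex" where
  "kernel_fredholm \<sigma> f h z = weighted_fredholm_det (tail_weight \<sigma>) (scaled_kernel \<sigma> f h z)"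

lemma scaled_kernel_bounded:
  assumes "f holomorphic_on strip" "h holomorphic_on strip" "compact K" "K \<subseteq> half_strip"
  shows "\<exists>B. \<forall>z\<in>K. \<forall>x y. cmod (scaled_kernel \<sigma> f h z x y) \<le> B"
  using scaled_kernel_eventually_bounded[OF boundedly_converges_const[OF open_strip assms(1)]
      boundedly_converges_const[OF open_strip assms(2)] assms(3,4), of \<sigma>] by simp

lemma kernel_fredholm_holomorphic:
  assumes "\<sigma> > - 1 / 2" "f holomorphic_on strip" "h holomorphic_on strip"
  shows "kernel_fredholm \<sigma> f h holomorphic_on half_strip"
proof -
  interpret fredholm_weight "tail_weight \<sigma>" by (rule fredholm_weight_tail_weight) fact
  show ?thesis unfolding kernel_fredholm_def[abs_def]
    using assms(2,3) by (intro fredholm_det_holomorphic open_half_strip holomorphic_scaled_kernel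
      measurable_scaled_kernel scaled_kernel_bounded)
qed

lemma kernel_fredholm_converges:
  assumes \<sigma>: "\<sigma> > - 1 / 2" and F: "boundedly_converges F f strip" and H: "boundedly_converges H h strip"
  shows "boundedly_converges (\<lambda>n. kernel_fredholm \<sigma> (F n) (H n)) (kernel_fredholm \<sigma> f h) half_strip"
proof (rule boundedly_convergesI)
  interpret fredholm_weight "tail_weight \<sigma>" by (rule fredholm_weight_tail_weight) fact
  note hol = boundedly_convergesD(2)[OF F] boundedly_convergesD(2)[OF H]
  show "open half_strip" by (rule open_half_strip)
  show "kernel_fredholm \<sigma> (F n) (H n) holomorphic_on half_strip" if "n \<ge> 1" for n
    by (intro kernel_fredholm_holomorphic \<sigma> hol that)
  show "kernel_fredholm \<sigma> f h holomorphic_on half_strip"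
    by (intro kernel_fredholm_holomorphic \<sigma> boundedly_convergesD(3)[OF F] boundedly_convergesD(3)[OF H])
  show "(\<lambda>n. kernel_fredholm \<sigma> (F n) (H n) z) \<longlonglongrightarrow> kernel_fredholm \<sigma> f h z" if z: "z \<in> half_strip" for z
  proof -
    obtain B where "\<forall>\<^sub>F n in sequentially. \<forall>z\<in>{z}. \<forall>x y. cmod (scaled_kernel \<sigma> (F n) (H n) z x y) \<le> B"
      using scaled_kernel_eventually_bounded[OF F H, of "{z}"] z by auto
    then obtain n0 where n0: "\<And>n x y. n \<ge> n0 \<Longrightarrow> cmod (scaled_kernel \<sigma> (F n) (H n) z x y) \<le> B"
      unfolding eventually_sequentially by blast
    have "(\<lambda>n. weighted_fredholm_det (tail_weight \<sigma>) (scaled_kernel \<sigma> (F (n + Suc n0)) (H (n + Suc n0)) z))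
        \<longlonglongrightarrow> weighted_fredholm_det (tail_weight \<sigma>) (scaled_kernel \<sigma> f h z)"
    proof (rule fredholm_det_tendsto)
      show "case_prod (scaled_kernel \<sigma> (F (n + Suc n0)) (H (n + Suc n0)) z) \<in> borel_measurable (borel \<Otimes>\<^sub>M borel)" for n
        by (intro measurable_scaled_kernel hol z) auto
      show "case_prod (scaled_kernel \<sigma> f h z) \<in> borel_measurable (borel \<Otimes>\<^sub>M borel)"
        by (intro measurable_scaled_kernel boundedly_convergesD(3)[OF F] boundedly_convergesD(3)[OF H] z)
      show "cmod (scaled_kernel \<sigma> (F (n + Suc n0)) (H (n + Suc n0)) z x y) \<le> B" for n x y by (intro n0) auto
      show "(\<lambda>n. scaled_kernel \<sigma> (F (n + Suc n0)) (H (n + Suc n0)) z x y) \<longlonglongrightarrow> scaled_kernel \<sigma> f h z x y" for x y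
        by (rule LIMSEQ_ignore_initial_segment[OF scaled_kernel_tendsto[OF F H z]])
    qed
    then show ?thesis unfolding kernel_fredholm_def by (rule LIMSEQ_offset)
  qed
  fix K assume K: "compact K" "K \<subseteq> half_strip"
  obtain B where B: "\<forall>\<^sub>F n in sequentially. \<forall>z\<in>K. \<forall>x y. cmod (scaled_kernel \<sigma> (F n) (H n) z x y) \<le> B"
    using scaled_kernel_eventually_bounded[OF F H K] by blast
  have "\<forall>\<^sub>F n in sequentially. \<forall>z\<in>K. cmod (kernel_fredholm \<sigma> (F n) (H n) z) \<le> 1 + (\<Sum>k. term_bound B (Suc k))"
    using B eventually_ge_at_top[of 1]
  proof eventually_elim
    case (elim n)
    then show ?case unfolding kernel_fredholm_def
      using K(2) by (intro ballI norm_fredholm_det_le measurable_scaled_kernel hol) auto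
  qed
  then show "\<exists>B. \<forall>\<^sub>F n in sequentially. \<forall>z\<in>K. cmod (kernel_fredholm \<sigma> (F n) (H n) z) \<le> B" by blast
qed

definition reciprocal_kernel :: "real \<Rightarrow> (complex \<Rightarrow> complex) \<Rightarrow> (complex \<Rightarrow> complex) \<Rightarrow> real \<Rightarrow> real \<Rightarrow> complex" where
  "reciprocal_kernel \<sigma> f h x y =
     of_real ((x * y) powr (- \<sigma> - 1)) * wronskian_quotient f h (of_real (1 / x)) (of_real (1 / y))"

text \<open>For \<open>x, y > 1\<close> the powers of \<open>t\<close> in \<open>t (t\<^sup>2 x y)\<^sup>-\<^sup>\<sigma>\<^sup>-\<^sup>1\<close> combine to \<open>(1/t)\<^sup>2\<^sup>\<sigma>\<^sup>+\<^sup>1\<close>, the power of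
  \<open>z\<close> in \<open>scaled_kernel\<close>.\<close>

lemma
  assumes \<sigma>: "\<sigma> > - 1 / 2" and f: "f holomorphic_on strip" and h: "h holomorphic_on strip"
    and K: "\<And>x y. x > 0 \<Longrightarrow> y > 0 \<Longrightarrow> K x y = reciprocal_kernel \<sigma> f h x y" and t: "t > 0"
  shows fredholm_det_reciprocal_kernel: "fredholm_det K t = kernel_fredholm \<sigma> f h (of_real (1 / t))" (is ?D)
    and fredholm_converges_reciprocal_kernel: "fredholm_converges K t" (is ?C)
proof -
  interpret fredholm_weight "tail_weight \<sigma>" by (rule fredholm_weight_tail_weight) fact
  define z where "z = complex_of_real (1 / t)"
  define L where "L = scaled_kernel \<sigma> f h z"
  have z: "z \<in> half_strip" using t by (simp add: z_def half_strip_def)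
  have Lm: "case_prod L \<in> borel_measurable (borel \<Otimes>\<^sub>M borel)"
    unfolding L_def by (intro measurable_scaled_kernel f h z)
  obtain B where Lb: "\<And>x y. cmod (L x y) \<le> B"
    using scaled_kernel_bounded[OF f h, of "{z}" \<sigma>] z unfolding L_def by auto
  have KL: "of_real t * K (t * x) (t * y) = of_real (x powr (- \<sigma> - 1)) * of_real (y powr (- \<sigma> - 1)) * L x y"
    if "x > 1" "y > 1" for x y
  proof -
    have p: "t * (t * x * (t * y)) powr (- \<sigma> - 1) = x powr (- \<sigma> - 1) * y powr (- \<sigma> - 1) * (1 / t) powr (2 * \<sigma> + 1)"
    proof -
      have "t * (t * x * (t * y)) powr (- \<sigma> - 1)
          = x powr (- \<sigma> - 1) * y powr (- \<sigma> - 1) * (t powr 1 * t powr (- \<sigma> - 1) * t powr (- \<sigma> - 1))"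
        using that t by (simp add: powr_mult)
      also have "t powr 1 * t powr (- \<sigma> - 1) * t powr (- \<sigma> - 1) = t powr (- (2 * \<sigma> + 1))"
        unfolding powr_add[symmetric] by (rule arg_cong[where f = "(powr) t"]) simp
      also have "\<dots> = (1 / t) powr (2 * \<sigma> + 1)"
        using powr_divide[of 1 t "2 * \<sigma> + 1"] powr_minus[of t "2 * \<sigma> + 1"] t
        by (simp only: inverse_eq_divide powr_one_eq_one zero_le_one less_imp_le)
      finally show ?thesis .
    qed
    have q: "z powr of_real (2 * \<sigma> + 1) = of_real ((1 / t) powr (2 * \<sigma> + 1))"
      unfolding z_def using t by (subst powr_of_real) auto
    have "of_real t * K (t * x) (t * y) = of_real t * reciprocal_kernel \<sigma> f h (t * x) (t * y)"
      using that t by (subst K) auto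
    also have "\<dots> = of_real (t * (t * x * (t * y)) powr (- \<sigma> - 1)) *
        wronskian_quotient f h (of_real (1 / (t * x))) (of_real (1 / (t * y)))"
      by (simp add: reciprocal_kernel_def)
    also have "complex_of_real (1 / (t * x)) = z * of_real (clamped_reciprocal x)"
      using that by (simp add: z_def clamped_reciprocal_def max_def)
    also have "complex_of_real (1 / (t * y)) = z * of_real (clamped_reciprocal y)"
      using that by (simp add: z_def clamped_reciprocal_def max_def)
    finally show ?thesis unfolding p L_def scaled_kernel_def q by simp
  qed
  have T: "fredholm_term K t k = weighted_fredholm_term (tail_weight \<sigma>) L k"
    "set_integrable (Pi\<^sub>M {..<k} (\<lambda>_. lborel)) (Pi\<^sub>E {..<k} (\<lambda>_. {t<..})) (rho K k)" for k
    using fredholm_term_rescale[where K = K and L = L and a = "\<lambda>x. x powr (- \<sigma> - 1)", OF t KL tail_weight_def Lm Lb]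
      set_integrable_rho[where K = K and L = L and a = "\<lambda>x. x powr (- \<sigma> - 1)", OF t KL tail_weight_def Lm Lb]
    by blast+
  show ?D unfolding fredholm_det_def kernel_fredholm_def weighted_fredholm_det_def T(1) L_def z_def ..
  show ?C unfolding fredholm_converges_def T(1) using T(2) fredholm_series_summable[OF Lm Lb] by blast
qed


section \<open>Kernels on the diagonal\<close>

text \<open>This explains the values of both kernels on the diagonal: they are the limits of the values
  beside it.\<close>

lemma wronskian_kernel_diagonal_limit:
  fixes P Q :: "real \<Rightarrow> complex"
  assumes P: "(P has_vector_derivative P') (at x)" and Q: "(Q has_vector_derivative Q') (at x)"
  shows "((\<lambda>y. (P x * Q y - Q x * P y) / of_real (x - y)) \<longlongrightarrow> P' * Q x - P x * Q') (at x)"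
proof -
  have sl: "((\<lambda>y. (g y - g x) / of_real (y - x)) \<longlongrightarrow> g') (at x)" if "(g has_vector_derivative g') (at x)" for g :: "real \<Rightarrow> complex" and g'
  proof -
    have "((\<lambda>y. norm (g y - g x - (y - x) *\<^sub>R g') / norm (y - x)) \<longlongrightarrow> 0) (at x)"
      using that unfolding has_vector_derivative_def has_derivative_iff_norm by blast
    then have "((\<lambda>y. norm ((g y - g x) / of_real (y - x) - g')) \<longlongrightarrow> 0) (at x)"
    proof (rule Lim_transform_eventually)
      have "norm (g y - g x - (y - x) *\<^sub>R g') / norm (y - x) = norm ((g y - g x) / of_real (y - x) - g')" if "y \<noteq> x" for y
      proof -
        have "(g y - g x) / of_real (y - x) - g' = (g y - g x - of_real (y - x) * g') / of_real (y - x)"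
          using that by (simp add: diff_divide_distrib)
        then show ?thesis by (simp only: norm_divide norm_of_real scaleR_conv_of_real real_norm_def)
      qed
      then show "\<forall>\<^sub>F y in at x. norm (g y - g x - (y - x) *\<^sub>R g') / norm (y - x) = norm ((g y - g x) / of_real (y - x) - g')"
        unfolding eventually_at_filter by (intro always_eventually) blast
    qed
    then show ?thesis by (rule LIM_zero_cancel[OF tendsto_norm_zero_cancel])
  qed
  have "((\<lambda>y. (P y - P x) / of_real (y - x) * Q x - P x * ((Q y - Q x) / of_real (y - x))) \<longlongrightarrow> P' * Q x - P x * Q') (at x)"
    by (intro tendsto_intros sl P Q)
  then show ?thesis
  proof (rule Lim_transform_eventually)
    show "\<forall>\<^sub>F y in at x. (P y - P x) / of_real (y - x) * Q x - P x * ((Q y - Q x) / of_real (y - x)) = (P x * Q y - Q x * P y) / of_real (x - y)"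
    proof -
      have q: "a / d * Q x - P x * (b / d) = (P x * b - Q x * a) / (- d)" for a b d :: complex
      proof -
        have "(P x * b - Q x * a) / (- d) = - ((P x * b - Q x * a) / d)"
          by (rule minus_divide_right[symmetric])
        also have "\<dots> = Q x * a / d - P x * b / d" by (simp only: diff_divide_distrib minus_diff_eq)
        finally show ?thesis by (simp only: times_divide_eq_right times_divide_eq_left mult.commute)
      qed
      have n: "P x * (Q y - Q x) - Q x * (P y - P x) = P x * Q y - Q x * P y" for y
        by (simp add: algebra_simps)
      have m: "- complex_of_real (y - x) = of_real (x - y)" for y by simp
      have "(P y - P x) / of_real (y - x) * Q x - P x * ((Q y - Q x) / of_real (y - x))
          = (P x * Q y - Q x * P y) / of_real (x - y)" for y
        unfolding q n m ..
      then show ?thesis by (intro always_eventually) blast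
    qed
  qed
qed

lemma has_vector_derivative_reciprocal:
  assumes g: "g holomorphic_on strip" and x: "x > 0"
  shows "((\<lambda>y. g (of_real (1 / y))) has_vector_derivative (- (1 / x\<^sup>2)) *\<^sub>R deriv g (of_real (1 / x))) (at x)"
proof -
  have r: "((\<lambda>y. 1 / y) has_real_derivative - (1 / x\<^sup>2)) (at x)"
    using x by (auto intro!: derivative_eq_intros simp: power2_eq_square)
  have "(g has_field_derivative deriv g (of_real (1 / x))) (at (of_real (1 / x)))"
    by (rule holomorphic_derivI[OF g open_strip]) (simp add: strip_def)
  then have "((\<lambda>t. g (of_real t)) has_vector_derivative deriv g (of_real (1 / x))) (at (1 / x))"
    using has_vector_derivative_real_field by blast
  with r have "((\<lambda>t. g (of_real t)) \<circ> (\<lambda>y. 1 / y) has_vector_derivative (- (1 / x\<^sup>2)) *\<^sub>R deriv g (of_real (1 / x))) (at x)"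
    unfolding has_real_derivative_iff_has_vector_derivative
    by (intro vector_diff_chain_at)
  then show ?thesis by (simp only: o_def)
qed

lemma reciprocal_kernel_isCont_diagonal:
  assumes f: "f holomorphic_on strip" and h: "h holomorphic_on strip" and x: "x > 0"
  shows "isCont (reciprocal_kernel \<sigma> f h x) x"
proof -
  define p q where "p y = f (of_real (1 / y))" and "q y = h (of_real (1 / y))" for y :: real
  note d = has_vector_derivative_reciprocal[OF _ x]
  have "((\<lambda>y. of_real ((x * y) powr (- \<sigma> - 1)) * (of_real (x * y) * ((p x * q y - q x * p y) / of_real (x - y))))
     \<longlongrightarrow> of_real ((x * x) powr (- \<sigma> - 1)) * (of_real (x * x) *
       ((- (1 / x\<^sup>2)) *\<^sub>R deriv f (of_real (1 / x)) * q x - p x * ((- (1 / x\<^sup>2)) *\<^sub>R deriv h (of_real (1 / x)))))) (at x)"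
    using x unfolding p_def q_def
    by (intro tendsto_mult tendsto_of_real tendsto_powr tendsto_const tendsto_ident_at
        wronskian_kernel_diagonal_limit d f h) auto
  also have "of_real ((x * x) powr (- \<sigma> - 1)) * (of_real (x * x) *
       ((- (1 / x\<^sup>2)) *\<^sub>R deriv f (of_real (1 / x)) * q x - p x * ((- (1 / x\<^sup>2)) *\<^sub>R deriv h (of_real (1 / x)))))
      = reciprocal_kernel \<sigma> f h x x"
    using x by (simp add: reciprocal_kernel_def wronskian_quotient_def p_def q_def scaleR_conv_of_real field_simps power2_eq_square)
  finally have lim: "((\<lambda>y. of_real ((x * y) powr (- \<sigma> - 1)) * (of_real (x * y) * ((p x * q y - q x * p y) / of_real (x - y))))
     \<longlongrightarrow> reciprocal_kernel \<sigma> f h x x) (at x)" .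
  have "\<forall>\<^sub>F y in at x. y \<in> {0<..} - {x}"
    using x by (intro eventually_at_in_open) auto
  then have "\<forall>\<^sub>F y in at x. of_real ((x * y) powr (- \<sigma> - 1)) * (of_real (x * y) * ((p x * q y - q x * p y) / of_real (x - y)))
      = reciprocal_kernel \<sigma> f h x y"
  proof eventually_elim
    case (elim y)
    then have y: "y > 0" "y \<noteq> x" by auto
    have "complex_of_real (1 / y) - of_real (1 / x) = of_real ((x - y) / (x * y))"
      using x y by (simp add: field_simps)
    moreover have "complex_of_real (1 / x) \<noteq> of_real (1 / y)" using x y by simp
    ultimately show ?case using x y
      by (simp add: reciprocal_kernel_def wronskian_quotient_def p_def q_def)
  qed
  then show ?thesis unfolding isCont_def by (rule Lim_transform_eventually[OF lim])
qed

text \<open>Identities between kernels need to be checked off the diagonal only, because both sides are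
  continuous in the second argument there.\<close>

lemma kernel_eq_reciprocal_kernel:
  assumes f: "f holomorphic_on strip" and h: "h holomorphic_on strip"
    and off: "\<And>x y. x > 0 \<Longrightarrow> y > 0 \<Longrightarrow> x \<noteq> y \<Longrightarrow> K x y = reciprocal_kernel \<sigma> f h x y"
    and cont: "\<And>x. x > 0 \<Longrightarrow> isCont (K x) x" and x: "x > 0" and y: "y > 0"
  shows "K x y = reciprocal_kernel \<sigma> f h x y"
proof (cases "x = y")
  case False with off x y show ?thesis by blast
next
  case True
  have "\<forall>\<^sub>F u in at x. u \<in> {0<..} - {x}"
    using x by (intro eventually_at_in_open) auto
  then have "\<forall>\<^sub>F u in at x. reciprocal_kernel \<sigma> f h x u = K x u"
    by eventually_elim (use off x in auto)
  then have "(K x \<longlongrightarrow> reciprocal_kernel \<sigma> f h x x) (at x)"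
    by (rule Lim_transform_eventually[OF reciprocal_kernel_isCont_diagonal[OF f h x, unfolded isCont_def]])
  then have "K x x = reciprocal_kernel \<sigma> f h x x"
    using cont[OF x] unfolding isCont_def by (intro tendsto_unique) auto
  with True show ?thesis by simp
qed

text \<open>In the coordinates \<open>\<xi> = 1/x\<close>, \<open>\<eta> = 1/y\<close> one has \<open>1/(x - y) = \<xi> \<eta> / (\<eta> - \<xi>)\<close>, and
  \<open>x\<^sup>-\<^sup>\<sigma> = x\<^sup>-\<^sup>\<sigma>\<^sup>-\<^sup>1 / \<xi>\<close> balances the powers of the two products in the numerator.\<close>

lemma wronskian_kernel_reciprocal:
  fixes P Q :: "real \<Rightarrow> complex"
  assumes P: "\<And>x. x > 0 \<Longrightarrow> P x = A * of_real (x powr (- \<sigma>)) * f (of_real (1 / x))"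
    and Q: "\<And>x. x > 0 \<Longrightarrow> Q x = B * of_real (x powr (- \<sigma> - 1)) * g (of_real (1 / x))"
    and x: "x > 0" "y > 0" "x \<noteq> y"
  shows "c * ((P x * Q y - Q x * P y) / of_real (x - y)) =
    reciprocal_kernel \<sigma> (\<lambda>z. c * A * B * f z) (\<lambda>z. z * g z) x y"
proof -
  have e: "x powr (- \<sigma>) = x powr (- \<sigma> - 1) * x" if "x > 0" for x
    using that powr_add[of x "- \<sigma> - 1" 1] by simp
  have "complex_of_real (1 / y) - of_real (1 / x) = of_real ((x - y) / (x * y))"
    using x by (simp add: field_simps)
  moreover have "complex_of_real (1 / x) \<noteq> of_real (1 / y)" using x by simp
  ultimately have r: "reciprocal_kernel \<sigma> (\<lambda>z. c * A * B * f z) (\<lambda>z. z * g z) x y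
     = of_real (x powr (- \<sigma> - 1)) * of_real (y powr (- \<sigma> - 1)) *
       ((c * A * B * f (of_real (1/x)) * (of_real (1/y) * g (of_real (1/y))) - of_real (1/x) * g (of_real (1/x)) * (c * A * B * f (of_real (1/y))))
        / of_real ((x - y) / (x * y)))"
    using x by (simp add: reciprocal_kernel_def wronskian_quotient_def powr_mult)
  define u v where "u = complex_of_real (x powr (- \<sigma> - 1))" and "v = complex_of_real (y powr (- \<sigma> - 1))"
  show ?thesis
    unfolding r P[OF x(1)] P[OF x(2)] Q[OF x(1)] Q[OF x(2)] e[OF x(1)] e[OF x(2)] of_real_mult u_def[symmetric] v_def[symmetric]
    using x by (simp add: field_simps)
qed


section \<open>Terminating hypergeometric sums\<close>

text \<open>The homogeneous form of the terminating series \<open>\<^sub>2F\<^sub>1(-m, a; c; -\<alpha>/\<beta>)\<close>: it is a polynomial in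
  \<open>\<alpha>\<close> and \<open>\<beta>\<close>, so it can be differentiated, conjugated and rescaled without regard to
  convergence or zero denominators.\<close>

definition hyp_form :: "nat \<Rightarrow> complex \<Rightarrow> complex \<Rightarrow> complex \<Rightarrow> complex \<Rightarrow> complex" where
  "hyp_form m a c \<alpha> \<beta> =
     (\<Sum>n\<le>m. of_nat (m choose n) * (pochhammer a n / pochhammer c n) * \<alpha> ^ n * \<beta> ^ (m - n))"

lemma hyp2F1_eq_hyp_form:
  assumes "\<beta> \<noteq> 0"
  shows "\<beta> ^ m * hyp2F1 (- of_nat m) a c (- \<alpha> / \<beta>) = hyp_form m a c \<alpha> \<beta>"
proof -
  have t: "pochhammer (- of_nat m) n * pochhammer a n / (pochhammer c n * fact n) * (- \<alpha> / \<beta>) ^ n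
      = of_nat (m choose n) * (pochhammer a n / pochhammer c n) * (\<alpha> / \<beta>) ^ n" for n
  proof -
    have "of_nat (m choose n) = (- 1) ^ n * pochhammer (- of_nat m) n / (fact n :: complex)"
      by (simp add: binomial_gbinomial gbinomial_pochhammer)
    moreover have "(- \<alpha> / \<beta>) ^ n = (- 1) ^ n * (\<alpha> / \<beta>) ^ n"
      by (simp add: power_mult_distrib[symmetric])
    ultimately show ?thesis by (simp add: mult_ac)
  qed
  have "hyp2F1 (- of_nat m) a c (- \<alpha> / \<beta>)
      = (\<Sum>n. of_nat (m choose n) * (pochhammer a n / pochhammer c n) * (\<alpha> / \<beta>) ^ n)"
    unfolding hyp2F1_def t ..
  also have "\<dots> = (\<Sum>n\<le>m. of_nat (m choose n) * (pochhammer a n / pochhammer c n) * (\<alpha> / \<beta>) ^ n)"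
    by (intro suminf_finite) (auto simp: binomial_eq_0)
  also have "\<beta> ^ m * \<dots> = hyp_form m a c \<alpha> \<beta>"
    unfolding hyp_form_def sum_distrib_left
  proof (intro sum.cong refl)
    fix n assume "n \<in> {..m}"
    then have "\<beta> ^ m = \<beta> ^ n * \<beta> ^ (m - n)" by (simp add: power_add[symmetric])
    then show "\<beta> ^ m * (of_nat (m choose n) * (pochhammer a n / pochhammer c n) * (\<alpha> / \<beta>) ^ n)
      = of_nat (m choose n) * (pochhammer a n / pochhammer c n) * \<alpha> ^ n * \<beta> ^ (m - n)"
      using assms by (simp add: power_divide)
  qed
  finally show ?thesis .
qed

lemma hyp_form_homogeneous: "hyp_form m a c (t * \<alpha>) (t * \<beta>) = t ^ m * hyp_form m a c \<alpha> \<beta>"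
  unfolding hyp_form_def sum_distrib_left
proof (intro sum.cong refl)
  fix n assume "n \<in> {..m}"
  then have "t ^ m = t ^ n * t ^ (m - n)" by (simp add: power_add[symmetric])
  then show "of_nat (m choose n) * (pochhammer a n / pochhammer c n) * (t * \<alpha>) ^ n * (t * \<beta>) ^ (m - n)
    = t ^ m * (of_nat (m choose n) * (pochhammer a n / pochhammer c n) * \<alpha> ^ n * \<beta> ^ (m - n))"
    by (simp add: power_mult_distrib)
qed

lemma cnj_hyp_form: "cnj (hyp_form m a c \<alpha> \<beta>) = hyp_form m (cnj a) (cnj c) (cnj \<alpha>) (cnj \<beta>)"
  by (simp add: hyp_form_def cnj_sum pochhammer_prod cnj_prod)

text \<open>Pascal's rule for the binomial coefficients.\<close>

lemma hyp_form_Suc: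
  "hyp_form (Suc m) a c \<alpha> \<beta> = \<beta> * hyp_form m a c \<alpha> \<beta> + a / c * \<alpha> * hyp_form m (a + 1) (c + 1) \<alpha> \<beta>"
proof -
  define r where "r n = pochhammer a n / pochhammer c n" for n
  have rS: "r (Suc n) = a / c * (pochhammer (a + 1) n / pochhammer (c + 1) n)" for n
    by (simp add: r_def pochhammer_rec)
  have "hyp_form (Suc m) a c \<alpha> \<beta> = \<beta> ^ Suc m + (\<Sum>n\<le>m. of_nat (Suc m choose Suc n) * r (Suc n) * \<alpha> ^ Suc n * \<beta> ^ (m - n))"
    unfolding hyp_form_def r_def[symmetric] by (subst sum.atMost_Suc_shift) (simp add: r_def)
  also have "\<dots> = \<beta> ^ Suc m + (\<Sum>n\<le>m. of_nat (m choose Suc n) * r (Suc n) * \<alpha> ^ Suc n * \<beta> ^ (m - n))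
      + (\<Sum>n\<le>m. of_nat (m choose n) * r (Suc n) * \<alpha> ^ Suc n * \<beta> ^ (m - n))"
    unfolding add.assoc sum.distrib[symmetric]
    by (intro arg_cong2[where f = "(+)"] sum.cong refl) (simp add: distrib_right)
  also have "(\<Sum>n\<le>m. of_nat (m choose n) * r (Suc n) * \<alpha> ^ Suc n * \<beta> ^ (m - n))
      = a / c * \<alpha> * hyp_form m (a + 1) (c + 1) \<alpha> \<beta>"
    unfolding hyp_form_def rS sum_distrib_left by (intro sum.cong refl) (simp add: mult_ac)
  also have "\<beta> ^ Suc m + (\<Sum>n\<le>m. of_nat (m choose Suc n) * r (Suc n) * \<alpha> ^ Suc n * \<beta> ^ (m - n))
      = (\<Sum>n\<le>Suc m. of_nat (m choose n) * r n * \<alpha> ^ n * \<beta> ^ (Suc m - n))"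
    by (subst sum.atMost_Suc_shift) (simp add: r_def)
  also have "\<dots> = (\<Sum>n\<le>m. of_nat (m choose n) * r n * \<alpha> ^ n * \<beta> ^ (Suc m - n))" by simp
  also have "\<dots> = \<beta> * hyp_form m a c \<alpha> \<beta>"
    unfolding hyp_form_def r_def[symmetric] sum_distrib_left
    by (intro sum.cong refl) (simp add: Suc_diff_le mult_ac)
  finally show ?thesis .
qed

lemma pochhammer_contiguous:
  fixes a c :: complex
  assumes "\<And>n. c \<noteq> - of_nat n"
  shows "pochhammer a n / pochhammer c n - (c - a) / c * (pochhammer a n / pochhammer (c + 1) n)
       = a / c * (pochhammer (a + 1) n / pochhammer (c + 1) n)"
proof -
  have c0: "c \<noteq> 0" using assms[of 0] by simp
  have cn: "c + of_nat n \<noteq> 0" using assms[of n] by (simp add: add_eq_0_iff2)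
  have p: "pochhammer (c + 1) n \<noteq> 0"
  proof
    assume "pochhammer (c + 1) n = 0"
    then obtain k where "c + 1 = - of_nat k" by (auto simp: pochhammer_eq_0_iff)
    then have "c = - of_nat (Suc k)" by (simp add: algebra_simps eq_neg_iff_add_eq_0)
    with assms[of "Suc k"] show False by simp
  qed
  have "c * pochhammer (c + 1) n = pochhammer c n * (c + of_nat n)"
    using pochhammer_rec[of c n] pochhammer_rec'[of c n] by (simp only: mult.commute)
  then have e: "pochhammer c n = c * pochhammer (c + 1) n / (c + of_nat n)" using cn by (simp add: field_simps)
  have f: "a * pochhammer (a + 1) n = pochhammer a n * (a + of_nat n)"
    using pochhammer_rec[of a n] pochhammer_rec'[of a n] by (simp only: mult.commute)
  have "pochhammer a n / pochhammer c n - (c - a) / c * (pochhammer a n / pochhammer (c + 1) n)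
      = (pochhammer a n * (c + of_nat n) - (c - a) * pochhammer a n) / (c * pochhammer (c + 1) n)"
    unfolding e divide_divide_eq_right times_divide_times_eq by (rule diff_divide_distrib[symmetric])
  also have "pochhammer a n * (c + of_nat n) - (c - a) * pochhammer a n = a * pochhammer (a + 1) n"
    unfolding f by (simp add: algebra_simps)
  finally show ?thesis by simp
qed

text \<open>Pfaff's transformation for terminating series. Heuristically \<open>(b)\<^sub>n / (c)\<^sub>n\<close> is the \<open>n\<close>-th moment
  of a Beta variable \<open>V\<close> with parameters \<open>b\<close> and \<open>c - b\<close>, the left-hand side is the mean of
  \<open>(\<beta> + \<alpha> - \<alpha> V)\<^sup>m\<close>, and \<open>1 - V\<close> is a Beta variable with the parameters exchanged. The proof is an
  induction with \<open>hyp_form_Suc\<close> and a contiguous relation between the coefficients.\<close>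

lemma hyp_form_reflect:
  assumes "\<And>n. c \<noteq> - of_nat n"
  shows "hyp_form m b c (- \<alpha>) (\<beta> + \<alpha>) = hyp_form m (c - b) c \<alpha> \<beta>"
  using assms
proof (induction m arbitrary: b c)
  case 0 show ?case by (simp add: hyp_form_def)
next
  case (Suc m)
  have c1: "c + 1 \<noteq> - of_nat n" for n
  proof
    assume "c + 1 = - of_nat n"
    then have "c = - of_nat (Suc n)" by (simp add: algebra_simps eq_neg_iff_add_eq_0)
    with Suc.prems[of "Suc n"] show False by simp
  qed
  let ?a = "c - b"
  have "hyp_form m ?a c \<alpha> \<beta> - (c - ?a) / c * hyp_form m ?a (c + 1) \<alpha> \<beta> = ?a / c * hyp_form m (?a + 1) (c + 1) \<alpha> \<beta>"
    unfolding hyp_form_def sum_distrib_left sum_subtractf[symmetric]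
  proof (intro sum.cong refl)
    fix n
    have "of_nat (m choose n) * (pochhammer ?a n / pochhammer c n) * \<alpha> ^ n * \<beta> ^ (m - n)
       - (c - ?a) / c * (of_nat (m choose n) * (pochhammer ?a n / pochhammer (c + 1) n) * \<alpha> ^ n * \<beta> ^ (m - n))
       = of_nat (m choose n) * \<alpha> ^ n * \<beta> ^ (m - n) *
         (pochhammer ?a n / pochhammer c n - (c - ?a) / c * (pochhammer ?a n / pochhammer (c + 1) n))"
      by (simp only: right_diff_distrib mult_ac)
    also note pochhammer_contiguous[OF Suc.prems]
    finally show "of_nat (m choose n) * (pochhammer ?a n / pochhammer c n) * \<alpha> ^ n * \<beta> ^ (m - n)
       - (c - ?a) / c * (of_nat (m choose n) * (pochhammer ?a n / pochhammer (c + 1) n) * \<alpha> ^ n * \<beta> ^ (m - n))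
       = ?a / c * (of_nat (m choose n) * (pochhammer (?a + 1) n / pochhammer (c + 1) n) * \<alpha> ^ n * \<beta> ^ (m - n))"
      by (simp only: mult_ac)
  qed
  then have k: "?a / c * hyp_form m (?a + 1) (c + 1) \<alpha> \<beta> = hyp_form m ?a c \<alpha> \<beta> - b / c * hyp_form m ?a (c + 1) \<alpha> \<beta>"
    by simp
  have "hyp_form (Suc m) b c (- \<alpha>) (\<beta> + \<alpha>)
      = (\<beta> + \<alpha>) * hyp_form m ?a c \<alpha> \<beta> - b / c * \<alpha> * hyp_form m ?a (c + 1) \<alpha> \<beta>"
    using Suc.IH[OF Suc.prems, of b] Suc.IH[OF c1, of "b + 1"] by (simp add: hyp_form_Suc)
  also have "\<dots> = \<beta> * hyp_form m ?a c \<alpha> \<beta> + \<alpha> * (hyp_form m ?a c \<alpha> \<beta> - b / c * hyp_form m ?a (c + 1) \<alpha> \<beta>)"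
    by (simp add: algebra_simps)
  also have "\<dots> = hyp_form (Suc m) ?a c \<alpha> \<beta>"
    unfolding k[symmetric] hyp_form_Suc by (simp add: mult_ac)
  finally show ?case .
qed

text \<open>Coefficientwise this is \<open>(a+1)\<^sub>n - (a)\<^sub>n = n (a+1)\<^sub>n\<^sub>-\<^sub>1\<close>.\<close>

lemma hyp_form_shift_parameter:
  "hyp_form (Suc m) (a + 1) c \<alpha> \<beta> = hyp_form (Suc m) a c \<alpha> \<beta>
     + of_nat (Suc m) * \<alpha> / c * hyp_form m (a + 1) (c + 1) \<alpha> \<beta>"
proof -
  have d: "pochhammer (a + 1) (Suc n) - pochhammer a (Suc n) = of_nat (Suc n) * pochhammer (a + 1) n" for n
  proof -
    have "pochhammer (a + 1) (Suc n) = (a + 1 + of_nat n) * pochhammer (a + 1) n" by (rule pochhammer_rec')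
    moreover have "pochhammer a (Suc n) = a * pochhammer (a + 1) n" by (rule pochhammer_rec)
    ultimately show ?thesis by (simp add: algebra_simps)
  qed
  have "hyp_form (Suc m) (a + 1) c \<alpha> \<beta> - hyp_form (Suc m) a c \<alpha> \<beta>
      = (\<Sum>n\<le>Suc m. of_nat (Suc m choose n) * ((pochhammer (a + 1) n - pochhammer a n) / pochhammer c n) * \<alpha> ^ n * \<beta> ^ (Suc m - n))"
    unfolding hyp_form_def sum_subtractf[symmetric] by (intro sum.cong refl) (simp only: diff_divide_distrib right_diff_distrib left_diff_distrib)
  also have "\<dots> = (\<Sum>n\<le>m. of_nat (Suc m choose Suc n) * ((of_nat (Suc n) * pochhammer (a + 1) n) / pochhammer c (Suc n)) * \<alpha> ^ Suc n * \<beta> ^ (m - n))"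
    by (subst sum.atMost_Suc_shift) (simp only: d diff_Suc_Suc pochhammer_0 diff_self div_0 mult_zero_left mult_zero_right add_0)
  also have "\<dots> = of_nat (Suc m) * \<alpha> / c * hyp_form m (a + 1) (c + 1) \<alpha> \<beta>"
    unfolding hyp_form_def sum_distrib_left
  proof (intro sum.cong refl)
    fix n
    have "of_nat (Suc n) * of_nat (Suc m choose Suc n) = (of_nat (Suc m) * of_nat (m choose n) :: complex)"
      using Suc_times_binomial_eq[of m n] by (metis mult.commute of_nat_mult)
    then have e: "of_nat (Suc m choose Suc n) * (of_nat (Suc n) * x) = (of_nat (Suc m) * of_nat (m choose n) * x :: complex)" for x
    proof -
      have "of_nat (Suc m choose Suc n) * (of_nat (Suc n) * x) = (of_nat (Suc n) * of_nat (Suc m choose Suc n)) * x"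
        by (simp only: mult_ac)
      with \<open>of_nat (Suc n) * of_nat (Suc m choose Suc n) = (of_nat (Suc m) * of_nat (m choose n) :: complex)\<close>
      show ?thesis by (simp only:)
    qed
    show "of_nat (Suc m choose Suc n) * ((of_nat (Suc n) * pochhammer (a + 1) n) / pochhammer c (Suc n)) * \<alpha> ^ Suc n * \<beta> ^ (m - n)
      = of_nat (Suc m) * \<alpha> / c * (of_nat (m choose n) * (pochhammer (a + 1) n / pochhammer (c + 1) n) * \<alpha> ^ n * \<beta> ^ (m - n))"
      unfolding times_divide_eq_right[symmetric] e by (simp add: pochhammer_rec mult_ac del: of_nat_Suc binomial_Suc_Suc)
  qed
  finally show ?thesis by (simp add: algebra_simps)
qed

lemma pochhammer_ratio_bound:
  fixes a :: complex and c :: real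
  assumes c: "c > 0"
  shows "cmod (pochhammer a n / pochhammer (of_real c) n) \<le> (1 + cmod a / c) ^ n"
proof (induction n)
  case (Suc n)
  have "complex_of_real c + of_nat n = of_real (c + real n)" by simp
  then have "cmod ((a + of_nat n) / (of_real c + of_nat n)) = cmod (a + of_nat n) / (c + real n)"
    using c by (simp only: norm_divide norm_of_real)
  also have "\<dots> \<le> (cmod a + real n) / (c + real n)"
    using c norm_triangle_ineq[of a "of_nat n"] by (intro divide_right_mono) auto
  also have "\<dots> \<le> 1 + cmod a / c"
    using c by (simp add: divide_simps algebra_simps)
  finally have q: "cmod ((a + of_nat n) / (of_real c + of_nat n)) \<le> 1 + cmod a / c" .
  have "pochhammer a (Suc n) / pochhammer (of_real c) (Suc n)
      = (a + of_nat n) / (of_real c + of_nat n) * (pochhammer a n / pochhammer (of_real c) n)"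
    by (simp add: pochhammer_rec')
  then have "cmod (pochhammer a (Suc n) / pochhammer (of_real c) (Suc n))
      = cmod ((a + of_nat n) / (of_real c + of_nat n)) * cmod (pochhammer a n / pochhammer (of_real c) n)"
    by (simp only: norm_mult)
  also have "\<dots> \<le> (1 + cmod a / c) * (1 + cmod a / c) ^ n"
    using q Suc c by (intro mult_mono) auto
  finally show ?case by simp
qed auto

text \<open>The quotients of Pochhammer symbols are at most \<open>(1 + \<bar>a\<bar>/c)\<^sup>n\<close>, and the binomial theorem sums the
  resulting bounds.\<close>

lemma norm_hyp_form_le:
  assumes c: "c > 0"
  shows "cmod (hyp_form m a (of_real c) \<alpha> \<beta>) \<le> ((1 + cmod a / c) * cmod \<alpha> + cmod \<beta>) ^ m"
proof -
  have "cmod (hyp_form m a (of_real c) \<alpha> \<beta>)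
      \<le> (\<Sum>n\<le>m. real (m choose n) * (1 + cmod a / c) ^ n * cmod \<alpha> ^ n * cmod \<beta> ^ (m - n))"
    unfolding hyp_form_def
    by (rule sum_norm_le) (unfold norm_mult norm_power norm_of_nat,
        intro mult_right_mono mult_left_mono pochhammer_ratio_bound c, auto)
  also have "\<dots> = ((1 + cmod a / c) * cmod \<alpha> + cmod \<beta>) ^ m"
    by (simp add: binomial_ring power_mult_distrib mult_ac)
  finally show ?thesis .
qed

lemma hyp_form_holomorphic:
  "(\<lambda>z. hyp_form m a c (f z) (g z)) holomorphic_on S" if "f holomorphic_on S" "g holomorphic_on S"
  unfolding hyp_form_def by (intro holomorphic_intros that)

lemma hyp1F1_sums:
  assumes c: "c > 0"
  shows "(\<lambda>n. pochhammer a n / (pochhammer (of_real c) n * fact n) * z ^ n) sums hyp1F1 a (of_real c) z"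
  unfolding hyp1F1_def
proof (intro summable_sums summable_comparison_test'[OF summable_exp_generic[of "(1 + cmod a / c) * cmod z"]])
  fix n :: nat
  have "cmod (pochhammer a n / (pochhammer (of_real c) n * fact n) * z ^ n)
     = cmod (pochhammer a n / pochhammer (of_real c) n) * (cmod z ^ n / fact n)"
    by (simp add: norm_mult norm_divide norm_power)
  also have "\<dots> \<le> (1 + cmod a / c) ^ n * (cmod z ^ n / fact n)"
    by (intro mult_right_mono pochhammer_ratio_bound c) auto
  finally show "cmod (pochhammer a n / (pochhammer (of_real c) n * fact n) * z ^ n) \<le> ((1 + cmod a / c) * cmod z) ^ n /\<^sub>R fact n"
    by (simp add: power_mult_distrib divide_inverse mult_ac)
qed

lemma hyp1F1_holomorphic:
  assumes c: "c > 0"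
  shows "hyp1F1 a (of_real c) holomorphic_on S"
proof -
  have "hyp1F1 a (of_real c) holomorphic_on ball 0 r" for r
    using hyp1F1_sums[OF c, of a]
    by (intro power_series_holomorphic[where a = "\<lambda>n. pochhammer a n / (pochhammer (of_real c) n * fact n)"]) auto
  then have "hyp1F1 a (of_real c) field_differentiable (at z)" for z
    using holomorphic_on_imp_differentiable_at[of "hyp1F1 a (of_real c)" "ball 0 (cmod z + 1)" z] by simp
  then show ?thesis by (auto simp: holomorphic_on_def intro: field_differentiable_at_within)
qed


section \<open>Asymptotics of the hypergeometric sums and of the weight\<close>

lemma tendsto_of_nat_mult_Ln:
  fixes w :: complex
  shows "(\<lambda>n. of_nat n * Ln (1 + w / of_nat n)) \<longlonglongrightarrow> w"
proof (rule LIM_zero_cancel, rule Lim_null_comparison)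
  have "\<forall>\<^sub>F n in sequentially. 2 * cmod w < real n" using filterlim_real_sequentially by (simp add: filterlim_at_top_dense)
  then show "\<forall>\<^sub>F n in sequentially. norm (of_nat n * Ln (1 + w / of_nat n) - w) \<le> 2 * (cmod w)\<^sup>2 * (1 / real n)"
  proof eventually_elim
    case (elim n)
    define v where "v = w / of_nat n"
    have n: "real n > 0" using elim norm_ge_zero[of w] by linarith
    have v: "cmod v = cmod w / n" by (simp add: v_def norm_divide)
    have v2: "cmod v < 1 / 2" unfolding v using elim n by (simp add: field_simps)
    have "cmod (Ln (1 + v) - v) \<le> (cmod v)\<^sup>2 / (1 - cmod v)" using v2 by (intro Ln_approx_linear) auto
    also have "\<dots> \<le> (cmod v)\<^sup>2 / (1 / 2)" using v2 by (intro divide_left_mono) auto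
    finally have b: "cmod (Ln (1 + v) - v) \<le> 2 * (cmod v)\<^sup>2" by simp
    have "of_nat n * Ln (1 + v) - w = of_nat n * (Ln (1 + v) - v)" using n by (simp add: v_def right_diff_distrib)
    then have "cmod (of_nat n * Ln (1 + v) - w) = n * cmod (Ln (1 + v) - v)" by (simp add: norm_mult)
    also have "\<dots> \<le> n * (2 * (cmod v)\<^sup>2)" using b by (intro mult_left_mono) auto
    also have "\<dots> = 2 * (cmod w)\<^sup>2 * (1 / real n)" using n by (simp add: v power2_eq_square field_simps)
    finally show ?case by (simp add: v_def)
  qed
  show "(\<lambda>n. 2 * (cmod w)\<^sup>2 * (1 / real n)) \<longlonglongrightarrow> 0"
    using tendsto_mult_right_zero[OF lim_1_over_n] by auto
qed

lemma tendsto_Ln_null: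
  fixes w :: complex
  shows "(\<lambda>n. Ln (1 + w / of_nat n)) \<longlonglongrightarrow> 0"
proof -
  have "(\<lambda>n. 1 + w / of_nat n) \<longlonglongrightarrow> 1 + 0"
    by (intro tendsto_intros lim_const_over_n)
  then have "(\<lambda>n. Ln (1 + w / of_nat n)) \<longlonglongrightarrow> Ln (1 + 0)"
    by (intro tendsto_Ln) auto
  then show ?thesis by simp
qed

lemma tendsto_power_exp:
  fixes w :: complex
  shows "(\<lambda>n. (1 + w / of_nat n) ^ n) \<longlonglongrightarrow> exp w"
proof -
  have "(\<lambda>n. exp (of_nat n * Ln (1 + w / of_nat n))) \<longlonglongrightarrow> exp w"
    by (intro tendsto_exp tendsto_of_nat_mult_Ln)
  then show ?thesis
  proof (rule Lim_transform_eventually)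
    have "\<forall>\<^sub>F n in sequentially. cmod w < real n" using filterlim_real_sequentially by (simp add: filterlim_at_top_dense)
    then show "\<forall>\<^sub>F n in sequentially. exp (of_nat n * Ln (1 + w / of_nat n)) = (1 + w / of_nat n) ^ n"
    proof eventually_elim
      case (elim n)
      have "1 + w / of_nat n \<noteq> 0"
      proof
        assume "1 + w / of_nat n = 0"
        then have "w / of_nat n = - 1" by (simp add: eq_neg_iff_add_eq_0 add.commute)
        then have "cmod w / real n = 1" by (metis norm_divide norm_minus_cancel norm_of_nat norm_one)
        with elim show False by (auto simp: divide_eq_1_iff)
      qed
      then show ?case by (simp add: exp_of_nat_mult)
    qed
  qed
qed

text \<open>For \<open>x = 1/z\<close> one has \<open>N x - \<i> = (N/z) (1 - \<i> z/N)\<close>. Taking the factor \<open>N/z\<close> out of the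
  homogeneous form leaves this polynomial in \<open>z\<close>; \<open>d = 0\<close> belongs to \<open>p_tilde\<close> and \<open>d = 1\<close> to
  \<open>p_pred\<close>.\<close>

definition finite_hyp :: "nat \<Rightarrow> complex \<Rightarrow> real \<Rightarrow> nat \<Rightarrow> complex \<Rightarrow> complex" where
  "finite_hyp d a c N z = hyp_form (N - d) a (of_real c) (2 * \<i> * z / of_nat N) (1 - \<i> * z / of_nat N)"

text \<open>The bound of \<open>norm_hyp_form_le\<close> is at most \<open>(1 + M \<bar>z\<bar>/N)\<^sup>N\<close>, which does not exceed
  \<open>exp (M \<bar>z\<bar>)\<close>.\<close>

lemma norm_finite_hyp_le:
  assumes c: "c > 0" and N: "N \<ge> 1"
  shows "cmod (finite_hyp d a c N z) \<le> exp ((2 * (1 + cmod a / c) + 1) * cmod z)"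
proof -
  define M where "M = 2 * (1 + cmod a / c) + 1"
  have M: "M \<ge> 0" using c by (auto simp: M_def intro!: add_nonneg_nonneg)
  have "cmod (finite_hyp d a c N z) \<le> ((1 + cmod a / c) * cmod (2 * \<i> * z / of_nat N) + cmod (1 - \<i> * z / of_nat N)) ^ (N - d)"
    unfolding finite_hyp_def by (rule norm_hyp_form_le[OF c])
  also have "\<dots> \<le> (1 + M * cmod z / N) ^ (N - d)"
  proof (rule power_mono)
    have "cmod (1 - \<i> * z / of_nat N) \<le> 1 + cmod z / N"
      using norm_triangle_ineq4[of 1 "\<i> * z / of_nat N"] by (simp add: norm_divide norm_mult)
    moreover have e2: "cmod (2 * \<i> * z / of_nat N) = 2 * (cmod z / N)" by (simp add: norm_divide norm_mult)
    moreover have "1 + M * cmod z / N = (1 + cmod a / c) * (2 * (cmod z / N)) + (1 + cmod z / N)"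
      by (simp add: M_def add_divide_distrib distrib_right distrib_left)
    ultimately show "(1 + cmod a / c) * cmod (2 * \<i> * z / of_nat N) + cmod (1 - \<i> * z / of_nat N) \<le> 1 + M * cmod z / N"
      unfolding e2 by linarith
  qed (use c in \<open>auto intro!: add_nonneg_nonneg mult_nonneg_nonneg\<close>)
  also have "\<dots> \<le> (1 + M * cmod z / N) ^ N" using M by (intro power_increasing) auto
  also have "\<dots> \<le> exp (M * cmod z)" using N M by (intro exp_ge_one_plus_x_over_n_power_n) (auto intro: order_trans[of _ 0])
  finally show ?thesis unfolding M_def .
qed

lemma binomial_over_power_tendsto:
  "(\<lambda>N. of_nat ((N - d) choose k) / of_nat N ^ k :: complex) \<longlonglongrightarrow> 1 / fact k"
proof -
  have "(\<lambda>N. (\<Prod>i=0..<k. (of_nat N - of_nat d - of_nat i) / of_nat N) / fact k :: complex) \<longlonglongrightarrow> (\<Prod>i=0..<k. 1) / fact k"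
  proof (intro tendsto_divide tendsto_prod tendsto_const)
    fix i
    have "(\<lambda>N. 1 - of_nat (d + i) / of_nat N :: complex) \<longlonglongrightarrow> 1 - 0"
      by (intro tendsto_diff tendsto_const lim_const_over_n)
    then show "(\<lambda>N. (of_nat N - of_nat d - of_nat i) / of_nat N :: complex) \<longlonglongrightarrow> 1"
      unfolding diff_0_right
    proof (rule Lim_transform_eventually)
      show "\<forall>\<^sub>F N in sequentially. 1 - of_nat (d + i) / of_nat N = (of_nat N - of_nat d - of_nat i) / (of_nat N :: complex)"
        using eventually_gt_at_top[of 0] by eventually_elim (simp add: diff_divide_distrib add_divide_distrib)
    qed
  qed auto
  then have "(\<lambda>N. (\<Prod>i=0..<k. (of_nat N - of_nat d - of_nat i) / of_nat N) / fact k :: complex) \<longlonglongrightarrow> 1 / fact k" by simp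
  then show ?thesis
  proof (rule Lim_transform_eventually)
    show "\<forall>\<^sub>F N in sequentially. (\<Prod>i=0..<k. (of_nat N - of_nat d - of_nat i) / of_nat N) / fact k = (of_nat ((N - d) choose k) / of_nat N ^ k :: complex)"
      using eventually_ge_at_top[of d]
    proof eventually_elim
      case (elim N)
      then have "of_nat ((N - d) choose k) = (\<Prod>i=0..<k. of_nat N - of_nat d - of_nat i) / (fact k :: complex)"
        by (simp add: binomial_gbinomial gbinomial_prod_rev of_nat_diff)
      then show ?case by (simp add: prod_dividef)
    qed
  qed
qed

text \<open>Termwise, \<open>binom(N-d, k) / N\<^sup>k\<close> tends to \<open>1/k!\<close> and the power of \<open>1 - \<i> z/N\<close> to \<open>exp (-\<i> z)\<close>;
  Tannery's theorem allows to sum the limits.\<close>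

lemma finite_hyp_tendsto:
  assumes c: "c > 0"
  shows "(\<lambda>N. finite_hyp d a c N z) \<longlonglongrightarrow> exp (- \<i> * z) * hyp1F1 a (of_real c) (2 * \<i> * z)"
proof -
  define M where "M = 1 + cmod a / c"
  have M: "M \<ge> 0" using c by (simp add: M_def)
  define r where "r k = pochhammer a k / pochhammer (complex_of_real c) k" for k
  define t where "t k N = of_nat ((N - d) choose k) * r k * (2 * \<i> * z / of_nat N) ^ k * (1 - \<i> * z / of_nat N) ^ (N - d - k)" for k N
  have fh: "finite_hyp d a c N z = (\<Sum>k. t k N)" for N
    unfolding finite_hyp_def hyp_form_def t_def r_def
    by (rule suminf_finite[symmetric]) (auto simp: binomial_eq_0)
  have lim: "(\<lambda>N. t k N) \<longlonglongrightarrow> 1 / fact k * r k * (2 * \<i> * z) ^ k * exp (- \<i> * z)" for k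
  proof -
    have b: "(\<lambda>N. 1 + - \<i> * z / of_nat N) \<longlonglongrightarrow> 1 + 0"
      by (intro tendsto_add tendsto_const lim_const_over_n)
    have "(\<lambda>N. (1 + - \<i> * z / of_nat N) ^ N / (1 + - \<i> * z / of_nat N) ^ (d + k)) \<longlonglongrightarrow> exp (- \<i> * z) / (1 + 0) ^ (d + k)"
      by (intro tendsto_divide tendsto_power_exp tendsto_power b) auto
    then have "(\<lambda>N. of_nat ((N - d) choose k) / of_nat N ^ k * r k * (2 * \<i> * z) ^ k * ((1 + - \<i> * z / of_nat N) ^ N / (1 + - \<i> * z / of_nat N) ^ (d + k)))
       \<longlonglongrightarrow> 1 / fact k * r k * (2 * \<i> * z) ^ k * exp (- \<i> * z)"
      by (intro tendsto_mult tendsto_const binomial_over_power_tendsto) simp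
    then show ?thesis
    proof (rule Lim_transform_eventually)
      have "\<forall>\<^sub>F N in sequentially. cmod z < real N" using filterlim_real_sequentially by (simp add: filterlim_at_top_dense)
      then show "\<forall>\<^sub>F N in sequentially. of_nat ((N - d) choose k) / of_nat N ^ k * r k * (2 * \<i> * z) ^ k *
          ((1 + - \<i> * z / of_nat N) ^ N / (1 + - \<i> * z / of_nat N) ^ (d + k)) = t k N"
        using eventually_ge_at_top[of "d + k"]
      proof eventually_elim
        case (elim N)
        have nz: "1 + - \<i> * z / of_nat N \<noteq> 0"
        proof
          assume "1 + - \<i> * z / of_nat N = 0"
          then have "\<i> * z / of_nat N = 1" by simp
          then have "cmod z / real N = 1" by (metis norm_divide norm_ii norm_mult norm_of_nat norm_one mult_1)
          with elim show False by (auto simp: divide_eq_1_iff)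
        qed
        have "(1 + - \<i> * z / of_nat N) ^ N / (1 + - \<i> * z / of_nat N) ^ (d + k) = (1 + - \<i> * z / of_nat N) ^ (N - d - k)"
          using nz elim power_diff[OF nz, of "d + k" N] by simp
        then show ?case unfolding t_def by (simp add: power_divide)
      qed
    qed
  qed
  have bd: "cmod (t k N) \<le> (M * (2 * cmod z)) ^ k /\<^sub>R fact k * exp (cmod z)" if "N \<ge> 1" for k N
  proof -
    have 1: "real ((N - d) choose k) / real N ^ k \<le> 1 / fact k"
    proof -
      have "((N - d) choose k) * fact k \<le> (N - d) ^ k" by (rule binomial_fact_pow)
      also have "\<dots> \<le> N ^ k" by (intro power_mono) auto
      finally have "real (((N - d) choose k) * fact k) \<le> real (N ^ k)" by (simp only: of_nat_le_iff)
      then show ?thesis using that by (simp add: divide_simps)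
    qed
    have 2: "cmod (1 - \<i> * z / of_nat N) ^ (N - d - k) \<le> exp (cmod z)"
    proof -
      have "cmod (1 - \<i> * z / of_nat N) \<le> 1 + cmod z / N"
        using norm_triangle_ineq4[of 1 "\<i> * z / of_nat N"] by (simp add: norm_divide norm_mult)
      then have "cmod (1 - \<i> * z / of_nat N) ^ (N - d - k) \<le> (1 + cmod z / N) ^ (N - d - k)" by (intro power_mono) auto
      also have "\<dots> \<le> (1 + cmod z / N) ^ N" by (intro power_increasing) auto
      also have "\<dots> \<le> exp (cmod z)" using that by (intro exp_ge_one_plus_x_over_n_power_n) (auto intro: order_trans[of _ 0])
      finally show ?thesis .
    qed
    have "cmod (t k N) = (real ((N - d) choose k) / real N ^ k) * cmod (r k) * (2 * cmod z) ^ k * cmod (1 - \<i> * z / of_nat N) ^ (N - d - k)"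
      unfolding t_def norm_mult norm_power norm_of_nat norm_divide by (simp add: norm_mult power_divide)
    also have "\<dots> \<le> 1 / fact k * M ^ k * (2 * cmod z) ^ k * exp (cmod z)"
      using 1 2 pochhammer_ratio_bound[OF c, of a k] M unfolding r_def M_def[symmetric]
      by (intro mult_mono) auto
    finally show ?thesis by (simp add: power_mult_distrib divide_inverse mult_ac)
  qed
  have "(\<lambda>N. \<Sum>k. t k N) \<longlonglongrightarrow> (\<Sum>k. 1 / fact k * r k * (2 * \<i> * z) ^ k * exp (- \<i> * z))"
  proof (rule conjunct2[OF conjunct2[OF tannerys_theorem[where M = "\<lambda>k. (M * (2 * cmod z)) ^ k /\<^sub>R fact k * exp (cmod z)"]]])
    have "\<forall>\<^sub>F N in sequentially. \<forall>k. cmod (t k N) \<le> (M * (2 * cmod z)) ^ k /\<^sub>R fact k * exp (cmod z)"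
      using eventually_ge_at_top[of 1] by eventually_elim (use bd in blast)
    then show "\<forall>\<^sub>F (k, N) in sequentially \<times>\<^sub>F sequentially. cmod (t k N) \<le> (M * (2 * cmod z)) ^ k /\<^sub>R fact k * exp (cmod z)"
      unfolding eventually_prod_filter
      by (intro exI[of _ "\<lambda>_. True"] exI[of _ "\<lambda>N. \<forall>k. cmod (t k N) \<le> (M * (2 * cmod z)) ^ k /\<^sub>R fact k * exp (cmod z)"]) auto
    show "summable (\<lambda>k. (M * (2 * cmod z)) ^ k /\<^sub>R fact k * exp (cmod z))"
      by (intro summable_mult2 summable_exp_generic)
  qed (use lim in auto)
  also have "(\<Sum>k. 1 / fact k * r k * (2 * \<i> * z) ^ k * exp (- \<i> * z)) = exp (- \<i> * z) * hyp1F1 a (of_real c) (2 * \<i> * z)"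
    using sums_unique[OF sums_mult[OF hyp1F1_sums[OF c, of a "2 * \<i> * z"], of "exp (- \<i> * z)"]]
    by (simp add: r_def mult_ac)
  finally show ?thesis unfolding fh .
qed

lemma finite_hyp_converges:
  assumes c: "c > 0"
  shows "boundedly_converges (finite_hyp d a c) (\<lambda>z. exp (- \<i> * z) * hyp1F1 a (of_real c) (2 * \<i> * z)) strip"
proof (rule boundedly_convergesI)
  show "finite_hyp d a c N holomorphic_on strip" if "N \<ge> 1" for N
    unfolding finite_hyp_def[abs_def] using that by (intro hyp_form_holomorphic holomorphic_intros) auto
  have "(hyp1F1 a (of_real c) \<circ> (\<lambda>z. 2 * \<i> * z)) holomorphic_on strip"
    by (intro holomorphic_on_compose holomorphic_intros hyp1F1_holomorphic[OF c])
  then show "(\<lambda>z. exp (- \<i> * z) * hyp1F1 a (of_real c) (2 * \<i> * z)) holomorphic_on strip"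
    by (intro holomorphic_intros) (simp add: o_def)
  fix K assume "compact K" "K \<subseteq> strip"
  then obtain R where R: "\<And>z. z \<in> K \<Longrightarrow> cmod z \<le> R"
    using compact_imp_bounded bounded_iff by metis
  have "\<forall>\<^sub>F N in sequentially. \<forall>z\<in>K. cmod (finite_hyp d a c N z) \<le> exp ((2 * (1 + cmod a / c) + 1) * R)"
    using eventually_ge_at_top[of 1]
  proof eventually_elim
    case (elim N)
    show ?case
    proof
      fix z assume "z \<in> K"
      have "cmod (finite_hyp d a c N z) \<le> exp ((2 * (1 + cmod a / c) + 1) * cmod z)" by (rule norm_finite_hyp_le[OF c elim])
      also have "\<dots> \<le> exp ((2 * (1 + cmod a / c) + 1) * R)"
        using R[OF \<open>z \<in> K\<close>] c by (auto intro!: mult_left_mono add_nonneg_nonneg)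
      finally show "cmod (finite_hyp d a c N z) \<le> exp ((2 * (1 + cmod a / c) + 1) * R)" .
    qed
  qed
  then show "\<exists>B. \<forall>\<^sub>F N in sequentially. \<forall>z\<in>K. cmod (finite_hyp d a c N z) \<le> B" by blast
qed (use open_strip finite_hyp_tendsto[OF c] in auto)

text \<open>The square root of \<open>w_H\<close> at \<open>N/z\<close> up to a power of \<open>z\<close> and a constant, see \<open>sqrt_w_H_scaled\<close>.
  Writing it with two principal logarithms continues it from positive \<open>z\<close> to the whole strip, since
  \<open>1 \<plusminus> \<i> z/N\<close> has positive real part there.\<close>

definition weight_factor :: "complex \<Rightarrow> nat \<Rightarrow> complex \<Rightarrow> complex" where
  "weight_factor s N z = exp (- (s + of_nat N) / 2 * Ln (1 - \<i> * z / of_nat N) - (cnj s + of_nat N) / 2 * Ln (1 + \<i> * z / of_nat N))"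

lemma Re_one_plus_strip:
  assumes "z \<in> strip" "N \<ge> 1"
  shows "Re (1 + \<i> * z / of_nat N) > 0" "Re (1 - \<i> * z / of_nat N) > 0"
proof -
  have "\<bar>Im z / real N\<bar> < 1" using assms by (auto simp: strip_def abs_divide divide_less_eq)
  then have "Im z / real N < 1" "- 1 < Im z / real N" by linarith+
  then show "Re (1 + \<i> * z / of_nat N) > 0" "Re (1 - \<i> * z / of_nat N) > 0" by (auto simp: Re_divide_of_nat)
qed

text \<open>To first order the exponents are \<open>\<i> z/2\<close> and \<open>-\<i> z/2\<close>, so they cancel in the limit.\<close>

lemma weight_factor_converges: "boundedly_converges (weight_factor s) (\<lambda>_. 1) strip"
proof (rule boundedly_convergesI)
  show "weight_factor s N holomorphic_on strip" if "N \<ge> 1" for N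
  proof -
    have "1 + \<i> * z / of_nat N \<notin> \<real>\<^sub>\<le>\<^sub>0" "1 - \<i> * z / of_nat N \<notin> \<real>\<^sub>\<le>\<^sub>0" if "z \<in> strip" for z
      using Re_one_plus_strip[OF that \<open>N \<ge> 1\<close>] complex_nonpos_Reals_iff by (metis not_le)+
    then show ?thesis unfolding weight_factor_def[abs_def] using that by (intro holomorphic_intros) auto
  qed
  show "(\<lambda>N. weight_factor s N z) \<longlonglongrightarrow> 1" for z
  proof -
    have "(\<lambda>N. - (s / 2 * Ln (1 + (- (\<i> * z)) / of_nat N)) - (of_nat N * Ln (1 + (- (\<i> * z)) / of_nat N)) / 2
        - cnj s / 2 * Ln (1 + (\<i> * z) / of_nat N) - (of_nat N * Ln (1 + (\<i> * z) / of_nat N)) / 2)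
      \<longlonglongrightarrow> - (s / 2 * 0) - (- (\<i> * z)) / 2 - cnj s / 2 * 0 - (\<i> * z) / 2"
      by (intro tendsto_diff tendsto_minus tendsto_mult tendsto_const tendsto_Ln_null tendsto_divide tendsto_of_nat_mult_Ln) auto
    then have "(\<lambda>N. exp (- (s / 2 * Ln (1 + (- (\<i> * z)) / of_nat N)) - (of_nat N * Ln (1 + (- (\<i> * z)) / of_nat N)) / 2
        - cnj s / 2 * Ln (1 + (\<i> * z) / of_nat N) - (of_nat N * Ln (1 + (\<i> * z) / of_nat N)) / 2))
      \<longlonglongrightarrow> exp (- (s / 2 * 0) - (- (\<i> * z)) / 2 - cnj s / 2 * 0 - (\<i> * z) / 2)"
      by (rule tendsto_exp)
    moreover have "- (s / 2 * l) - (n * l) / 2 - cnj s / 2 * m - (n * m) / 2 = - (s + n) / 2 * l - (cnj s + n) / 2 * m" for l m n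
      by (simp add: field_simps)
    ultimately show ?thesis by (simp add: weight_factor_def)
  qed
  fix K assume "compact K" "K \<subseteq> strip"
  then obtain R where R: "\<And>z. z \<in> K \<Longrightarrow> cmod z \<le> R"
    using compact_imp_bounded bounded_iff by metis
  have "\<forall>\<^sub>F N in sequentially. 2 * R < real N" using filterlim_real_sequentially by (simp add: filterlim_at_top_dense)
  then have "\<forall>\<^sub>F N in sequentially. \<forall>z\<in>K. cmod (weight_factor s N z) \<le> exp (2 * (cmod s + 1) * R)"
    using eventually_ge_at_top[of 1]
  proof eventually_elim
    case (elim N)
    show ?case
    proof
      fix z assume z: "z \<in> K"
      have R0: "0 \<le> R" using R[OF z] norm_ge_zero order_trans by blast
      define v where "v = \<i> * z / of_nat N"
      have v: "cmod v \<le> R / N" using R[OF z] elim by (simp add: v_def norm_divide norm_mult divide_right_mono)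
      also have "R / N < 1 / 2" using elim by (simp add: field_simps)
      finally have v2: "cmod v < 1 / 2" .
      have l: "cmod (Ln (1 - v)) \<le> 2 * (R / N)" "cmod (Ln (1 + v)) \<le> 2 * (R / N)"
        using norm_Ln_le[of v] norm_Ln_le[of "- v"] v v2 by auto
      have sN: "cmod (s + of_nat N) \<le> cmod s + N" "cmod (cnj s + of_nat N) \<le> cmod s + N"
        using norm_triangle_ineq[of s "of_nat N"] norm_triangle_ineq[of "cnj s" "of_nat N"] by auto
      then have sN': "cmod (- s - of_nat N) \<le> cmod s + N"
        using norm_minus_cancel[of "s + of_nat N"] by simp
      have "cmod (- (s + of_nat N) / 2 * Ln (1 - v) - (cnj s + of_nat N) / 2 * Ln (1 + v))
         \<le> cmod (- (s + of_nat N) / 2 * Ln (1 - v)) + cmod ((cnj s + of_nat N) / 2 * Ln (1 + v))"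
        by (rule norm_triangle_ineq4)
      also have "\<dots> \<le> (cmod s + N) / 2 * (2 * (R / N)) + (cmod s + N) / 2 * (2 * (R / N))"
        using sN sN' l by (intro add_mono) (auto simp: norm_mult norm_divide norm_minus_cancel simp del: times_divide_eq_left times_divide_eq_right
            intro!: mult_mono divide_right_mono)
      also have "\<dots> = 2 * (cmod s / N + 1) * R" using elim by (simp add: field_simps)
      also have "\<dots> \<le> 2 * (cmod s + 1) * R"
        using elim R0 by (intro mult_right_mono mult_left_mono add_mono) (auto simp: divide_le_eq mult_le_cancel_left1)
      finally have "cmod (- (s + of_nat N) / 2 * Ln (1 - v) - (cnj s + of_nat N) / 2 * Ln (1 + v)) \<le> 2 * (cmod s + 1) * R" .
      then show "cmod (weight_factor s N z) \<le> exp (2 * (cmod s + 1) * R)"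
        unfolding weight_factor_def v_def[symmetric] norm_exp_eq_Re exp_le_cancel_iff
        by (rule order_trans[OF complex_Re_le_cmod])
    qed
  qed
  then show "\<exists>B. \<forall>\<^sub>F N in sequentially. \<forall>z\<in>K. cmod (weight_factor s N z) \<le> B" by blast
qed (auto simp: open_strip)


section \<open>The kernel for finite N\<close>

lemma Ln_cnj_one_plus: "Ln (1 - \<i> * of_real x) = cnj (Ln (1 + \<i> * of_real x))"
proof -
  have "1 + \<i> * of_real x \<notin> \<real>\<^sub>\<le>\<^sub>0" by (simp add: complex_nonpos_Reals_iff)
  then show ?thesis by (simp add: cnj_Ln)
qed

lemma w_H_eq_exp: "w_H s N x = exp (- 2 * Re ((s + of_nat N) * Ln (1 + \<i> * of_real x)))"
proof -
  define B where "B = (s + of_nat N) * Ln (1 + \<i> * of_real x)"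
  have nz: "1 + \<i> * complex_of_real x \<noteq> 0" "1 - \<i> * complex_of_real x \<noteq> 0" by (auto simp: complex_eq_iff)
  have "complex_of_real (w_H s N x) = exp (- B + - cnj B)"
    unfolding w_H_eq_powr powr_def exp_add using nz
    by (simp add: B_def Ln_cnj_one_plus algebra_simps)
  also have "- B + - cnj B = of_real (- 2 * Re B)" by (simp add: complex_eq_iff)
  finally have "complex_of_real (w_H s N x) = of_real (exp (- 2 * Re B))" by (simp only: exp_of_real)
  then show ?thesis by (simp only: of_real_eq_iff B_def)
qed

lemma sqrt_w_H_eq_exp: "sqrt (w_H s N x) = exp (- Re ((s + of_nat N) * Ln (1 + \<i> * of_real x)))"
  unfolding w_H_eq_exp by (rule real_sqrt_unique) (simp_all add: exp_double[symmetric])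

lemma isCont_w_H: "isCont (w_H s N) x"
proof -
  have "1 + \<i> * of_real x \<notin> \<real>\<^sub>\<le>\<^sub>0" by (simp add: complex_nonpos_Reals_iff)
  then show ?thesis unfolding w_H_eq_exp[abs_def] by (intro continuous_intros) auto
qed

text \<open>From \<open>1 + \<i> X = \<i> X (1 - \<i>/X)\<close> and \<open>X > 0\<close>, the logarithm of \<open>1 + \<i> X\<close> is
  \<open>ln X + \<i> \<pi>/2 + Ln (1 - \<i>/X)\<close>; the middle term produces the constant \<open>exp (\<pi> Im s / 2)\<close>.\<close>

lemma sqrt_w_H_scaled:
  assumes x: "x > 0" and N: "N \<ge> 1"
  shows "complex_of_real (sqrt (w_H s N (real N * x)))
    = of_real ((real N * x) powr (- Re s - real N) * exp (pi * Im s / 2)) * weight_factor s N (of_real (1 / x))"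
proof -
  define X where "X = real N * x"
  have X: "X > 0" using x N by (simp add: X_def)
  define u where "u = 1 - \<i> * of_real (1 / X)"
  have u0: "u \<noteq> 0" and Ru: "Re u > 0" by (auto simp: u_def complex_eq_iff)
  have LnX: "Ln (1 + \<i> * of_real X) = of_real (ln X) + \<i> * of_real (pi / 2) + Ln u"
  proof (rule Ln_unique)
    have "exp (of_real (ln X) + \<i> * of_real (pi / 2) + Ln u) = of_real X * \<i> * u"
      using X u0 by (simp add: exp_add exp_of_real cis_conv_exp[symmetric] del: of_real_divide)
    also have "\<dots> = 1 + \<i> * of_real X" using X by (simp add: u_def field_simps)
    finally show "exp (of_real (ln X) + \<i> * of_real (pi / 2) + Ln u) = 1 + \<i> * of_real X" .
    have "\<bar>Im (Ln u)\<bar> < pi / 2" using Re_Ln_pos_lt[OF u0] Ru by simp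
    then show "- pi < Im (of_real (ln X) + \<i> * of_real (pi / 2) + Ln u)" "Im (of_real (ln X) + \<i> * of_real (pi / 2) + Ln u) \<le> pi"
      by auto
  qed
  have wf: "weight_factor s N (of_real (1 / x)) = of_real (exp (- Re ((s + of_nat N) * Ln u)))"
  proof -
    have e: "\<i> * of_real (1 / x) / of_nat N = \<i> * complex_of_real (1 / X)" by (simp add: X_def)
    have c: "Ln (1 + \<i> * of_real (1 / X)) = cnj (Ln u)"
      unfolding u_def using Ln_cnj_one_plus[of "- (1 / X)"] by simp
    have "weight_factor s N (of_real (1 / x)) = exp (- (s + of_nat N) / 2 * Ln u - (cnj s + of_nat N) / 2 * cnj (Ln u))"
      unfolding weight_factor_def e c u_def ..
    also have "- (s + of_nat N) / 2 * Ln u - (cnj s + of_nat N) / 2 * cnj (Ln u) = of_real (- Re ((s + of_nat N) * Ln u))"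
      by (simp add: complex_eq_iff field_simps)
    finally show ?thesis by (simp only: exp_of_real)
  qed
  have "- Re ((s + of_nat N) * Ln (1 + \<i> * of_real X))
      = (- Re s - real N) * ln X + pi * Im s / 2 + - Re ((s + of_nat N) * Ln u)"
    unfolding LnX by (simp add: algebra_simps)
  then have "sqrt (w_H s N X) = X powr (- Re s - real N) * exp (pi * Im s / 2) * exp (- Re ((s + of_nat N) * Ln u))"
    unfolding sqrt_w_H_eq_exp using X by (simp add: exp_add powr_def)
  then show ?thesis unfolding wf X_def[symmetric] by simp
qed

lemma p_tilde_eq_hyp_form: "p_tilde s N x = hyp_form N s (of_real (2 * Re s + 1)) (2 * \<i>) (of_real x - \<i>)"
  and p_pred_eq_hyp_form: "p_pred s N x = hyp_form (N - 1) (s + 1) (of_real (2 * Re s + 2)) (2 * \<i>) (of_real x - \<i>)"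
proof -
  have nz: "of_real x - \<i> \<noteq> 0" and nz': "1 + \<i> * of_real x \<noteq> 0" by (auto simp: complex_eq_iff)
  have "1 + \<i> * of_real x = \<i> * (of_real x - \<i>)" by (simp add: algebra_simps)
  then have e: "2 / (1 + \<i> * of_real x) = - (2 * \<i>) / (of_real x - \<i>)"
    using nz nz' by (simp add: divide_simps algebra_simps)
  show "p_tilde s N x = hyp_form N s (of_real (2 * Re s + 1)) (2 * \<i>) (of_real x - \<i>)"
    "p_pred s N x = hyp_form (N - 1) (s + 1) (of_real (2 * Re s + 2)) (2 * \<i>) (of_real x - \<i>)"
    unfolding p_tilde_def p_pred_def e by (rule hyp2F1_eq_hyp_form[OF nz])+
qed

lemma p_polynomials_scaled:
  assumes x: "x > 0" and N: "N \<ge> 1"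
  shows p_tilde_scaled: "p_tilde s N (real N * x) = of_real (real N * x) ^ N * finite_hyp 0 s (2 * Re s + 1) N (of_real (1 / x))"
    and p_pred_scaled: "p_pred s N (real N * x) = of_real (real N * x) ^ (N - 1) * finite_hyp 1 (s + 1) (2 * Re s + 2) N (of_real (1 / x))"
proof -
  have a: "2 * \<i> = of_real (real N * x) * (2 * \<i> * of_real (1 / x) / of_nat N)" using x N by simp
  have b: "of_real (real N * x) - \<i> = of_real (real N * x) * (1 - \<i> * of_real (1 / x) / of_nat N)"
    using x N by (simp add: field_simps)
  show "p_tilde s N (real N * x) = of_real (real N * x) ^ N * finite_hyp 0 s (2 * Re s + 1) N (of_real (1 / x))"
    unfolding p_tilde_eq_hyp_form finite_hyp_def diff_zero hyp_form_homogeneous[symmetric] a[symmetric] b[symmetric] ..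
  show "p_pred s N (real N * x) = of_real (real N * x) ^ (N - 1) * finite_hyp 1 (s + 1) (2 * Re s + 2) N (of_real (1 / x))"
    unfolding p_pred_eq_hyp_form finite_hyp_def hyp_form_homogeneous[symmetric] a[symmetric] b[symmetric] ..
qed

lemma hyp_form_has_vector_derivative:
  fixes F :: "real \<Rightarrow> complex"
  assumes "F = (\<lambda>x. hyp_form m a c \<alpha> (of_real x - \<i>))"
  shows "(F has_vector_derivative vector_derivative F (at x)) (at x)"
proof -
  define g where "g z = hyp_form m a c \<alpha> (z - \<i>)" for z
  have "g holomorphic_on UNIV" unfolding g_def by (intro hyp_form_holomorphic holomorphic_intros)
  then have "(g has_field_derivative deriv g (of_real x)) (at (of_real x))"
    by (rule holomorphic_derivI) auto
  then have "((\<lambda>x. g (of_real x)) has_vector_derivative deriv g (of_real x)) (at x)"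
    using has_vector_derivative_real_field by blast
  then have "F differentiable (at x)" unfolding assms g_def[symmetric]
    by (rule differentiableI_vector)
  then show ?thesis by (simp add: vector_derivative_works)
qed

lemma isCont_K_fin: "isCont (K_fin s N x) x"
proof -
  have "((\<lambda>y. C_const s N * ((p_tilde s N x * p_pred s N y - p_pred s N x * p_tilde s N y) / of_real (x - y)) *
      of_real (sqrt (w_H s N x * w_H s N y))) \<longlongrightarrow>
      C_const s N * (vector_derivative (p_tilde s N) (at x) * p_pred s N x - p_tilde s N x * vector_derivative (p_pred s N) (at x)) *
      of_real (sqrt (w_H s N x * w_H s N x))) (at x)"
    by (intro tendsto_mult tendsto_const tendsto_of_real tendsto_real_sqrt wronskian_kernel_diagonal_limit
        hyp_form_has_vector_derivative[OF ext, OF p_tilde_eq_hyp_form]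
        hyp_form_has_vector_derivative[OF ext, OF p_pred_eq_hyp_form] isCont_w_H[unfolded isCont_def])
  also have "sqrt (w_H s N x * w_H s N x) = w_H s N x"
    by (simp add: w_H_eq_exp)
  finally have "((\<lambda>y. C_const s N * ((p_tilde s N x * p_pred s N y - p_pred s N x * p_tilde s N y) / of_real (x - y)) *
      of_real (sqrt (w_H s N x * w_H s N y))) \<longlongrightarrow> K_fin s N x x) (at x)"
    by (simp add: K_fin_def)
  then show ?thesis unfolding isCont_def
    by (rule Lim_transform_eventually) (auto simp: eventually_at_filter K_fin_def)
qed

lemma isCont_K_resc: "isCont (K_resc s N x) x"
proof -
  have "isCont (K_fin s N (real N * x)) (real N * x)" by (rule isCont_K_fin)
  then have "isCont (\<lambda>y. K_fin s N (real N * x) (real N * y)) x"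
    by (rule isCont_o2[rotated]) (intro continuous_intros)
  then show ?thesis unfolding K_resc_def[abs_def] by (intro continuous_intros)
qed

lemma C_const_real: "C_const s N \<in> \<real>"
  unfolding Reals_cnj_iff C_const_def by (simp add: cnj_Gamma mult_ac)

text \<open>Conjugation replaces \<open>s + 1\<close> by its conjugate and \<open>(2\<i>, x - \<i>)\<close> by \<open>(-2\<i>, x + \<i>)\<close>, which
  \<open>hyp_form_reflect\<close> undoes because \<open>s + 1\<close> and its conjugate add up to \<open>2 Re s + 2\<close>.\<close>

lemma cnj_p_pred:
  assumes s: "Re s > - 1 / 2"
  shows "cnj (p_pred s N x) = p_pred s N x"
proof -
  have c: "complex_of_real (2 * Re s + 2) \<noteq> - of_nat n" for n
  proof
    assume "complex_of_real (2 * Re s + 2) = - of_nat n"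
    then have "2 * Re s + 2 = - real n" by (metis Re_complex_of_real complex_Re_of_nat uminus_complex.sel(1))
    with s show False by simp
  qed
  have a: "complex_of_real (2 * Re s + 2) - cnj (s + 1) = s + 1" by (simp add: complex_eq_iff)
  have "cnj (p_pred s N x) = hyp_form (N - 1) (cnj (s + 1)) (of_real (2 * Re s + 2)) (- (2 * \<i>)) ((of_real x - \<i>) + 2 * \<i>)"
    unfolding p_pred_eq_hyp_form cnj_hyp_form by (simp add: add.commute)
  also have "\<dots> = p_pred s N x"
    unfolding hyp_form_reflect[OF c] a p_pred_eq_hyp_form ..
  finally show ?thesis .
qed

text \<open>Here \<open>s\<close> and its conjugate add up to one less than the lower parameter, so the reflection gives
  the upper parameter \<open>s + 1\<close> instead of \<open>s\<close>; \<open>hyp_form_shift_parameter\<close> supplies the difference.\<close>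

lemma cnj_p_tilde:
  assumes s: "Re s > - 1 / 2" and N: "N \<ge> 1"
  shows "cnj (p_tilde s N x) = p_tilde s N x + of_nat N * (2 * \<i>) / of_real (2 * Re s + 1) * p_pred s N x"
proof -
  have c: "complex_of_real (2 * Re s + 1) \<noteq> - of_nat n" for n
  proof
    assume "complex_of_real (2 * Re s + 1) = - of_nat n"
    then have "2 * Re s + 1 = - real n" by (metis Re_complex_of_real complex_Re_of_nat uminus_complex.sel(1))
    with s show False by simp
  qed
  obtain m where m: "N = Suc m" using N by (cases N) auto
  have a: "complex_of_real (2 * Re s + 1) - cnj s = s + 1" by (simp add: complex_eq_iff)
  have "cnj (p_tilde s N x) = hyp_form N (cnj s) (of_real (2 * Re s + 1)) (- (2 * \<i>)) ((of_real x - \<i>) + 2 * \<i>)"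
    unfolding p_tilde_eq_hyp_form cnj_hyp_form by (simp add: add.commute)
  also have "\<dots> = hyp_form N (s + 1) (of_real (2 * Re s + 1)) (2 * \<i>) (of_real x - \<i>)"
    unfolding hyp_form_reflect[OF c] a ..
  also have "\<dots> = p_tilde s N x + of_nat N * (2 * \<i>) / of_real (2 * Re s + 1) * p_pred s N x"
    unfolding p_tilde_eq_hyp_form p_pred_eq_hyp_form m hyp_form_shift_parameter[of m s]
    by (simp add: add.assoc)
  finally show ?thesis .
qed

text \<open>Off the diagonal, the multiple of \<open>p_pred\<close> by which \<open>p_tilde\<close> differs from its conjugate cancels in
  the antisymmetric numerator. The diagonal follows by continuity.\<close>

lemma K_fin_real:
  assumes s: "Re s > - 1 / 2" and N: "N \<ge> 1"
  shows "K_fin s N x y \<in> \<real>"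
proof -
  have off: "K_fin s N x y \<in> \<real>" if "x \<noteq> y" for x y
  proof -
    have "cnj (p_tilde s N x * p_pred s N y - p_pred s N x * p_tilde s N y) = p_tilde s N x * p_pred s N y - p_pred s N x * p_tilde s N y"
      by (simp add: cnj_p_pred[OF s] cnj_p_tilde[OF s N] algebra_simps)
    then have "p_tilde s N x * p_pred s N y - p_pred s N x * p_tilde s N y \<in> \<real>" by (simp only: Reals_cnj_iff)
    with that show ?thesis unfolding K_fin_def by (auto intro!: Reals_mult Reals_divide C_const_real)
  qed
  show ?thesis
  proof (cases "x = y")
    case True
    have "\<forall>\<^sub>F u in at x. K_fin s N x u \<in> \<real>" unfolding eventually_at_filter by (rule always_eventually) (use off in auto)
    then have "K_fin s N x x \<in> \<real>"
      using Lim_in_closed_set[OF closed_complex_Reals _ _ isCont_K_fin[where s = s and N = N and x = x, unfolded isCont_def]] by simp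
    with True show ?thesis by simp
  qed (rule off)
qed

lemma K_resc_real: "Re s > - 1 / 2 \<Longrightarrow> N \<ge> 1 \<Longrightarrow> K_resc s N x y \<in> \<real>"
  unfolding K_resc_def by (intro Reals_mult K_fin_real) auto

text \<open>Conjugation is real-linear and continuous, so it commutes with the integrals and with the sum.\<close>

lemma fredholm_det_real:
  assumes K: "\<And>x y. K x y \<in> \<real>" and c: "fredholm_converges K t"
  shows "fredholm_det K t \<in> \<real>"
proof -
  have r: "cnj (rho K k x) = rho K k x" for k x
    unfolding rho_def det_mat_expand using K by (simp add: Reals_cnj_iff cnj_prod sign_def)
  have "cnj (fredholm_term K t (Suc k)) = fredholm_term K t (Suc k)" for k
  proof -
    let ?M = "Pi\<^sub>M {..<Suc k} (\<lambda>_. lborel :: real measure)" and ?f = "\<lambda>x. indicator (Pi\<^sub>E {..<Suc k} (\<lambda>_. {t<..})) x *\<^sub>R rho K (Suc k) x"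
    have i: "integrable ?M ?f" using c unfolding fredholm_converges_def set_integrable_def by simp
    have "cnj (integral\<^sup>L ?M ?f) = (\<integral>x. cnj (?f x) \<partial>?M)"
      by (rule integral_bounded_linear[OF bounded_linear_cnj i, symmetric])
    then have "cnj (integral\<^sup>L ?M ?f) = integral\<^sup>L ?M ?f" by (simp add: scaleR_conv_of_real r)
    then show ?thesis unfolding fredholm_term_def set_lebesgue_integral_def by simp
  qed
  moreover have "cnj (\<Sum>k. fredholm_term K t (Suc k)) = (\<Sum>k. cnj (fredholm_term K t (Suc k)))"
    using c unfolding fredholm_converges_def by (intro bounded_linear.suminf[OF bounded_linear_cnj]) auto
  ultimately show ?thesis unfolding fredholm_det_def Reals_cnj_iff by simp
qed


section \<open>The limit\<close>

text \<open>\<open>P\<close> and \<open>Q\<close> are each a constant times a power of \<open>x\<close> times a function of \<open>1/x\<close>; this is the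
  product of the two constants, where \<open>b = 1/N\<close> comes from the powers of \<open>N x\<close> and \<open>b = 2\<close> from the
  powers of \<open>2/x\<close>.\<close>

definition amplitude :: "complex \<Rightarrow> real \<Rightarrow> complex" where
  "amplitude s b = of_real (b powr (2 * Re s + 1) * exp (pi * Im s))"

text \<open>The pairs \<open>(f, h)\<close> of the two kernels. All constants are put into \<open>f\<close>; the factor \<open>z\<close> in \<open>h\<close>
  is the additional \<open>1/x\<close> that \<open>Q\<close> has in comparison with \<open>P\<close>.\<close>

definition fin_f :: "complex \<Rightarrow> nat \<Rightarrow> complex \<Rightarrow> complex" where
  "fin_f s N z = C_const s N * amplitude s (1 / real N) * (finite_hyp 0 s (2 * Re s + 1) N z * weight_factor s N z)"

definition fin_h :: "complex \<Rightarrow> nat \<Rightarrow> complex \<Rightarrow> complex" where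
  "fin_h s N z = z * (finite_hyp 1 (s + 1) (2 * Re s + 2) N z * weight_factor s N z)"

definition lim_f :: "complex \<Rightarrow> complex \<Rightarrow> complex" where
  "lim_f s z = c_const s * amplitude s 2 * (exp (- \<i> * z) * hyp1F1 s (of_real (2 * Re s + 1)) (2 * \<i> * z))"

definition lim_h :: "complex \<Rightarrow> complex \<Rightarrow> complex" where
  "lim_h s z = z * (exp (- \<i> * z) * hyp1F1 (s + 1) (of_real (2 * Re s + 2)) (2 * \<i> * z))"

text \<open>The ratio is \<open>\<Gamma>(a)\<close> divided by the \<open>N\<close>-th approximant in Gauss's product formula for \<open>\<Gamma>(a)\<close>.\<close>

lemma Gamma_ratio_tendsto:
  fixes a :: real
  assumes a: "a > 0"
  shows "(\<lambda>N. Gamma (complex_of_real a + of_nat N) / Gamma (of_nat N) * of_real ((1 / real N) powr a)) \<longlonglongrightarrow> 1"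
proof -
  have an: "complex_of_real a \<notin> \<int>\<^sub>\<le>\<^sub>0" using a by (auto elim!: nonpos_Ints_cases simp: complex_eq_iff)
  then have G: "Gamma (complex_of_real a) \<noteq> 0" by (simp add: Gamma_eq_zero_iff)
  have "(\<lambda>N. Gamma (complex_of_real a) / Gamma_series' (complex_of_real a) N) \<longlonglongrightarrow> Gamma (complex_of_real a) / Gamma (complex_of_real a)"
    by (intro tendsto_divide tendsto_const Gamma_series'_LIMSEQ G)
  then have "(\<lambda>N. Gamma (complex_of_real a) / Gamma_series' (complex_of_real a) N) \<longlonglongrightarrow> 1" using G by simp
  then show ?thesis
  proof (rule Lim_transform_eventually)
    show "\<forall>\<^sub>F N in sequentially. Gamma (complex_of_real a) / Gamma_series' (complex_of_real a) N
        = Gamma (complex_of_real a + of_nat N) / Gamma (of_nat N) * of_real ((1 / real N) powr a)"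
      using eventually_ge_at_top[of 1]
    proof eventually_elim
      case (elim N)
      have p: "Gamma (complex_of_real a + of_nat N) = pochhammer (complex_of_real a) N * Gamma (complex_of_real a)"
        using pochhammer_Gamma[OF an, of N] G by simp
      have q: "Gamma (of_nat N :: complex) = fact (N - 1)"
        using Gamma_fact[of "N - 1", where 'a = complex] elim by (simp add: of_nat_diff)
      have "complex_of_real ((1 / real N) powr a) = of_real (exp (- (a * ln (real N))))"
        using elim by (simp add: powr_def ln_div)
      then have r: "complex_of_real ((1 / real N) powr a) = 1 / exp (of_real a * of_real (ln (real N)))"
        by (simp add: exp_minus divide_inverse flip: exp_of_real of_real_mult)
      show ?case unfolding p q r Gamma_series'_def by (simp add: mult_ac)
    qed
  qed
qed

lemma amplitude_tendsto:
  assumes s: "Re s > - 1 / 2"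
  shows "(\<lambda>N. C_const s N * amplitude s (1 / real N)) \<longlonglongrightarrow> c_const s * amplitude s 2"
proof -
  define D where "D = of_real (2 powr (2 * Re s) / pi * exp (pi * Im s)) * (Gamma (s + 1) * Gamma (cnj s + 1)) /
    (Gamma (of_real (2 * Re s + 1)) * Gamma (of_real (2 * Re s + 2)))"
  have "(\<lambda>N. D * (Gamma (complex_of_real (2 * Re s + 1) + of_nat N) / Gamma (of_nat N) * of_real ((1 / real N) powr (2 * Re s + 1)))) \<longlonglongrightarrow> D * 1"
    using s by (intro tendsto_mult tendsto_const Gamma_ratio_tendsto) auto
  also have "(\<lambda>N. D * (Gamma (complex_of_real (2 * Re s + 1) + of_nat N) / Gamma (of_nat N) * of_real ((1 / real N) powr (2 * Re s + 1))))
      = (\<lambda>N. C_const s N * amplitude s (1 / real N))"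
  proof
    fix N
    have e: "complex_of_real (2 * Re s + real N + 1) = complex_of_real (2 * Re s + 1) + of_nat N" by simp
    show "D * (Gamma (complex_of_real (2 * Re s + 1) + of_nat N) / Gamma (of_nat N) * of_real ((1 / real N) powr (2 * Re s + 1)))
        = C_const s N * amplitude s (1 / real N)"
      unfolding C_const_def e D_def amplitude_def of_real_mult of_real_divide by (simp only: times_divide_eq_right times_divide_eq_left divide_divide_eq_left mult_ac)
  qed
  also have "D * 1 = c_const s * amplitude s 2"
  proof -
    have "(2::real) powr (2 * Re s + 1) = 2 * 2 powr (2 * Re s)" by (simp add: powr_add)
    then have e: "complex_of_real (2 powr (2 * Re s + 1) * exp (pi * Im s)) = 2 * of_real (2 powr (2 * Re s) * exp (pi * Im s))" by simp
    show ?thesis unfolding D_def c_const_def amplitude_def e by (simp add: field_simps)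
  qed
  finally show ?thesis .
qed

lemma fin_converges:
  assumes s: "Re s > - 1 / 2"
  shows "boundedly_converges (fin_f s) (lim_f s) strip" "boundedly_converges (fin_h s) (lim_h s) strip"
proof -
  have A: "boundedly_converges (\<lambda>N z. C_const s N * amplitude s (1 / real N)) (\<lambda>z. c_const s * amplitude s 2) strip"
  proof (rule boundedly_convergesI)
    obtain B where "\<forall>N. cmod (C_const s N * amplitude s (1 / real N)) \<le> B"
      using convergent_imp_bounded[OF amplitude_tendsto[OF s]] by (auto simp: bounded_iff)
    then show "\<exists>B. \<forall>\<^sub>F N in sequentially. \<forall>z\<in>K. cmod (C_const s N * amplitude s (1 / real N)) \<le> B" for K
      by (intro exI[of _ B] always_eventually) auto
  qed (auto intro: open_strip amplitude_tendsto[OF s])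
  have Z: "boundedly_converges (\<lambda>N z. z) (\<lambda>z. z) strip"
    by (intro boundedly_converges_const open_strip holomorphic_intros)
  have F: "boundedly_converges (finite_hyp 0 s (2 * Re s + 1)) (\<lambda>z. exp (- \<i> * z) * hyp1F1 s (of_real (2 * Re s + 1)) (2 * \<i> * z)) strip"
    "boundedly_converges (finite_hyp 1 (s + 1) (2 * Re s + 2)) (\<lambda>z. exp (- \<i> * z) * hyp1F1 (s + 1) (of_real (2 * Re s + 2)) (2 * \<i> * z)) strip"
    using s by (intro finite_hyp_converges; simp)+
  note M = boundedly_converges_mult[OF _ boundedly_converges_mult[OF _ weight_factor_converges[of s]]]
  show "boundedly_converges (fin_f s) (lim_f s) strip"
    using M[OF A F(1)] by (simp only: fin_f_def[abs_def] lim_f_def[abs_def] mult_1_right)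
  show "boundedly_converges (fin_h s) (lim_h s) strip"
    using M[OF Z F(2)] by (simp only: fin_h_def[abs_def] lim_h_def[abs_def] mult_1_right)
qed

lemma amplitude_split:
  assumes "b > 0"
  shows "amplitude s b = (of_real (b powr Re s * exp (pi * Im s / 2))) * (of_real (b powr (Re s + 1) * exp (pi * Im s / 2)))"
proof -
  have "b powr (2 * Re s + 1) = b powr Re s * b powr (Re s + 1)" by (simp add: powr_add[symmetric])
  moreover have "exp (pi * Im s) = exp (pi * Im s / 2) * exp (pi * Im s / 2)" by (simp add: exp_add[symmetric])
  ultimately show ?thesis by (simp add: amplitude_def)
qed

lemma K_resc_eq_reciprocal_kernel:
  assumes s: "Re s > - 1 / 2" and N: "N \<ge> 1" and xy: "x > 0" "y > 0"
  shows "K_resc s N x y = reciprocal_kernel (Re s) (fin_f s N) (fin_h s N) x y"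
proof (rule kernel_eq_reciprocal_kernel[OF _ _ _ isCont_K_resc xy])
  show "fin_f s N holomorphic_on strip" "fin_h s N holomorphic_on strip"
    using boundedly_convergesD(2)[OF fin_converges(1)[OF s] N] boundedly_convergesD(2)[OF fin_converges(2)[OF s] N] .
  fix x y :: real assume xy: "x > 0" "y > 0" "x \<noteq> y"
  define r where "r u = complex_of_real (sqrt (w_H s N (real N * u)))" for u
  define P where "P u = p_tilde s N (real N * u) * r u" for u
  define Q where "Q u = p_pred s N (real N * u) * r u" for u
  define A where "A = complex_of_real ((1 / real N) powr Re s * exp (pi * Im s / 2))"
  define B where "B = complex_of_real ((1 / real N) powr (Re s + 1) * exp (pi * Im s / 2))"
  have N0: "real N > 0" using N by simp
  have inv: "(1 / real N) powr a = real N powr (- a)" for a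
    using powr_divide[of 1 "real N" a] powr_minus[of "real N" a] N0 by (simp add: inverse_eq_divide)
  have "K_resc s N x y = of_nat N * (C_const s N *
      ((p_tilde s N (real N * x) * p_pred s N (real N * y) - p_pred s N (real N * x) * p_tilde s N (real N * y)) / of_real (real N * x - real N * y)) *
      of_real (sqrt (w_H s N (real N * x) * w_H s N (real N * y))))"
    using xy N0 by (simp add: K_resc_def K_fin_def)
  also have "complex_of_real (real N * x - real N * y) = of_nat N * of_real (x - y)" by (simp add: algebra_simps)
  also have "complex_of_real (sqrt (w_H s N (real N * x) * w_H s N (real N * y))) = r x * r y"
    by (simp add: r_def real_sqrt_mult)
  also have "of_nat N * (C_const s N *
      ((p_tilde s N (real N * x) * p_pred s N (real N * y) - p_pred s N (real N * x) * p_tilde s N (real N * y)) / (of_nat N * of_real (x - y))) *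
      (r x * r y)) = C_const s N * ((P x * Q y - Q x * P y) / of_real (x - y))"
  proof -
    have "of_nat N * (c * (d / (of_nat N * e)) * (u * v)) = c * (d * (u * v) / e)" for c d e u v :: complex
      using N0 by simp
    moreover have "(p_tilde s N (real N * x) * p_pred s N (real N * y) - p_pred s N (real N * x) * p_tilde s N (real N * y)) * (r x * r y)
        = P x * Q y - Q x * P y" by (simp add: P_def Q_def algebra_simps)
    ultimately show ?thesis by simp
  qed
  also have "\<dots> = reciprocal_kernel (Re s) (\<lambda>z. C_const s N * A * B * (finite_hyp 0 s (2 * Re s + 1) N z * weight_factor s N z))
      (\<lambda>z. z * (finite_hyp 1 (s + 1) (2 * Re s + 2) N z * weight_factor s N z)) x y"
  proof (rule wronskian_kernel_reciprocal[OF _ _ xy])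
    fix u :: real assume u: "u > 0"
    have Nu: "real N * u > 0" using N0 u by simp
    note R = r_def sqrt_w_H_scaled[OF u N]
    have pw: "of_real (real N * u) ^ m * complex_of_real ((real N * u) powr a) = of_real ((real N * u) powr (real m + a))" for m a
      using Nu by (simp add: powr_add powr_realpow flip: of_real_power of_real_mult)
    have "P u = (of_real (real N * u) ^ N * of_real ((real N * u) powr (- Re s - real N))) * of_real (exp (pi * Im s / 2)) *
        (finite_hyp 0 s (2 * Re s + 1) N (of_real (1 / u)) * weight_factor s N (of_real (1 / u)))"
      unfolding P_def R p_tilde_scaled[OF u N] of_real_mult[of "_ powr _"] by (simp only: mult_ac)
    also have "of_real (real N * u) ^ N * complex_of_real ((real N * u) powr (- Re s - real N)) = of_real ((1 / real N) powr Re s * u powr (- Re s))"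
      unfolding pw inv using N0 u by (simp add: powr_mult)
    finally show "P u = A * of_real (u powr (- Re s)) * (finite_hyp 0 s (2 * Re s + 1) N (of_real (1 / u)) * weight_factor s N (of_real (1 / u)))"
      unfolding A_def by (simp only: of_real_mult mult_ac)
    have "Q u = (of_real (real N * u) ^ (N - 1) * of_real ((real N * u) powr (- Re s - real N))) * of_real (exp (pi * Im s / 2)) *
        (finite_hyp 1 (s + 1) (2 * Re s + 2) N (of_real (1 / u)) * weight_factor s N (of_real (1 / u)))"
      unfolding Q_def R p_pred_scaled[OF u N] of_real_mult[of "_ powr _"] by (simp only: mult_ac)
    also have "of_real (real N * u) ^ (N - 1) * complex_of_real ((real N * u) powr (- Re s - real N)) = of_real ((1 / real N) powr (Re s + 1) * u powr (- Re s - 1))"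
    proof -
      have e: "real (N - 1) + (- Re s - real N) = - Re s - 1" "- (Re s + 1) = - Re s - 1"
        using N by (simp_all add: of_nat_diff)
      show ?thesis unfolding pw inv e using N0 u by (simp add: powr_mult)
    qed
    finally show "Q u = B * of_real (u powr (- Re s - 1)) * (finite_hyp 1 (s + 1) (2 * Re s + 2) N (of_real (1 / u)) * weight_factor s N (of_real (1 / u)))"
      unfolding B_def by (simp only: of_real_mult mult_ac)
  qed
  also have "(\<lambda>z. C_const s N * A * B * (finite_hyp 0 s (2 * Re s + 1) N z * weight_factor s N z)) = fin_f s N"
    using N0 by (simp add: fin_f_def[abs_def] amplitude_split A_def B_def mult.assoc)
  also have "(\<lambda>z. z * (finite_hyp 1 (s + 1) (2 * Re s + 2) N z * weight_factor s N z)) = fin_h s N"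
    by (simp add: fin_h_def[abs_def])
  finally show "K_resc s N x y = reciprocal_kernel (Re s) (fin_f s N) (fin_h s N) x y" .
qed

lemma limit_functions_reciprocal:
  fixes s :: complex and u :: real
  assumes u: "u > 0"
  shows P_tilde_reciprocal: "P_tilde s u = of_real (2 powr Re s * exp (pi * Im s / 2)) * of_real (u powr (- Re s)) *
      (exp (- \<i> * of_real (1 / u)) * hyp1F1 s (of_real (2 * Re s + 1)) (2 * \<i> * of_real (1 / u)))"
    and Q_lim_reciprocal: "Q_lim s u = of_real (2 powr (Re s + 1) * exp (pi * Im s / 2)) * of_real (u powr (- Re s - 1)) *
      (exp (- \<i> * of_real (1 / u)) * hyp1F1 (s + 1) (of_real (2 * Re s + 2)) (2 * \<i> * of_real (1 / u)))"
proof -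
  have p: "\<bar>2 / u\<bar> powr a = 2 powr a * u powr (- a)" for a
    using u powr_divide[of 2 u a] powr_minus[of u a] by (simp add: divide_inverse)
  have q: "2 / u * \<bar>2 / u\<bar> powr Re s = 2 powr (Re s + 1) * u powr (- Re s - 1)"
  proof -
    have "2 / u * \<bar>2 / u\<bar> powr Re s = \<bar>2 / u\<bar> powr (Re s + 1)" using u by (simp add: powr_add)
    also have "\<dots> = 2 powr (Re s + 1) * u powr (- (Re s + 1))" by (rule p)
    finally show ?thesis by simp
  qed
  have e: "exp (- \<i> / of_real u + of_real (pi * Im s * sgn u / 2)) = exp (- \<i> * of_real (1 / u)) * of_real (exp (pi * Im s / 2))"
  proof -
    have "- \<i> / of_real u + of_real (pi * Im s * sgn u / 2) = - \<i> * of_real (1 / u) + complex_of_real (pi * Im s / 2)"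
      using u by simp
    then show ?thesis by (simp only: exp_add exp_of_real)
  qed
  have z: "2 * \<i> / of_real u = 2 * \<i> * complex_of_real (1 / u)" by simp
  show "P_tilde s u = of_real (2 powr Re s * exp (pi * Im s / 2)) * of_real (u powr (- Re s)) *
      (exp (- \<i> * of_real (1 / u)) * hyp1F1 s (of_real (2 * Re s + 1)) (2 * \<i> * of_real (1 / u)))"
    unfolding P_tilde_def p e z by (simp only: of_real_mult mult_ac)
  show "Q_lim s u = of_real (2 powr (Re s + 1) * exp (pi * Im s / 2)) * of_real (u powr (- Re s - 1)) *
      (exp (- \<i> * of_real (1 / u)) * hyp1F1 (s + 1) (of_real (2 * Re s + 2)) (2 * \<i> * of_real (1 / u)))"
    unfolding Q_lim_def q e z by (simp only: of_real_mult mult_ac)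
qed

lemma reciprocal_differentiable:
  fixes F :: "real \<Rightarrow> complex"
  assumes g: "g holomorphic_on strip" and x: "x > 0"
    and F: "\<And>u. u > 0 \<Longrightarrow> F u = A * of_real (u powr a) * g (of_real (1 / u))"
  shows "(F has_vector_derivative vector_derivative F (at x)) (at x)"
proof -
  have "((\<lambda>u. u powr a) has_real_derivative a * x powr (a - 1)) (at x)"
    using x by (intro has_real_derivative_powr)
  then have "((\<lambda>u. complex_of_real (u powr a)) has_vector_derivative of_real (a * x powr (a - 1))) (at x)"
    unfolding has_real_derivative_iff_has_vector_derivative by (rule bounded_linear.has_vector_derivative[OF bounded_linear_of_real])
  from has_vector_derivative_mult[OF has_vector_derivative_mult[OF has_vector_derivative_const[of A] this] has_vector_derivative_reciprocal[OF g x]]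
  have "\<exists>D. ((\<lambda>u. A * of_real (u powr a) * g (of_real (1 / u))) has_vector_derivative D) (at x)" by blast
  then obtain D where "((\<lambda>u. A * of_real (u powr a) * g (of_real (1 / u))) has_vector_derivative D) (at x)" ..
  then have "(F has_vector_derivative D) (at x)"
    by (rule has_vector_derivative_transform_within_open[where S = "{0<..}"]) (use x F in auto)
  then have "F differentiable (at x)" by (rule differentiableI_vector)
  then show ?thesis by (simp add: vector_derivative_works)
qed

lemma exp_hyp1F1_holomorphic:
  assumes "c > 0"
  shows "(\<lambda>z. exp (- \<i> * z) * hyp1F1 a (of_real c) (2 * \<i> * z)) holomorphic_on strip"
  using boundedly_convergesD(3)[OF finite_hyp_converges[OF assms, of 0 a]] .

lemma isCont_K_infty:
  assumes s: "Re s > - 1 / 2" and x: "x > 0"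
  shows "isCont (K_infty s x) x"
proof -
  have P: "(P_tilde s has_vector_derivative vector_derivative (P_tilde s) (at x)) (at x)"
    by (rule reciprocal_differentiable[OF exp_hyp1F1_holomorphic x P_tilde_reciprocal]) (use s in auto)
  have Q: "(Q_lim s has_vector_derivative vector_derivative (Q_lim s) (at x)) (at x)"
    by (rule reciprocal_differentiable[OF exp_hyp1F1_holomorphic x Q_lim_reciprocal]) (use s in auto)
  have "((\<lambda>y. c_const s * ((P_tilde s x * Q_lim s y - Q_lim s x * P_tilde s y) / of_real (x - y))) \<longlongrightarrow> K_infty s x x) (at x)"
    using tendsto_mult[OF tendsto_const wronskian_kernel_diagonal_limit[OF P Q], of "c_const s"]
    by (simp add: K_infty_def mult.commute)
  then show ?thesis unfolding isCont_def
    by (rule Lim_transform_eventually) (auto simp: eventually_at_filter K_infty_def)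
qed

lemma K_infty_eq_reciprocal_kernel:
  assumes s: "Re s > - 1 / 2" and xy: "x > 0" "y > 0"
  shows "K_infty s x y = reciprocal_kernel (Re s) (lim_f s) (lim_h s) x y"
proof (rule kernel_eq_reciprocal_kernel[OF _ _ _ isCont_K_infty[OF s] xy])
  show "lim_f s holomorphic_on strip" "lim_h s holomorphic_on strip"
    using boundedly_convergesD(3)[OF fin_converges(1)[OF s]] boundedly_convergesD(3)[OF fin_converges(2)[OF s]] .
  fix x y :: real assume xy: "x > 0" "y > 0" "x \<noteq> y"
  have "K_infty s x y = c_const s * ((P_tilde s x * Q_lim s y - Q_lim s x * P_tilde s y) / of_real (x - y))"
    using xy by (simp add: K_infty_def)
  also note wronskian_kernel_reciprocal[OF P_tilde_reciprocal Q_lim_reciprocal xy]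
  finally show "K_infty s x y = reciprocal_kernel (Re s) (lim_f s) (lim_h s) x y"
    by (simp add: lim_f_def[abs_def] lim_h_def[abs_def] amplitude_split mult.assoc)
qed

lemma boundedly_converges_compose:
  assumes F: "boundedly_converges F f V" and U: "open U" and g: "g holomorphic_on U" "\<And>z. z \<in> U \<Longrightarrow> g z \<in> V"
  shows "boundedly_converges (\<lambda>n z. F n (g z)) (\<lambda>z. f (g z)) U"
proof (rule boundedly_convergesI)
  note D = boundedly_convergesD[OF F]
  show "(\<lambda>z. F n (g z)) holomorphic_on U" if "n \<ge> 1" for n
    using holomorphic_on_compose_gen[OF g(1) D(2)[OF that]] g(2) by (auto simp: o_def)
  show "(\<lambda>z. f (g z)) holomorphic_on U"
    using holomorphic_on_compose_gen[OF g(1) D(3)] g(2) by (auto simp: o_def)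
  show "(\<lambda>n. F n (g z)) \<longlonglongrightarrow> f (g z)" if "z \<in> U" for z by (intro D(4) g(2) that)
  fix K assume K: "compact K" "K \<subseteq> U"
  have "compact (g ` K)" "g ` K \<subseteq> V"
    using K g by (auto intro!: compact_continuous_image continuous_on_subset[OF holomorphic_on_imp_continuous_on])
  from D(5)[OF this] show "\<exists>B. \<forall>\<^sub>F n in sequentially. \<forall>z\<in>K. cmod (F n (g z)) \<le> B" by simp
qed (rule U)

theorem theorem1p4:
  fixes s :: complex
    and F_N :: "nat \<Rightarrow> real \<Rightarrow> real" and F_infty :: "real \<Rightarrow> real"
  assumes s: "Re s > - 1 / 2"
  defines "F_N \<equiv> (\<lambda>N t. Re (fredholm_det (K_resc s N) t))"
    and "F_infty \<equiv> (\<lambda>t. Re (fredholm_det (K_infty s) t))"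
  shows "(\<forall>N\<ge>1. (\<forall>t>0. fredholm_converges (K_resc s N) t \<and> fredholm_det (K_resc s N) t \<in> \<real>) \<and>
                 C_class_on 3 {0<..} (F_N N)) \<and>
         (\<forall>t>0. fredholm_converges (K_infty s) t \<and> fredholm_det (K_infty s) t \<in> \<real>) \<and>
         C_class_on 3 {0<..} F_infty \<and>
         (\<forall>p\<in>{0, 1, 2, 3}. \<forall>t>0.
            (\<lambda>N. (deriv ^^ p) (F_N N) t) \<longlonglongrightarrow> (deriv ^^ p) F_infty t)"
proof -
  note bf = fin_converges(1)[OF s] and bh = fin_converges(2)[OF s]
  \<comment> \<open>\<Phi> and \<Psi> below continue the determinants from real \<open>t\<close> to the complex neighbourhood \<open>U\<close> of the half-line.\<close>
  define U where "U = {z. Re z > 0} \<inter> (\<lambda>z. 1 / z) -` half_strip"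
  have "continuous_on {z. Re z > 0} (\<lambda>z. 1 / z)" by (intro continuous_intros) auto
  then have U: "open U"
    unfolding U_def by (intro continuous_open_preimage open_halfspace_Re_gt open_half_strip)
  define \<Phi> where "\<Phi> N z = kernel_fredholm (Re s) (fin_f s N) (fin_h s N) (1 / z)" for N z
  define \<Psi> where "\<Psi> z = kernel_fredholm (Re s) (lim_f s) (lim_h s) (1 / z)" for z
  have inv: "(\<lambda>z. 1 / z) holomorphic_on U" unfolding U_def by (intro holomorphic_intros) auto
  have conv: "boundedly_converges \<Phi> \<Psi> U"
    unfolding \<Phi>_def[abs_def] \<Psi>_def[abs_def]
    by (rule boundedly_converges_compose[OF kernel_fredholm_converges[OF s bf bh] U inv]) (auto simp: U_def)
  have tU: "complex_of_real t \<in> U" if "t > 0" for t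
    using that by (simp add: U_def half_strip_def)
  have N_det: "fredholm_det (K_resc s N) t = \<Phi> N (of_real t)" "fredholm_converges (K_resc s N) t"
    if "N \<ge> 1" "t > 0" for N t
  proof -
    note h = boundedly_convergesD(2)[OF bf that(1)] boundedly_convergesD(2)[OF bh that(1)]
    show "fredholm_det (K_resc s N) t = \<Phi> N (of_real t)"
      using fredholm_det_reciprocal_kernel[OF s h K_resc_eq_reciprocal_kernel[OF s that(1)] that(2)] by (simp add: \<Phi>_def)
    show "fredholm_converges (K_resc s N) t"
      by (rule fredholm_converges_reciprocal_kernel[OF s h K_resc_eq_reciprocal_kernel[OF s that(1)] that(2)])
  qed
  note h = boundedly_convergesD(3)[OF bf] boundedly_convergesD(3)[OF bh]
  have inf_det: "fredholm_det (K_infty s) t = \<Psi> (of_real t)" "fredholm_converges (K_infty s) t" if "t > 0" for t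
  proof -
    show "fredholm_det (K_infty s) t = \<Psi> (of_real t)"
      using fredholm_det_reciprocal_kernel[OF s h K_infty_eq_reciprocal_kernel[OF s] that] by (simp add: \<Psi>_def)
    show "fredholm_converges (K_infty s) t"
      by (rule fredholm_converges_reciprocal_kernel[OF s h K_infty_eq_reciprocal_kernel[OF s] that])
  qed
  have N_real: "fredholm_det (K_resc s N) t \<in> \<real>" if "N \<ge> 1" "t > 0" for N t
    by (rule fredholm_det_real[OF K_resc_real[OF s that(1)] N_det(2)[OF that]])
  have inf_real: "fredholm_det (K_infty s) t \<in> \<real>" if "t > 0" for t
  proof -
    have "\<forall>\<^sub>F N in sequentially. \<Phi> N (of_real t) \<in> \<real>"
      using eventually_ge_at_top[of 1] by eventually_elim (use N_real N_det(1) that in metis)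
    from Lim_in_closed_set[OF closed_complex_Reals this _ boundedly_convergesD(4)[OF conv tU[OF that]]]
    show ?thesis using inf_det(1)[OF that] by simp
  qed
  have FN: "F_N N t = Re (\<Phi> N (of_real t))" if "N \<ge> 1" "t \<in> {0<..}" for N t
    using N_det(1)[OF that(1)] that(2) by (simp add: F_N_def)
  have Finf: "F_infty t = Re (\<Psi> (of_real t))" if "t \<in> {0<..}" for t
    using inf_det(1) that by (simp add: F_infty_def)
  have tU': "complex_of_real t \<in> U" if "t \<in> {0<..}" for t using tU that by simp
  have CN: "C_class_on 3 {0<..} (F_N N)" if "N \<ge> 1" for N
    by (rule C_class_on_Re_real_line[OF U boundedly_convergesD(2)[OF conv that] open_greaterThan tU' FN[OF that]])
  have Cinf: "C_class_on 3 {0<..} F_infty"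
    by (rule C_class_on_Re_real_line[OF U boundedly_convergesD(3)[OF conv] open_greaterThan tU' Finf])
  have lim: "(\<lambda>N. (deriv ^^ p) (F_N N) t) \<longlonglongrightarrow> (deriv ^^ p) F_infty t" if t: "t > 0" for p t
  proof -
    have t': "t \<in> {0<..}" using t by simp
    have "(\<lambda>N. Re ((deriv ^^ p) (\<Phi> N) (of_real t))) \<longlonglongrightarrow> Re ((deriv ^^ p) \<Psi> (of_real t))"
      by (intro tendsto_Re boundedly_converges_higher_deriv_tendsto[OF conv tU[OF t]])
    also have "Re ((deriv ^^ p) \<Psi> (of_real t)) = (deriv ^^ p) F_infty t"
      by (rule higher_deriv_Re_real_line(1)[OF U boundedly_convergesD(3)[OF conv] open_greaterThan tU' Finf t', symmetric])
    finally show ?thesis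
    proof (rule Lim_transform_eventually)
      show "\<forall>\<^sub>F N in sequentially. Re ((deriv ^^ p) (\<Phi> N) (of_real t)) = (deriv ^^ p) (F_N N) t"
        using eventually_ge_at_top[of 1]
      proof eventually_elim
        case (elim N)
        show ?case
          by (rule higher_deriv_Re_real_line(1)[OF U boundedly_convergesD(2)[OF conv elim] open_greaterThan tU' FN[OF elim] t', symmetric])
      qed
    qed
  qed
  show ?thesis using N_det(2) N_real CN inf_det(2) inf_real Cinf lim by blast
qed

end
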